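(* Let $\mathbb{K}$ be a field, let $G$ be a connected closed graph on $[n]$, and let $R=\mathbb{K}[x_1,\dots,x_n,y_1,\dots,y_n]$. Then $\mathrm{v}(J_G^k)\leq \operatorname{reg}(R/J_G^k)$ for all $k\geq 1$.
   Context: $[n]=\{1,\dots,n\}$ and $R$ has the standard grading. The binomial edge ideal of $G$ is $J_G=(x_iy_j-x_jy_i: i<j,\ \{i,j\}\in E(G))\subseteq R$. A simple graph $G$ on $n$ vertices is closed if its vertices can be labelled by $[n]$ such that for all edges $\{i,j\},\{k,\ell\}$ with $i<j$ and $k<\ell$: if $i=k$ and $j\neq \ell$ then $\{j,\ell\}\in E(G)$, and if $j=\ell$ and $i\ne k$ then $\{i,k\}\in E(G)$ (equivalently, for this labelling the generators of $J_G$ form a Gröbner basis with respect to the lexicographic order with $x_1>\dots>x_n>y_1>\dots>y_n$). For a graded ideal $I\subset R$, the $\mathrm{v}$-number is $\mathrm{v}(I)=\min\{d\ge 0:\exists f\in R_d \text{ and } \mathfrak p\in\mathrm{Ass}(I) \text{ with } I:f=\mathfrak p\}$, and $\operatorname{reg}(R/I)=\max\{j-i:\beta_{i,j}(R/I)\neq 0\}$ is the Castelnuovo–Mumford regularity. *)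

theory Defs
  imports
    "HOL-Library.Poly_Mapping"
    "HOL-Library.Extended_Real"
    "Jordan_Normal_Form.Matrix_Kernel"
begin

section \<open>The polynomial ring\<close>

text \<open>
  The vertex set \<open>[n]\<close> is a type \<open>'n\<close> of sort \<open>{finite, linorder}\<close>, with \<open>n = card (UNIV :: 'n set) \<ge> 1\<close>.
  The ring \<open>R = K[x\<^sub>1,\<dots>,x\<^sub>n,y\<^sub>1,\<dots>,y\<^sub>n]\<close> is the whole type \<open>('n, 'k) xy_poly\<close>: finitely
  supported functions from monomials to coefficients, with convolution as multiplication.
\<close>

datatype 'n var = X 'n | Y 'n

type_synonym ('n, 'k) xy_poly = "('n var \<Rightarrow>\<^sub>0 nat) \<Rightarrow>\<^sub>0 'k"

definition x_var :: "'n \<Rightarrow> ('n, 'k::field) xy_poly"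
  where "x_var i = Poly_Mapping.single (Poly_Mapping.single (X i) 1) 1"

definition y_var :: "'n \<Rightarrow> ('n, 'k::field) xy_poly"
  where "y_var i = Poly_Mapping.single (Poly_Mapping.single (Y i) 1) 1"

definition monom_degree :: "('n var \<Rightarrow>\<^sub>0 nat) \<Rightarrow> nat"
  where "monom_degree m = (\<Sum>v\<in>Poly_Mapping.keys m. Poly_Mapping.lookup m v)"

text \<open>The degree ranges over \<open>int\<close>, so that \<open>R\<^sub>d = 0\<close> for \<open>d < 0\<close>.\<close>

definition graded_component :: "int \<Rightarrow> ('n, 'k::field) xy_poly set"
  where "graded_component d = {f. \<forall>m\<in>Poly_Mapping.keys f. int (monom_degree m) = d}"


section \<open>Ideals\<close>

text \<open>Ideals of a commutative ring are its submodules as a module over itself.\<close>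

abbreviation is_ideal :: "'a::comm_ring_1 set \<Rightarrow> bool"
  where "is_ideal \<equiv> Modules.module.subspace (*)"

abbreviation ideal_span :: "'a::comm_ring_1 set \<Rightarrow> 'a set"
  where "ideal_span \<equiv> Modules.module.span (*)"

definition ideal_times :: "'a::comm_ring_1 set \<Rightarrow> 'a set \<Rightarrow> 'a set"
  where "ideal_times I J = ideal_span {a * b | a b. a \<in> I \<and> b \<in> J}"

primrec ideal_power :: "'a::comm_ring_1 set \<Rightarrow> nat \<Rightarrow> 'a set"
  where
    "ideal_power I 0 = UNIV"
  | "ideal_power I (Suc k) = ideal_times I (ideal_power I k)"

definition is_prime_ideal :: "'a::comm_ring_1 set \<Rightarrow> bool"
  where "is_prime_ideal P \<longleftrightarrow>
    is_ideal P \<and> P \<noteq> UNIV \<and> (\<forall>a b. a * b \<in> P \<longrightarrow> a \<in> P \<or> b \<in> P)"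

definition ideal_colon :: "'a::comm_ring_1 set \<Rightarrow> 'a \<Rightarrow> 'a set"
  where "ideal_colon I f = {g. g * f \<in> I}"

text \<open>\<open>Ass(I)\<close> denotes the associated primes of the module \<open>R/I\<close>; the annihilator of the class
  of \<open>f\<close> in \<open>R/I\<close> is \<open>I : f\<close>.\<close>

definition associated_primes :: "'a::comm_ring_1 set \<Rightarrow> 'a set set"
  where "associated_primes I = {P. is_prime_ideal P \<and> (\<exists>f. P = ideal_colon I f)}"

definition v_number :: "('n, 'k::field) xy_poly set \<Rightarrow> nat"
  where "v_number I =
    (LEAST d. \<exists>f\<in>graded_component (int d). \<exists>P\<in>associated_primes I. ideal_colon I f = P)"


section \<open>Graded Betti numbers and regularity\<close>

definition irrelevant_ideal :: "('n, 'k::field) xy_poly set"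
  where "irrelevant_ideal = ideal_span (range x_var \<union> range y_var)"

text \<open>
  A minimal graded free resolution
  \<open>\<cdots> \<rightarrow> F\<^sub>2 \<rightarrow> F\<^sub>1 \<rightarrow> F\<^sub>0 = R \<rightarrow> R/I \<rightarrow> 0\<close>
  of \<open>R/I\<close>, for a proper graded ideal \<open>I\<close>, with the canonical projection as augmentation. It is
  encoded by \<open>D\<close> and \<open>M\<close>: the list \<open>D i\<close> contains the degrees of a homogeneous basis of \<open>F\<^sub>i\<close>,
  that is, \<open>F\<^sub>i\<close> is the direct sum of the \<open>R(-d)\<close> for \<open>d\<close> in \<open>D i\<close>, and for \<open>i \<ge> 1\<close> the matrix
  \<open>M i\<close> represents the differential \<open>F\<^sub>i \<rightarrow> F\<^bsub>i-1\<^esub>\<close> acting on column vectors. (\<open>M 0\<close> is not used.)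
  The degrees may be taken in \<open>nat\<close> because \<open>R/I\<close> lives in nonnegative degrees and the resolution
  is minimal.

  The four conditions after the shape of \<open>F\<^sub>0\<close> and of the matrices say that the differentials are
  homogeneous of degree 0, that the image of \<open>F\<^sub>1\<close> in \<open>R\<close> is \<open>I\<close> (exactness at \<open>F\<^sub>0\<close>), exactness
  at \<open>F\<^sub>i\<close> for \<open>i \<ge> 1\<close>, and that each \<open>F\<^sub>i\<close> is mapped into the irrelevant ideal times \<open>F\<^bsub>i-1\<^esub>\<close>.
\<close>

definition minimal_graded_free_resolution ::
  "('n, 'k::field) xy_poly set \<Rightarrow> (nat \<Rightarrow> nat list) \<Rightarrow> (nat \<Rightarrow> ('n, 'k) xy_poly mat) \<Rightarrow> bool"
  where "minimal_graded_free_resolution I D M \<longleftrightarrow>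
    D 0 = [0] \<and>
    (\<forall>i\<ge>1. M i \<in> carrier_mat (length (D (i - 1))) (length (D i))) \<and>
    (\<forall>i\<ge>1. \<forall>r<length (D (i - 1)). \<forall>c<length (D i).
        M i $$ (r, c) \<in> graded_component (int (D i ! c) - int (D (i - 1) ! r))) \<and>
    {M 1 *\<^sub>v v | v. v \<in> carrier_vec (length (D 1))} = {w \<in> carrier_vec 1. w $ 0 \<in> I} \<and>
    (\<forall>i\<ge>1. {M (i + 1) *\<^sub>v v | v. v \<in> carrier_vec (length (D (i + 1)))} = mat_kernel (M i)) \<and>
    (\<forall>i\<ge>1. \<forall>r<length (D (i - 1)). \<forall>c<length (D i). M i $$ (r, c) \<in> irrelevant_ideal)"

text \<open>
  \<open>graded_betti I i j\<close> is the graded Betti number \<open>\<beta>\<^bsub>i,j\<^esub>(R/I)\<close> of a proper graded ideal \<open>I\<close>, that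
  is, the number of copies of \<open>R(-j)\<close> in \<open>F\<^sub>i\<close>. Minimal graded free resolutions exist and are unique
  up to isomorphism, so the result of the choice below does not matter.
\<close>

definition graded_betti :: "('n, 'k::field) xy_poly set \<Rightarrow> nat \<Rightarrow> nat \<Rightarrow> nat"
  where "graded_betti I i j =
    count_list ((SOME D. \<exists>M. minimal_graded_free_resolution I D M) i) j"

text \<open>
  \<open>regularity I\<close> is \<open>reg(R/I)\<close>. The set of all \<open>j - i\<close> is finite by Hilbert's syzygy theorem and
  contains 0, so its supremum in \<open>ereal\<close> is its maximum.
\<close>

definition regularity :: "('n, 'k::field) xy_poly set \<Rightarrow> ereal"
  where "regularity I = Sup {ereal (real j - real i) | i j. graded_betti I i j \<noteq> 0}"


section \<open>Graphs and binomial edge ideals\<close>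

text \<open>A simple graph with vertex set \<open>UNIV :: 'n set\<close> is given by its set of edges.\<close>

definition simple_graph :: "'n set set \<Rightarrow> bool"
  where "simple_graph E \<longleftrightarrow> (\<forall>e\<in>E. card e = 2)"

definition connected_graph :: "'n set set \<Rightarrow> bool"
  where "connected_graph E \<longleftrightarrow> (\<forall>u v. (u, v) \<in> {(a, b). {a, b} \<in> E}\<^sup>*)"

definition closed_graph :: "'n::finite set set \<Rightarrow> bool"
  where "closed_graph E \<longleftrightarrow>
    (\<exists>label :: 'n \<Rightarrow> nat. bij_betw label UNIV {1..card (UNIV :: 'n set)} \<and>
      (\<forall>i j k l. {i, j} \<in> E \<and> {k, l} \<in> E \<and> label i < label j \<and> label k < label l \<longrightarrow>
        (i = k \<and> j \<noteq> l \<longrightarrow> {j, l} \<in> E) \<and> (j = l \<and> i \<noteq> k \<longrightarrow> {i, k} \<in> E)))"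

definition binomial_edge_ideal :: "'n::linorder set set \<Rightarrow> ('n, 'k::field) xy_poly set"
  where "binomial_edge_ideal E =
    ideal_span {x_var i * y_var j - x_var j * y_var i | i j. i < j \<and> {i, j} \<in> E}"

end

theory Submission
  imports Defs "HOL-Library.Function_Algebras"
begin

text \<open>
  Number the vertices by the closed labelling and let \<open>c\<^sub>0, \<dots>, c\<^sub>l\<close> be the greedy path from the first to the
  last vertex; it is induced, and its inner vertices dominate the graph (if \<open>l = 1\<close>, the graph is complete). Write
  \<open>f\<^sub>u\<^sub>v = x\<^sub>u y\<^sub>v - x\<^sub>v y\<^sub>u\<close>, let \<open>J\<close> be the binomial edge ideal and \<open>P\<close> the prime ideal of all \<open>f\<^sub>u\<^sub>v\<close>.

  Upper bound: multiplication by the product of the \<open>x\<^sub>c\<close> over the inner vertices \<open>c\<close> of the path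
  maps \<open>P\<close> into \<open>J\<close>, and an order argument along a generic perturbation of the rank one matrices
  shows that \<open>J\<^sup>k : F = P\<close> if \<open>F\<close> is this product times the \<open>(k-1)\<close>-st power of some \<open>f\<^sub>u\<^sub>v\<close> with an edge
  \<open>uv\<close>. So the v-number is at most \<open>2(k-1) + l - 1\<close>.

  Lower bound: a linear specialization that kills all variables outside the path turns the
  generators of \<open>J\<close> into a complete intersection of \<open>l\<close> quadrics in \<open>l\<close> variables, and the quotient by
  the \<open>k\<close>-th power of the latter ideal is nonzero in degree \<open>2(k-1) + l\<close> and has finite length.
  Cutting down a free resolution of \<open>R/J\<^sup>k\<close> by one linear form at a time, a class of this
  degree climbs to step \<open>l\<close> of the resolution, so that the regularity is at least \<open>2(k-1) + l\<close>.
\<close>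

section \<open>Ideals\<close>

text \<open>The regularity refers to an arbitrarily chosen minimal resolution. The lower bound is
  therefore proved for every minimal graded free resolution, and the existence of one is derived
  from Hilbert's basis theorem, so that the choice has its intended meaning. The homology of the
  resolution modulo an ideal Q is Tor of R/I and R/Q, but it is handled through representatives:
  cycles, boundaries and connecting maps are equations modulo Q between families of polynomials. The
  specialization sends the y-row of the path to a shifted copy of its x-row; the minors of
  consecutive columns then become the square of u_i minus the product of its two neighbours, with
  the missing neighbours at both ends equal to 0. Primes and nonzerodivisors come from one source:
  the kernel of a substitution R -> R is prime because R is a domain.\<close>

interpretation ring_module: Modules.module "(*) :: 'a::comm_ring_1 \<Rightarrow> 'a \<Rightarrow> 'a"
  by unfold_locales (auto simp: algebra_simps)

text \<open>For multiplication this rule is associativity read backwards; as a simp rule it would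
  loop with \<open>mult.assoc\<close> and \<open>ac_simps\<close>.\<close>

declare ring_module.scale_scale [simp del]

lemma ideal_mult_left: "is_ideal I \<Longrightarrow> a \<in> I \<Longrightarrow> b * a \<in> I" for I :: "'a::comm_ring_1 set"
  by (rule ring_module.subspace_scale)

lemma ideal_mult_right: "is_ideal I \<Longrightarrow> a \<in> I \<Longrightarrow> a * b \<in> I" for I :: "'a::comm_ring_1 set"
  by (metis ideal_mult_left mult.commute)

lemma is_ideal_ideal_times [intro]: "is_ideal (ideal_times I J)"
  unfolding ideal_times_def by (rule ring_module.subspace_span)

lemma is_ideal_ideal_power [intro]: "is_ideal (ideal_power I k)"
  by (cases k) (auto simp: ring_module.subspace_UNIV)

lemma ideal_times_mem: "a \<in> I \<Longrightarrow> b \<in> J \<Longrightarrow> a * b \<in> ideal_times I J"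
  unfolding ideal_times_def by (rule ring_module.span_base) blast

lemma ideal_times_subset:
  assumes "is_ideal K" and "\<And>a b. a \<in> I \<Longrightarrow> b \<in> J \<Longrightarrow> a * b \<in> K"
  shows "ideal_times I J \<subseteq> K"
  unfolding ideal_times_def by (rule ring_module.span_minimal) (use assms in auto)

lemma ideal_power_1 [simp]:
  assumes "is_ideal I"
  shows "ideal_power I (Suc 0) = I"
proof
  show "ideal_power I (Suc 0) \<subseteq> I"
    unfolding ideal_power.simps by (rule ideal_times_subset) (use assms ideal_mult_right in auto)
  show "I \<subseteq> ideal_power I (Suc 0)"
    using ideal_times_mem[of _ I 1 UNIV] by auto
qed

lemma power_mem_ideal_power: "a \<in> I \<Longrightarrow> a ^ k \<in> ideal_power I k"
  by (induction k) (auto intro: ideal_times_mem)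

lemma power_mult_mem_ideal_power:
  assumes "a \<in> I" and "b \<in> ideal_power I k"
  shows "a ^ j * b \<in> ideal_power I (j + k)"
  using assms by (induction j) (auto simp: mult.assoc intro: ideal_times_mem)

lemma ideal_power_subset:
  assumes "is_ideal I" and "k \<ge> 1"
  shows "ideal_power I k \<subseteq> I"
proof -
  obtain j where "k = Suc j" using assms(2) by (cases k) auto
  then show ?thesis
    using ideal_times_subset[OF assms(1), of I "ideal_power I j"] ideal_mult_right[OF assms(1)] by auto
qed

text \<open>This reduces a containment of powers to single generators: each of them only has to
  raise the index of the filtration by one. It serves for basis expansions, for orders of
  divisibility and for preimages under substitutions.\<close>

lemma ideal_power_subset_filtration:
  assumes "K 0 = UNIV" and "\<And>j. is_ideal (K j)"
    and "\<And>a b j. a \<in> S \<Longrightarrow> b \<in> K j \<Longrightarrow> a * b \<in> K (Suc j)"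
  shows "ideal_power (ideal_span S) k \<subseteq> K k"
proof (induction k)
  case (Suc k)
  show ?case unfolding ideal_power.simps
  proof (rule ideal_times_subset)
    fix a b assume a: "a \<in> ideal_span S" and b: "b \<in> ideal_power (ideal_span S) k"
    \<comment> \<open>For fixed \<open>b\<close> the multipliers sending \<open>b\<close> into
      \<open>K (Suc k)\<close> form an ideal, so testing generators is enough.\<close>
    have "is_ideal {a. a * b \<in> K (Suc k)}"
      using assms(2)[of "Suc k"]
      by (auto simp: ring_module.subspace_def algebra_simps)
    with assms(3) b Suc have "ideal_span S \<subseteq> {a. a * b \<in> K (Suc k)}"
      by (intro ring_module.span_minimal) auto
    then show "a * b \<in> K (Suc k)" using a by auto
  qed (use assms in auto)
qed (use assms in auto)

lemma ideal_colon_is_ideal: "is_ideal I \<Longrightarrow> is_ideal (ideal_colon I f)"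
  unfolding ideal_colon_def by (auto simp: ring_module.subspace_def algebra_simps)

lemma ideal_span_insert_mem:
  assumes "f \<in> ideal_span (insert z S)"
  shows "\<exists>a q. q \<in> ideal_span S \<and> f = z * a + q"
  using ring_module.span_breakdown_eq[of f z S] assms
  by (metis add.commute diff_add_cancel mult.commute)

section \<open>Polynomials\<close>

lemma UNIV_var: "UNIV = range X \<union> range Y"
proof -
  have "v \<in> range X \<union> range Y" for v :: "'a var" by (cases v) auto
  then show ?thesis by auto
qed

instance var :: (finite) finite
  by standard (simp add: UNIV_var)

text \<open>The induced lexicographic order on monomials provides leading monomials for the basis
  theorem and makes the polynomial ring an instance of the classes without zero divisors.\<close>

instantiation var :: (linorder) linorder
begin

fun less_eq_var :: "'a var \<Rightarrow> 'a var \<Rightarrow> bool" where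
  "X i \<le> X j \<longleftrightarrow> i \<le> j"
| "X i \<le> Y j \<longleftrightarrow> True"
| "Y i \<le> X j \<longleftrightarrow> False"
| "Y i \<le> Y j \<longleftrightarrow> i \<le> j"

definition less_var :: "'a var \<Rightarrow> 'a var \<Rightarrow> bool" where
  "less_var u v \<longleftrightarrow> u \<le> v \<and> \<not> v \<le> u"

instance
proof
  fix u v w :: "'a var"
  show "u < v \<longleftrightarrow> u \<le> v \<and> \<not> v \<le> u" by (rule less_var_def)
  show "u \<le> u" by (cases u) auto
  show "u \<le> v \<Longrightarrow> v \<le> w \<Longrightarrow> u \<le> w" by (cases u; cases v; cases w) auto
  show "u \<le> v \<Longrightarrow> v \<le> u \<Longrightarrow> u = v" by (cases u; cases v) auto
  show "u \<le> v \<or> v \<le> u" by (cases u; cases v) auto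
qed

end

abbreviation xmon :: "('n var \<Rightarrow>\<^sub>0 nat) \<Rightarrow> ('n, 'k::field) xy_poly" where
  "xmon m \<equiv> Poly_Mapping.single m 1"

abbreviation cst :: "'k \<Rightarrow> ('n, 'k::field) xy_poly" where
  "cst c \<equiv> Poly_Mapping.single 0 c"

definition varp :: "'n var \<Rightarrow> ('n, 'k::field) xy_poly" where
  "varp v = xmon (Poly_Mapping.single v 1)"

lemma x_var_eq: "x_var i = varp (X i)" and y_var_eq: "y_var i = varp (Y i)"
  by (simp_all add: x_var_def y_var_def varp_def)

lemma poly_eq_sum_single: "f = (\<Sum>m\<in>Poly_Mapping.keys f. Poly_Mapping.single m (Poly_Mapping.lookup f m))"
  by (rule poly_mapping_eqI) (simp add: lookup_sum lookup_single when_def in_keys_iff)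

lemma poly_add_induct [case_names single add]:
  fixes P :: "('a \<Rightarrow>\<^sub>0 'b::comm_monoid_add) \<Rightarrow> bool"
  assumes "\<And>m c. P (Poly_Mapping.single m c)" and "\<And>f g. P f \<Longrightarrow> P g \<Longrightarrow> P (f + g)"
  shows "P f"
proof -
  have z: "P 0" using assms(1)[of undefined 0] by simp
  have "P (\<Sum>m\<in>A. Poly_Mapping.single m (Poly_Mapping.lookup f m))" if "finite A" for A
    using that by (induction A) (auto simp: z assms)
  then show ?thesis by (subst poly_eq_sum_single) simp
qed

lemma single_split: "Poly_Mapping.single m c = cst c * xmon m"
  by (simp add: mult_single)

lemma monom_eq_sum: "m = (\<Sum>v\<in>UNIV. Poly_Mapping.single v (Poly_Mapping.lookup m v))"
  for m :: "'n::finite var \<Rightarrow>\<^sub>0 nat"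
  by (rule poly_mapping_eqI) (simp add: lookup_sum lookup_single when_def)

lemma xmon_add: "xmon (a + b) = xmon a * xmon b"
  by (simp add: mult_single)

lemma xmon_sum: "finite A \<Longrightarrow> xmon (\<Sum>v\<in>A. h v) = (\<Prod>v\<in>A. xmon (h v))"
  by (induction A rule: finite_induct) (simp_all add: xmon_add)

lemma varp_power: "varp v ^ e = xmon (Poly_Mapping.single v e)"
  by (induction e) (simp_all add: varp_def mult_single single_add[symmetric])

lemma xmon_eq_prod: "xmon m = (\<Prod>v\<in>UNIV. varp v ^ Poly_Mapping.lookup m v)"
  for m :: "'n::finite var \<Rightarrow>\<^sub>0 nat"
  by (subst monom_eq_sum) (simp add: xmon_sum varp_power)

lemma poly_ring_induct [case_names const var add mult]:
  fixes P :: "('n::finite, 'k::field) xy_poly \<Rightarrow> bool"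
  assumes c: "\<And>c. P (cst c)" and v: "\<And>v. P (varp v)"
    and a: "\<And>f g. P f \<Longrightarrow> P g \<Longrightarrow> P (f + g)" and m: "\<And>f g. P f \<Longrightarrow> P g \<Longrightarrow> P (f * g)"
  shows "P f"
proof (induction f rule: poly_add_induct)
  case (single e b)
  have one: "P 1" using c[of 1] by simp
  have p: "P (f ^ j)" if "P f" for f j by (induction j) (auto simp: one m that)
  have "P (\<Prod>v\<in>A. varp v ^ Poly_Mapping.lookup e v)" if "finite A" for A
    using that by (induction A rule: finite_induct) (auto simp: one m p v)
  then show ?case by (subst single_split, subst xmon_eq_prod) (auto intro: m c)
qed (rule a)

section \<open>Substitutions\<close>

text \<open>The product over all variables, with exponent 0 off the support, is multiplicative in
  the monomial without any bookkeeping of supports.\<close>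

definition monom_eval :: "('n var \<Rightarrow> ('n, 'k::field) xy_poly) \<Rightarrow> ('n::finite var \<Rightarrow>\<^sub>0 nat) \<Rightarrow> ('n, 'k) xy_poly" where
  "monom_eval g m = (\<Prod>v\<in>UNIV. g v ^ Poly_Mapping.lookup m v)"

definition subst_poly :: "('n::finite var \<Rightarrow> ('n, 'k::field) xy_poly) \<Rightarrow> ('n, 'k) xy_poly \<Rightarrow> ('n, 'k) xy_poly" where
  "subst_poly g f = (\<Sum>m\<in>Poly_Mapping.keys f. cst (Poly_Mapping.lookup f m) * monom_eval g m)"

lemma subst_poly_superset:
  assumes "finite A" "Poly_Mapping.keys f \<subseteq> A"
  shows "subst_poly g f = (\<Sum>m\<in>A. cst (Poly_Mapping.lookup f m) * monom_eval g m)"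
  unfolding subst_poly_def
  by (rule sum.mono_neutral_left) (use assms in \<open>auto simp: in_keys_iff\<close>)

lemma subst_poly_add: "subst_poly g (f + h) = subst_poly g f + subst_poly g h"
proof -
  let ?A = "Poly_Mapping.keys f \<union> Poly_Mapping.keys h"
  have "Poly_Mapping.keys (f + h) \<subseteq> ?A" by (rule keys_add)
  then show ?thesis
    by (simp add: subst_poly_superset[of ?A] lookup_add single_add distrib_right sum.distrib)
qed

lemma monom_eval_add: "monom_eval g (m + m') = monom_eval g m * monom_eval g m'"
  by (simp add: monom_eval_def lookup_add power_add prod.distrib)

lemma subst_poly_single: "subst_poly g (Poly_Mapping.single m c) = cst c * monom_eval g m"
  by (simp add: subst_poly_def)

lemma subst_poly_const: "subst_poly g (cst c) = cst c"
  by (simp add: subst_poly_single monom_eval_def)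

lemma subst_poly_0 [simp]: "subst_poly g 0 = 0"
  by (simp add: subst_poly_def)

lemma subst_poly_1 [simp]: "subst_poly g 1 = 1"
  using subst_poly_const[of g 1] by simp

lemma subst_poly_varp [simp]: "subst_poly g (varp v) = g v"
proof -
  have "monom_eval g (Poly_Mapping.single v 1) = (\<Prod>w\<in>UNIV. if w = v then g v else 1)"
    unfolding monom_eval_def by (rule prod.cong) (auto simp: lookup_single when_def)
  then show ?thesis by (simp add: varp_def subst_poly_single)
qed

lemma subst_poly_mult: "subst_poly g (f * h) = subst_poly g f * subst_poly g h"
  for f :: "('n::finite, 'k::field) xy_poly"
proof (induction f rule: poly_add_induct)
  case (single m c)
  show ?case
  proof (induction h rule: poly_add_induct)
    case (single m' c')
    have "subst_poly g (Poly_Mapping.single m c * Poly_Mapping.single m' c') = cst (c * c') * monom_eval g (m + m')"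
      by (simp add: mult_single subst_poly_single)
    also have "\<dots> = (cst c * cst c') * (monom_eval g m * monom_eval g m')"
      by (simp add: mult_single monom_eval_add)
    also have "\<dots> = (cst c * monom_eval g m) * (cst c' * monom_eval g m')"
      by (simp only: ac_simps)
    finally show ?case by (simp only: subst_poly_single)
  qed (simp add: subst_poly_add distrib_left)
qed (simp add: subst_poly_add distrib_right)

lemma subst_poly_uminus: "subst_poly g (- f) = - subst_poly g f"
  by (metis add_eq_0_iff subst_poly_0 subst_poly_add)

lemma subst_poly_diff: "subst_poly g (f - h) = subst_poly g f - subst_poly g h"
  using subst_poly_add[of g f "- h"] by (simp add: subst_poly_uminus)

lemma subst_poly_power: "subst_poly g (f ^ j) = subst_poly g f ^ j"
  by (induction j) (simp_all add: subst_poly_mult)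

lemma subst_poly_prod: "subst_poly g (\<Prod>a\<in>A. h a) = (\<Prod>a\<in>A. subst_poly g (h a))"
  by (induction A rule: infinite_finite_induct) (simp_all add: subst_poly_mult)

lemma subst_poly_id: "subst_poly varp f = f"
  by (induction f rule: poly_ring_induct)
    (simp_all add: subst_poly_const subst_poly_add subst_poly_mult)

lemma subst_poly_subst_poly: "subst_poly g (subst_poly h f) = subst_poly (\<lambda>v. subst_poly g (h v)) f"
  by (induction f rule: poly_ring_induct)
    (simp_all add: subst_poly_const subst_poly_add subst_poly_mult)

lemmas subst_poly_simps = subst_poly_add subst_poly_mult subst_poly_diff subst_poly_uminus
  subst_poly_power subst_poly_prod subst_poly_const

lemma subst_poly_cong_ideal:
  assumes I: "is_ideal I" and gh: "\<And>v. g v - h v \<in> I"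
  shows "subst_poly g f - subst_poly h f \<in> I"
proof (induction f rule: poly_ring_induct)
  case (const c)
  show ?case using I by (simp add: subst_poly_const ring_module.subspace_0)
next
  case (var v)
  show ?case using gh by simp
next
  case (add a b)
  then show ?case using ring_module.subspace_add[OF I add] by (simp add: subst_poly_add algebra_simps)
next
  case (mult a b)
  have "subst_poly g (a * b) - subst_poly h (a * b) =
      subst_poly g b * (subst_poly g a - subst_poly h a) + subst_poly h a * (subst_poly g b - subst_poly h b)"
    by (simp add: subst_poly_mult algebra_simps)
  also have "\<dots> \<in> I" by (intro ring_module.subspace_add[OF I] ideal_mult_left[OF I] mult)
  finally show ?case .
qed

lemma is_ideal_subst_kernel: "is_ideal {f. subst_poly g f = 0}"
  by (auto simp: ring_module.subspace_def subst_poly_simps)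

text \<open>If \<open>g\<close> fixes every variable modulo the ideal of \<open>Z\<close>, then each
  f differs from its image by an element of that ideal, so image 0 means membership. Linear ideals
  are recognised as kernels, and hence as primes, in this way.\<close>

lemma kernel_subst_poly_eq_span:
  assumes "\<And>z. z \<in> Z \<Longrightarrow> subst_poly g z = 0" and "\<And>v. varp v - g v \<in> ideal_span Z"
  shows "{f. subst_poly g f = 0} = ideal_span Z"
proof
  show "ideal_span Z \<subseteq> {f. subst_poly g f = 0}"
    by (rule ring_module.span_minimal) (use assms(1) is_ideal_subst_kernel in auto)
  show "{f. subst_poly g f = 0} \<subseteq> ideal_span Z"
  proof safe
    fix f assume "subst_poly g f = 0"
    then show "f \<in> ideal_span Z"
      using subst_poly_cong_ideal[of "ideal_span Z" varp g f] assms(2) by (simp add: subst_poly_id)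
  qed
qed

lemma prime_kernel_subst_poly: "is_prime_ideal {f. subst_poly g f = (0 :: ('n::{finite,linorder}, 'k::field) xy_poly)}"
proof -
  have "(1 :: ('n, 'k) xy_poly) \<notin> {f. subst_poly g f = 0}" by simp
  then have "{f. subst_poly g f = 0} \<noteq> (UNIV :: ('n, 'k) xy_poly set)" by blast
  then show ?thesis
    unfolding is_prime_ideal_def using is_ideal_subst_kernel[of g] by (auto simp: subst_poly_mult)
qed

section \<open>Homogeneous components\<close>

lemma monom_degree_eq: "monom_degree m = (\<Sum>v\<in>UNIV. Poly_Mapping.lookup m v)" for m :: "'n::finite var \<Rightarrow>\<^sub>0 nat"
  unfolding monom_degree_def by (rule sum.mono_neutral_left) (auto simp: in_keys_iff)

lemma monom_degree_add: "monom_degree (m + m') = monom_degree m + monom_degree m'" for m :: "'n::finite var \<Rightarrow>\<^sub>0 nat"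
  by (simp add: monom_degree_eq lookup_add sum.distrib)

lemma monom_degree_single [simp]: "monom_degree (Poly_Mapping.single v e) = e"
  by (cases "e = 0") (simp_all add: monom_degree_def)

lemma monom_degree_0 [simp]: "monom_degree 0 = 0"
  by (simp add: monom_degree_def)

lemma monom_degree_eq_0 [simp]: "monom_degree m = 0 \<longleftrightarrow> m = 0" for m :: "'n::finite var \<Rightarrow>\<^sub>0 nat"
  by (auto simp: monom_degree_eq intro: poly_mapping_eqI)

lemma graded_component_0 [simp]: "0 \<in> graded_component d"
  by (simp add: graded_component_def)

lemma graded_component_diff: "f \<in> graded_component d \<Longrightarrow> g \<in> graded_component d \<Longrightarrow> f - g \<in> graded_component d"
  unfolding graded_component_def by (auto simp: in_keys_iff lookup_minus)

lemma graded_component_mult: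
  fixes f g :: "('n::finite, 'k::field) xy_poly"
  assumes "f \<in> graded_component d" and "g \<in> graded_component e" and "d' = d + e"
  shows "f * g \<in> graded_component d'"
  unfolding graded_component_def
proof safe
  fix m assume "m \<in> Poly_Mapping.keys (f * g)"
  then obtain a b where "m = a + b" "a \<in> Poly_Mapping.keys f" "b \<in> Poly_Mapping.keys g"
    using keys_mult[of f g] by blast
  then show "int (monom_degree m) = d'"
    using assms unfolding graded_component_def by (auto simp: monom_degree_add)
qed

lemma graded_component_const [simp]: "cst c \<in> graded_component 0"
  by (auto simp: graded_component_def)

lemma graded_component_varp [simp]: "varp v \<in> graded_component 1"
  by (auto simp: graded_component_def varp_def)

lemma graded_component_power:
  fixes f :: "('n::finite, 'k::field) xy_poly"
  assumes "f \<in> graded_component d"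
  shows "f ^ j \<in> graded_component (int j * d)"
proof (induction j)
  case 0
  show ?case using graded_component_const[of 1] by simp
next
  case (Suc j)
  have "f * f ^ j \<in> graded_component (int (Suc j) * d)"
    by (rule graded_component_mult[OF assms Suc]) (simp add: algebra_simps)
  then show ?case by simp
qed

lemma graded_component_single: "Poly_Mapping.single m c \<in> graded_component (int (monom_degree m))"
  by (auto simp: graded_component_def)

definition hcomp :: "int \<Rightarrow> ('n, 'k::field) xy_poly \<Rightarrow> ('n, 'k) xy_poly" where
  "hcomp d f = (\<Sum>m | m \<in> Poly_Mapping.keys f \<and> int (monom_degree m) = d. Poly_Mapping.single m (Poly_Mapping.lookup f m))"

lemma lookup_hcomp: "Poly_Mapping.lookup (hcomp d f) m = (if int (monom_degree m) = d then Poly_Mapping.lookup f m else 0)"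
  by (simp add: hcomp_def lookup_sum lookup_single when_def in_keys_iff)

lemma hcomp_graded [simp]: "hcomp d f \<in> graded_component d"
  by (auto simp: graded_component_def in_keys_iff lookup_hcomp split: if_splits)

lemma hcomp_0 [simp]: "hcomp d 0 = 0"
  by (simp add: hcomp_def)

lemma hcomp_add: "hcomp d (f + g) = hcomp d f + hcomp d g"
  by (rule poly_mapping_eqI) (simp add: lookup_hcomp lookup_add)

lemma hcomp_diff: "hcomp d (f - g) = hcomp d f - hcomp d g"
  by (rule poly_mapping_eqI) (simp add: lookup_hcomp lookup_minus)

lemma hcomp_sum: "hcomp d (\<Sum>a\<in>A. f a) = (\<Sum>a\<in>A. hcomp d (f a))"
  by (induction A rule: infinite_finite_induct) (simp_all add: hcomp_add)

lemma hcomp_graded_component: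
  assumes "f \<in> graded_component e"
  shows "hcomp d f = (if d = e then f else 0)"
  using assms by (intro poly_mapping_eqI) (auto simp: lookup_hcomp graded_component_def in_keys_iff)

lemma hcomp_mult:
  fixes g :: "('n::finite, 'k::field) xy_poly"
  assumes g: "g \<in> graded_component e"
  shows "hcomp d (f * g) = hcomp (d - e) f * g"
proof (induction f rule: poly_add_induct)
  case (single m c)
  have s: "Poly_Mapping.single m c \<in> graded_component (int (monom_degree m))" for m and c :: 'k
    by (rule graded_component_single)
  show ?case
    using hcomp_graded_component[OF graded_component_mult[OF s[of m c] g refl], of d]
      hcomp_graded_component[OF s[of m c], of "d - e"] by auto
qed (simp add: hcomp_add distrib_right)

definition degrees :: "('n, 'k::field) xy_poly \<Rightarrow> int set" where
  "degrees f = (\<lambda>m. int (monom_degree m)) ` Poly_Mapping.keys f"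

lemma finite_degrees [simp]: "finite (degrees f)"
  by (simp add: degrees_def)

lemma sum_hcomp:
  assumes "finite A" and "degrees f \<subseteq> A"
  shows "(\<Sum>d\<in>A. hcomp d f) = f"
proof (rule poly_mapping_eqI)
  fix m
  have "Poly_Mapping.lookup f m = 0" if "int (monom_degree m) \<notin> A"
    using that assms(2) unfolding degrees_def image_subset_iff by (meson in_keys_iff)
  then show "Poly_Mapping.lookup (\<Sum>d\<in>A. hcomp d f) m = Poly_Mapping.lookup f m"
    using assms(1) by (auto simp: lookup_sum lookup_hcomp)
qed

definition graded_ideal :: "('n, 'k::field) xy_poly set \<Rightarrow> bool" where
  "graded_ideal I \<longleftrightarrow> is_ideal I \<and> (\<forall>f\<in>I. \<forall>d. hcomp d f \<in> I)"

lemma graded_ideal_span: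
  fixes S :: "('n::finite, 'k::field) xy_poly set"
  assumes "\<And>s. s \<in> S \<Longrightarrow> \<exists>d. s \<in> graded_component d"
  shows "graded_ideal (ideal_span S)"
  unfolding graded_ideal_def
proof (intro conjI ballI allI)
  fix f d assume "f \<in> ideal_span S"
  then show "hcomp d f \<in> ideal_span S"
  proof (induction rule: ring_module.span_induct_alt)
    case base
    show ?case by (simp add: ring_module.span_zero)
  next
    case (step c x y)
    obtain e where "x \<in> graded_component e" using assms step(1) by blast
    then have "hcomp d (c * x + y) = hcomp (d - e) c * x + hcomp d y"
      by (simp add: hcomp_add hcomp_mult)
    then show ?case using step by (auto intro: ring_module.span_add ring_module.span_scale ring_module.span_base)
  qed
qed (rule ring_module.subspace_span)

text \<open>Splitting both factors into homogeneous components shows that products of homogeneous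
  elements already generate.\<close>

lemma graded_ideal_times:
  fixes I :: "('n::finite, 'k::field) xy_poly set"
  assumes "graded_ideal I" and "graded_ideal J"
  shows "graded_ideal (ideal_times I J)"
proof -
  let ?S = "{a * b | a b. a \<in> I \<and> b \<in> J \<and> (\<exists>d. a \<in> graded_component d) \<and> (\<exists>d. b \<in> graded_component d)}"
  have "a * b \<in> ideal_span ?S" if "a \<in> I" "b \<in> J" for a b
  proof -
    have "a * b = (\<Sum>d\<in>degrees a. hcomp d a) * (\<Sum>d\<in>degrees b. hcomp d b)"
      by (simp add: sum_hcomp)
    also have "\<dots> = (\<Sum>d\<in>degrees a. \<Sum>e\<in>degrees b. hcomp d a * hcomp e b)"
      by (simp add: sum_product)
    also have "\<dots> \<in> ideal_span ?S"
      using assms that hcomp_graded unfolding graded_ideal_def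
      by (intro ring_module.span_sum ring_module.span_base) blast
    finally show ?thesis .
  qed
  then have "ideal_times I J \<subseteq> ideal_span ?S"
    by (intro ideal_times_subset) auto
  moreover have "ideal_span ?S \<subseteq> ideal_times I J"
    unfolding ideal_times_def by (rule ring_module.span_mono) blast
  moreover have "graded_ideal (ideal_span ?S)"
    by (rule graded_ideal_span) (blast intro: graded_component_mult)
  ultimately show ?thesis by simp
qed

lemma graded_ideal_power:
  fixes I :: "('n::finite, 'k::field) xy_poly set"
  assumes "graded_ideal I"
  shows "graded_ideal (ideal_power I k)"
proof (induction k)
  case 0
  show ?case by (simp add: graded_ideal_def ring_module.subspace_UNIV)
next
  case (Suc k)
  show ?case unfolding ideal_power.simps by (rule graded_ideal_times[OF assms Suc])
qed

section \<open>The irrelevant ideal\<close>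

lemma irrelevant_ideal_eq: "irrelevant_ideal = ideal_span (range (varp :: 'n var \<Rightarrow> ('n, 'k::field) xy_poly))"
proof -
  have "range x_var \<union> range y_var = (range varp :: ('n, 'k::field) xy_poly set)"
    unfolding UNIV_var image_Un by (auto simp: x_var_eq y_var_eq image_image)
  then show ?thesis by (simp add: irrelevant_ideal_def)
qed

text \<open>The irrelevant ideal is the kernel of evaluation at the origin, which returns the
  constant coefficient.\<close>

lemma irrelevant_ideal_iff: "f \<in> irrelevant_ideal \<longleftrightarrow> Poly_Mapping.lookup f 0 = 0"
  for f :: "('n::finite, 'k::field) xy_poly"
proof -
  have k: "subst_poly (\<lambda>v. 0) f = cst (Poly_Mapping.lookup f 0)"
  proof (induction f rule: poly_add_induct)
    case (single m c)
    show ?case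
    proof (cases "m = 0")
      case True
      then show ?thesis by (simp add: subst_poly_const)
    next
      case False
      then obtain v where "Poly_Mapping.lookup m v \<noteq> 0" by (metis lookup_zero poly_mapping_eqI)
      then have "monom_eval (\<lambda>v. 0 :: ('n, 'k) xy_poly) m = 0"
        unfolding monom_eval_def by (intro prod_zero) (auto simp: zero_power intro!: exI[of _ v])
      then show ?thesis using False by (simp add: subst_poly_single lookup_single when_def)
    qed
  qed (simp add: subst_poly_add lookup_add single_add)
  have "{f. subst_poly (\<lambda>v. 0) f = (0 :: ('n, 'k) xy_poly)} = ideal_span (range varp)"
    by (rule kernel_subst_poly_eq_span) (auto intro: ring_module.span_base)
  then have "f \<in> irrelevant_ideal \<longleftrightarrow> subst_poly (\<lambda>v. 0) f = 0"
    by (auto simp: irrelevant_ideal_eq)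
  also have "\<dots> \<longleftrightarrow> Poly_Mapping.lookup f 0 = 0" unfolding k by (metis lookup_single_eq single_zero)
  finally show ?thesis .
qed

lemma graded_component_irrelevant:
  "f \<in> graded_component d \<Longrightarrow> d \<noteq> 0 \<Longrightarrow> f \<in> irrelevant_ideal" for f :: "('n::finite, 'k::field) xy_poly"
  by (auto simp: irrelevant_ideal_iff graded_component_def in_keys_iff)

lemma graded_component_0_eq_const:
  "f \<in> graded_component 0 \<Longrightarrow> f = cst (Poly_Mapping.lookup f 0)" for f :: "('n::finite, 'k::field) xy_poly"
  by (rule poly_mapping_eqI) (auto simp: graded_component_def in_keys_iff lookup_single when_def)

section \<open>Degrees in a graded free resolution\<close>

text \<open>\<open>m i\<close> is the differential from step \<open>i + 1\<close> to step
  \<open>i\<close>. Elements of the i-th free module are functions on \<open>nat\<close> of which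
  only the values below \<open>L i\<close> count, which keeps vector dimensions out of the
  homological arguments.\<close>

locale graded_resolution =
  fixes I :: "('n::{finite,linorder}, 'k::field) xy_poly set"
    and L :: "nat \<Rightarrow> nat" and deg :: "nat \<Rightarrow> nat \<Rightarrow> int"
    and m :: "nat \<Rightarrow> nat \<Rightarrow> nat \<Rightarrow> ('n, 'k) xy_poly"
  assumes I: "is_ideal I"
    and L_0: "L 0 = 1" and deg_0: "deg 0 0 = 0"
    and m_graded: "\<And>i r c. r < L i \<Longrightarrow> c < L (Suc i) \<Longrightarrow> m i r c \<in> graded_component (deg (Suc i) c - deg i r)"
    and image_0: "{\<Sum>c<L 1. m 0 0 c * g c | g. True} = I"
    and complex: "\<And>i g r. r < L i \<Longrightarrow> (\<Sum>c<L (Suc i). m i r c * (\<Sum>b<L (Suc (Suc i)). m (Suc i) c b * g b)) = 0"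
    and exact: "\<And>i f. (\<And>r. r < L i \<Longrightarrow> (\<Sum>c<L (Suc i). m i r c * f c) = 0) \<Longrightarrow>
      \<exists>g. \<forall>r<L (Suc i). f r = (\<Sum>b<L (Suc (Suc i)). m (Suc i) r b * g b)"
begin

definition dmap :: "nat \<Rightarrow> (nat \<Rightarrow> ('n, 'k) xy_poly) \<Rightarrow> nat \<Rightarrow> ('n, 'k) xy_poly" where
  "dmap i f r = (\<Sum>c<L (Suc i). m i r c * f c)"

text \<open>\<open>bounds\<close> and \<open>cycle\<close> describe, on lifts to R, the boundaries
  and cycles of the resolution tensored with R/Q, whose homology is Tor of R/I and R/Q. At step 0
  everything is a cycle.\<close>

definition bounds :: "nat \<Rightarrow> ('n, 'k) xy_poly set \<Rightarrow> (nat \<Rightarrow> ('n, 'k) xy_poly) \<Rightarrow> bool" where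
  "bounds i Q c \<longleftrightarrow> (\<exists>g. \<forall>r<L i. c r - dmap i g r \<in> Q)"

definition cycle :: "nat \<Rightarrow> ('n, 'k) xy_poly set \<Rightarrow> (nat \<Rightarrow> ('n, 'k) xy_poly) \<Rightarrow> bool" where
  "cycle i Q c \<longleftrightarrow> (\<forall>j. i = Suc j \<longrightarrow> (\<forall>r<L j. dmap j c r \<in> Q))"

definition homog :: "nat \<Rightarrow> int \<Rightarrow> (nat \<Rightarrow> ('n, 'k) xy_poly) \<Rightarrow> bool" where
  "homog i e c \<longleftrightarrow> (\<forall>r<L i. c r \<in> graded_component (e - deg i r))"

lemma dmap_diff: "dmap i (\<lambda>c. f c - g c) r = dmap i f r - dmap i g r"
  by (simp add: dmap_def right_diff_distrib sum_subtractf)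

lemma dmap_scale: "dmap i (\<lambda>c. a * f c) r = a * dmap i f r"
  by (simp add: dmap_def sum_distrib_left mult.left_commute)

lemma dmap_dmap: "r < L i \<Longrightarrow> dmap i (dmap (Suc i) g) r = 0"
  using complex by (simp add: dmap_def)

lemma dmap_mem: "is_ideal Q \<Longrightarrow> (\<And>c. c < L (Suc i) \<Longrightarrow> f c \<in> Q) \<Longrightarrow> dmap i f r \<in> Q"
  unfolding dmap_def by (intro ring_module.subspace_sum ideal_mult_left) auto

lemma hcomp_dmap:
  assumes "r < L i"
  shows "hcomp (e - deg i r) (dmap i g r) = dmap i (\<lambda>c. hcomp (e - deg (Suc i) c) (g c)) r"
  unfolding dmap_def hcomp_sum
proof (rule sum.cong)
  fix c assume "c \<in> {..<L (Suc i)}"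
  then have "m i r c \<in> graded_component (deg (Suc i) c - deg i r)" using m_graded assms by simp
  from hcomp_mult[OF this, of "e - deg i r" "g c"]
  show "hcomp (e - deg i r) (m i r c * g c) = m i r c * hcomp (e - deg (Suc i) c) (g c)"
    by (simp add: mult.commute)
qed simp

text \<open>The exponent may grow along the induction, since in the end only some power of a linear
  form has to kill a class.\<close>

definition kills_homology :: "nat \<Rightarrow> ('n, 'k) xy_poly set \<Rightarrow> bool" where
  "kills_homology s Q \<longleftrightarrow> (\<forall>i c a. a \<in> I \<longrightarrow> cycle i Q c \<longrightarrow> bounds i Q (\<lambda>r. a ^ s * c r))"

lemma kills_homology_0: "kills_homology 1 {0}"
  unfolding kills_homology_def
proof (intro allI impI)
  fix i c a assume a: "a \<in> I" and c: "cycle i {0} c"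
  show "bounds i {0} (\<lambda>r. a ^ 1 * c r)"
  proof (cases i)
    case 0
    have "a * c 0 \<in> I" using a I ideal_mult_right by blast
    then obtain g where "a * c 0 = (\<Sum>b<L 1. m 0 0 b * g b)" using image_0 by blast
    then show ?thesis using 0 by (auto simp: bounds_def dmap_def L_0 intro!: exI[of _ g])
  next
    case (Suc j)
    then obtain g where "\<forall>r<L i. c r = dmap i g r"
      using exact[of j c] c by (auto simp: cycle_def dmap_def)
    then show ?thesis by (auto simp: bounds_def dmap_scale intro!: exI[of _ "\<lambda>b. a * g b"])
  qed
qed

text \<open>Multiplication by \<open>z\<close> gives a short exact sequence from R/Q to R/Q to R/Q'.
  So Tor_i for R/Q' sits between Tor_i and Tor_(i-1) for R/Q; as \<open>a ^ s\<close> kills both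
  neighbours, its square kills the middle.\<close>

lemma kills_homology_step:
  assumes tor: "kills_homology s Q" and Q: "is_ideal Q" and Q': "is_ideal Q'"
    and ext: "\<And>f. f \<in> Q' \<longleftrightarrow> (\<exists>a q. q \<in> Q \<and> f = z * a + q)"
    and nzd: "\<And>f. z * f \<in> Q \<Longrightarrow> f \<in> Q"
  shows "kills_homology (2 * s) Q'"
  unfolding kills_homology_def
proof (intro allI impI)
  fix i c a assume a: "a \<in> I" and c: "cycle i Q' c"
  have sub: "f \<in> Q'" if "f \<in> Q" for f using ext[of f] that by (metis add.left_neutral mult_zero_right)
  have zQ: "z * f \<in> Q'" for f using ext ring_module.subspace_0[OF Q] by (metis add.right_neutral)
  show "bounds i Q' (\<lambda>r. a ^ (2 * s) * c r)"
  proof (cases i)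
    case 0
    have "cycle 0 Q c" by (simp add: cycle_def)
    then obtain g where g: "\<forall>r<L i. a ^ s * c r - dmap i g r \<in> Q"
      using tor a 0 unfolding kills_homology_def bounds_def by blast
    have "a ^ (2 * s) * c r - dmap i (\<lambda>b. a ^ s * g b) r \<in> Q'" if "r < L i" for r
    proof -
      have "a ^ (2 * s) * c r - dmap i (\<lambda>b. a ^ s * g b) r = a ^ s * (a ^ s * c r - dmap i g r)"
        unfolding dmap_scale by (simp add: mult_2 power_add right_diff_distrib mult.assoc)
      then show ?thesis using g that ideal_mult_left[OF Q] sub by simp
    qed
    then show ?thesis unfolding bounds_def by blast
  next
    case (Suc j)
    have "\<forall>r. \<exists>e. r < L j \<longrightarrow> dmap j c r - z * e \<in> Q"
    proof
      fix r
      show "\<exists>e. r < L j \<longrightarrow> dmap j c r - z * e \<in> Q"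
      proof (cases "r < L j")
        case True
        then have "dmap j c r \<in> Q'" using c Suc by (simp add: cycle_def)
        then obtain e q where "q \<in> Q" "dmap j c r = z * e + q" using ext by blast
        then show ?thesis by (intro exI[of _ e]) simp
      qed simp
    qed
    \<comment> \<open>\<open>e\<close> represents the image of the class of \<open>c\<close> under
      the connecting map: the boundary of \<open>c\<close> is \<open>z\<close> times
      \<open>e\<close> modulo \<open>Q\<close>.\<close>
    then obtain e where e: "\<And>r. r < L j \<Longrightarrow> dmap j c r - z * e r \<in> Q" by metis
    have "cycle j Q e" unfolding cycle_def
    proof (intro allI impI)
      fix k r assume k: "j = Suc k" and r: "r < L k"
      have "dmap k (\<lambda>r. dmap j c r - z * e r) r \<in> Q" by (rule dmap_mem[OF Q]) (use e k in auto)
      then have "- (z * dmap k e r) \<in> Q" using dmap_dmap[OF r] k by (simp add: dmap_diff dmap_scale)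
      then show "dmap k e r \<in> Q" using nzd ring_module.subspace_neg[OF Q] by fastforce
    qed
    then obtain g where g: "\<And>r. r < L j \<Longrightarrow> a ^ s * e r - dmap j g r \<in> Q"
      using tor a unfolding kills_homology_def bounds_def by blast
    \<comment> \<open>Since \<open>a ^ s\<close> times \<open>e\<close> is the boundary of
      \<open>g\<close> modulo \<open>Q\<close>, subtracting \<open>z\<close> times \<open>g\<close>
      produces a cycle modulo \<open>Q\<close> that is unchanged modulo \<open>Q'\<close>.\<close>
    have "cycle i Q (\<lambda>r. a ^ s * c r - z * g r)" unfolding cycle_def
    proof (intro allI impI)
      fix k r assume k: "i = Suc k" and r: "r < L k"
      have kj: "k = j" using k Suc by simp
      have "dmap k (\<lambda>r. a ^ s * c r - z * g r) r =
          a ^ s * (dmap j c r - z * e r) + z * (a ^ s * e r - dmap j g r)"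
        unfolding kj dmap_diff dmap_scale by (simp add: right_diff_distrib mult.left_commute)
      also have "\<dots> \<in> Q"
        by (intro ring_module.subspace_add[OF Q] ideal_mult_left[OF Q] e g) (use r k Suc in auto)
      finally show "dmap k (\<lambda>r. a ^ s * c r - z * g r) r \<in> Q" .
    qed
    then obtain h where h: "\<And>r. r < L i \<Longrightarrow> a ^ s * (a ^ s * c r - z * g r) - dmap i h r \<in> Q"
      using tor a unfolding kills_homology_def bounds_def by blast
    have "a ^ (2 * s) * c r - dmap i h r \<in> Q'" if "r < L i" for r
    proof -
      have "a ^ (2 * s) * c r - dmap i h r =
          (a ^ s * (a ^ s * c r - z * g r) - dmap i h r) + z * (a ^ s * g r)"
        unfolding mult_2 power_add by (simp add: algebra_simps)
      also have "\<dots> \<in> Q'" by (intro ring_module.subspace_add[OF Q'] sub zQ h that)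
      finally show ?thesis .
    qed
    then show ?thesis unfolding bounds_def by blast
  qed
qed

text \<open>The connecting homomorphism: a class killed by a power of \<open>z\<close> modulo \<open>Q\<close> yields a class one
  homological step higher modulo \<open>Q + (z)\<close>.\<close>

lemma connecting_step:
  assumes Q: "graded_ideal Q" and z: "z \<in> graded_component 1"
    and ext: "\<And>f. f \<in> Q' \<longleftrightarrow> (\<exists>a q. q \<in> Q \<and> f = z * a + q)"
    and nzd: "\<And>f. z * f \<in> Q \<Longrightarrow> f \<in> Q"
    and c: "homog i e c" "\<not> bounds i Q c" "bounds i Q (\<lambda>r. z ^ N * c r)"
  shows "\<exists>c' e'. e' \<ge> e + 1 \<and> homog (Suc i) e' c' \<and> cycle (Suc i) Q' c' \<and> \<not> bounds (Suc i) Q' c'"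
proof -
  have Qi: "is_ideal Q" using Q by (simp add: graded_ideal_def)
  \<comment> \<open>The least power of \<open>z\<close> that turns the class into a boundary; the
    chain bounded by \<open>z ^ s\<close> times \<open>c\<close> will be the new class.\<close>
  define s where "s = (LEAST s. bounds i Q (\<lambda>r. z ^ s * c r))"
  have s: "bounds i Q (\<lambda>r. z ^ s * c r)" unfolding s_def by (rule LeastI[of _ N]) (rule c(3))
  have s_min: "\<not> bounds i Q (\<lambda>r. z ^ t * c r)" if "t < s" for t using that not_less_Least s_def by blast
  have "s \<noteq> 0" using s c(2) by (cases s) auto
  then obtain t where t: "s = Suc t" by (cases s) auto
  obtain g0 where g0: "\<And>r. r < L i \<Longrightarrow> z ^ s * c r - dmap i g0 r \<in> Q"
    using s unfolding bounds_def by blast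
  \<comment> \<open>As \<open>Q\<close> is graded, only the component of the right degree need be
    kept. The new degree is \<open>e + s\<close>, and \<open>s\<close> is positive because
    \<open>c\<close> itself is no boundary.\<close>
  define g where "g = (\<lambda>b. hcomp (e + int s - deg (Suc i) b) (g0 b))"
  have zc: "z ^ s * c r \<in> graded_component (e + int s - deg i r)" if "r < L i" for r
    by (rule graded_component_mult[OF graded_component_power[OF z]])
      (use c(1) that in \<open>auto simp: homog_def\<close>)
  have g: "z ^ s * c r - dmap i g r \<in> Q" if r: "r < L i" for r
  proof -
    have "hcomp (e + int s - deg i r) (z ^ s * c r - dmap i g0 r) \<in> Q"
      using g0[OF r] Q by (simp add: graded_ideal_def)
    then show ?thesis
      using hcomp_graded_component[OF zc[OF r]] by (simp add: hcomp_diff hcomp_dmap[OF r] g_def)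
  qed
  have "homog (Suc i) (e + int s) g" by (simp add: homog_def g_def)
  moreover have "cycle (Suc i) Q' g" unfolding cycle_def
  proof (intro allI impI)
    fix j r assume "Suc i = Suc j" and r: "r < L j"
    then have "dmap j g r = z * (z ^ t * c r) + - (z ^ s * c r - dmap i g r)" by (simp add: t)
    moreover have "- (z ^ s * c r - dmap i g r) \<in> Q" using g \<open>Suc i = Suc j\<close> r ring_module.subspace_neg[OF Qi] by blast
    ultimately show "dmap j g r \<in> Q'" using ext by blast
  qed
  \<comment> \<open>Otherwise \<open>g\<close> is a boundary plus \<open>z\<close> times some
    \<open>e'\<close> modulo \<open>Q\<close>. Applying the differential and cancelling one
    \<open>z\<close> makes \<open>z ^ t\<close> times \<open>c\<close> a boundary, against the
    minimality of \<open>s\<close>.\<close>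
  moreover have "\<not> bounds (Suc i) Q' g"
  proof
    assume "bounds (Suc i) Q' g"
    then obtain h where h: "\<And>b. b < L (Suc i) \<Longrightarrow> g b - dmap (Suc i) h b \<in> Q'"
      unfolding bounds_def by blast
    have "\<forall>b. \<exists>e'. b < L (Suc i) \<longrightarrow> g b - dmap (Suc i) h b - z * e' \<in> Q"
    proof
      fix b
      show "\<exists>e'. b < L (Suc i) \<longrightarrow> g b - dmap (Suc i) h b - z * e' \<in> Q"
      proof (cases "b < L (Suc i)")
        case True
        then obtain a q where "q \<in> Q" "g b - dmap (Suc i) h b = z * a + q" using h ext by blast
        then show ?thesis by (intro exI[of _ a]) simp
      qed simp
    qed
    then obtain e' where e': "\<And>b. b < L (Suc i) \<Longrightarrow> g b - dmap (Suc i) h b - z * e' b \<in> Q" by metis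
    have "z ^ t * c r - dmap i e' r \<in> Q" if r: "r < L i" for r
    proof (rule nzd)
      have "dmap i (\<lambda>b. g b - dmap (Suc i) h b - z * e' b) r \<in> Q" by (rule dmap_mem[OF Qi]) (rule e')
      then have "dmap i g r - z * dmap i e' r \<in> Q" using dmap_dmap[OF r] by (simp add: dmap_diff dmap_scale)
      from ring_module.subspace_add[OF Qi this g[OF r]]
      show "z * (z ^ t * c r - dmap i e' r) \<in> Q" by (simp add: t algebra_simps)
    qed
    then have "bounds i Q (\<lambda>r. z ^ t * c r)" unfolding bounds_def by blast
    then show False using s_min t by blast
  qed
  ultimately show ?thesis using \<open>s \<noteq> 0\<close> by (intro exI[of _ g] exI[of _ "e + int s"]) auto
qed

lemma bounds_cong_mod:
  assumes Q: "is_ideal Q" and "bounds i Q c" and "\<And>r. r < L i \<Longrightarrow> c' r - c r \<in> Q"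
  shows "bounds i Q c'"
proof -
  obtain g where g: "\<And>r. r < L i \<Longrightarrow> c r - dmap i g r \<in> Q" using assms unfolding bounds_def by blast
  have "c' r - dmap i g r \<in> Q" if "r < L i" for r
    using ring_module.subspace_add[OF Q assms(3)[OF that] g[OF that]] by simp
  then show ?thesis unfolding bounds_def by blast
qed

text \<open>If \<open>R/(I + Q\<^sub>a)\<close> has finite length and is nonzero in degree \<open>d\<close>, with the ideal \<open>Q\<^sub>a\<close> generated
  by all but \<open>l\<close> elements of a linear coordinate system \<open>z\<^sub>0, z\<^sub>1, \<dots>\<close>, then the regularity is at
  least \<open>d\<close>, and this is visible at step \<open>l\<close> of the resolution.\<close>

lemma generator_degree_ge:
  assumes Q0: "Q 0 = {0}"
    and Qg: "\<And>p. graded_ideal (Q p)"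
    and z: "\<And>p. p < a + l \<Longrightarrow> z p \<in> graded_component 1"
    and ext: "\<And>p f. p < a + l \<Longrightarrow> f \<in> Q (Suc p) \<longleftrightarrow> (\<exists>a q. q \<in> Q p \<and> f = z p * a + q)"
    and nzd: "\<And>p f. p < a + l \<Longrightarrow> z p * f \<in> Q p \<Longrightarrow> f \<in> Q p"
    and nilp: "\<And>p. a \<le> p \<Longrightarrow> p < a + l \<Longrightarrow> \<exists>M b. b \<in> I \<and> z p ^ M - b \<in> Q a"
    and top: "irrelevant_ideal \<subseteq> Q (a + l)"
    and w: "w \<in> graded_component d" "\<And>b. b \<in> I \<Longrightarrow> w - b \<notin> Q a"
  shows "\<exists>r<L l. deg l r \<ge> d + int l"
proof -
  have Qi: "is_ideal (Q p)" for p using Qg by (simp add: graded_ideal_def)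
  \<comment> \<open>The exponent starts at 1 and doubles with each linear form that is divided
    out.\<close>
  have tor: "kills_homology (2 ^ p) (Q p)" if "p \<le> a + l" for p
    using that
  proof (induction p)
    case 0
    then show ?case using kills_homology_0 Q0 by simp
  next
    case (Suc p)
    have "kills_homology (2 * 2 ^ p) (Q (Suc p))"
      by (rule kills_homology_step[OF _ Qi Qi ext nzd]) (use Suc in auto)
    then show ?case by simp
  qed
  have mono: "Q a \<subseteq> Q (a + j)" if "j \<le> l" for j
    using that
  proof (induction j)
    case (Suc j)
    have "f \<in> Q (a + Suc j)" if "f \<in> Q (a + j)" for f
    proof -
      have "\<exists>b q. q \<in> Q (a + j) \<and> f = z (a + j) * b + q"
        by (intro exI[of _ 0] exI[of _ f]) (simp add: that)
      then show ?thesis using ext[of "a + j" f] Suc.prems by simp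
    qed
    then show ?case using Suc by auto
  qed simp
  have "\<exists>c e. e \<ge> d + int j \<and> homog j e c \<and> cycle j (Q (a + j)) c \<and> \<not> bounds j (Q (a + j)) c"
    if "j \<le> l" for j
    using that
  proof (induction j)
    case 0
    \<comment> \<open>The climb starts with \<open>w\<close> itself: boundaries at step 0 are the
      elements of \<open>I\<close>, and \<open>w\<close> is nonzero modulo \<open>I\<close> and
      \<open>Q a\<close>.\<close>
    have "dmap 0 g 0 \<in> I" for g using image_0 by (auto simp: dmap_def)
    then have "\<not> bounds 0 (Q a) (\<lambda>r. w)" using w(2) by (auto simp: bounds_def L_0)
    then show ?case using w(1) L_0 deg_0 by (intro exI[of _ "\<lambda>r. w"] exI[of _ d]) (auto simp: cycle_def homog_def)
  next
    case (Suc j)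
    then obtain c e where c: "e \<ge> d + int j" "homog j e c" "cycle j (Q (a + j)) c" "\<not> bounds j (Q (a + j)) c"
      by auto
    obtain M b where b: "b \<in> I" "z (a + j) ^ M - b \<in> Q a" using nilp[of "a + j"] Suc.prems by auto
    \<comment> \<open>The power \<open>?s\<close> of \<open>b\<close> kills the class
      \<open>c\<close>, and \<open>z (a + j) ^ M\<close> agrees with \<open>b\<close> modulo the
      smaller ideal \<open>Q a\<close>; hence a power of \<open>z (a + j)\<close> kills it
      too.\<close>
    let ?s = "2 ^ (a + j) :: nat"
    have bounds: "bounds j (Q (a + j)) (\<lambda>r. b ^ ?s * c r)"
      using tor[of "a + j"] Suc.prems b(1) c(3) unfolding kills_homology_def by auto
    have bnd': "bounds j (Q (a + j)) (\<lambda>r. z (a + j) ^ (M * ?s) * c r)"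
    proof (rule bounds_cong_mod[OF Qi bounds])
      fix r
      have "z (a + j) ^ M - b dvd (z (a + j) ^ M) ^ ?s - b ^ ?s"
        unfolding power_diff_sumr2[of "z (a + j) ^ M" ?s b] by simp
      then obtain k where k: "z (a + j) ^ (M * ?s) - b ^ ?s = (z (a + j) ^ M - b) * k"
        unfolding power_mult by (elim dvdE)
      have "z (a + j) ^ (M * ?s) * c r - b ^ ?s * c r = (k * c r) * (z (a + j) ^ M - b)"
        unfolding left_diff_distrib[symmetric] k by (simp only: ac_simps)
      also have "\<dots> \<in> Q (a + j)"
        using mono[of j] b(2) Suc.prems by (intro ideal_mult_left[OF Qi]) auto
      finally show "z (a + j) ^ (M * ?s) * c r - b ^ ?s * c r \<in> Q (a + j)" .
    qed
    have "\<exists>c' e'. e' \<ge> e + 1 \<and> homog (Suc j) e' c' \<and> cycle (Suc j) (Q (Suc (a + j))) c'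
        \<and> \<not> bounds (Suc j) (Q (Suc (a + j))) c'"
      by (rule connecting_step[OF Qg z ext nzd c(2,4) bnd']) (use Suc.prems in auto)
    then obtain c' e' where "e' \<ge> e + 1" "homog (Suc j) e' c'" "cycle (Suc j) (Q (a + Suc j)) c'"
      "\<not> bounds (Suc j) (Q (a + Suc j)) c'" by auto
    then show ?case using c(1) by (intro exI[of _ c'] exI[of _ e']) auto
  qed
  then obtain c e where c: "e \<ge> d + int l" "homog l e c" "\<not> bounds l (Q (a + l)) c" by blast
  \<comment> \<open>A chain with all coordinates in \<open>Q (a + l)\<close> is bounded by 0, so
    some coordinate of \<open>c\<close> lies outside this ideal and thus outside the irrelevant one.
    Being homogeneous, it has degree 0, which makes \<open>e\<close> the degree of a basis
    element.\<close>
  have "dmap l (\<lambda>b. 0) r = 0" for r by (simp add: dmap_def)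
  then obtain r where r: "r < L l" "c r \<notin> Q (a + l)"
    using c(3) unfolding bounds_def by (metis diff_zero)
  then have "e - deg l r = 0"
    using c(2) graded_component_irrelevant[of "c r"] top unfolding homog_def by blast
  then show ?thesis using r(1) c(1) by (intro exI[of _ r]) auto
qed

end

section \<open>Noetherianity\<close>

lemma nat_seq_incseq_subseq:
  fixes s :: "nat \<Rightarrow> nat"
  shows "\<exists>\<psi>. strict_mono \<psi> \<and> incseq (s \<circ> \<psi>)"
proof -
  obtain f where f: "strict_mono (f :: nat \<Rightarrow> nat)" "monoseq (\<lambda>n. s (f n))"
    using seq_monosub by blast
  show ?thesis
  proof (cases "incseq (\<lambda>n. s (f n))")
    case True
    then show ?thesis using f(1) by (auto simp: comp_def)
  next
    case False
    then have dec: "decseq (\<lambda>n. s (f n))"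
      using f(2) by (auto simp: monoseq_def incseq_def decseq_def)
    \<comment> \<open>A weakly decreasing sequence of naturals is constant from the index of its
      least value on.\<close>
    define k where "k = arg_min (\<lambda>n. s (f n)) (\<lambda>n. True)"
    have k: "s (f k) \<le> s (f n)" for n
      unfolding k_def by (rule arg_min_nat_le) simp
    have "s (f (k + i)) = s (f k)" for i
      using k[of "k + i"] decseqD[OF dec, of k "k + i"] by simp
    then have "incseq (s \<circ> (\<lambda>i. f (k + i)))" by (simp add: incseq_def)
    moreover have "strict_mono (\<lambda>i. f (k + i))" using f(1) by (simp add: strict_mono_def)
    ultimately show ?thesis by blast
  qed
qed

text \<open>Pass to a weakly increasing subsequence for one coordinate after the other; any two
  terms of the last one will do.\<close>

lemma dickson:
  fixes a :: "nat \<Rightarrow> 'v::finite \<Rightarrow> nat"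
  shows "\<exists>i j. i < j \<and> (\<forall>v. a i v \<le> a j v)"
proof -
  have "\<exists>\<phi>. strict_mono \<phi> \<and> (\<forall>v\<in>V. incseq (\<lambda>n. a (\<phi> n) v))" if "finite V" for V
    using that
  proof (induction V rule: finite_induct)
    case empty
    show ?case by (intro exI[of _ id]) (simp add: strict_mono_def)
  next
    case (insert v V)
    then obtain \<phi> where \<phi>: "strict_mono (\<phi> :: nat \<Rightarrow> nat)" "\<forall>v\<in>V. incseq (\<lambda>n. a (\<phi> n) v)" by blast
    obtain \<psi> where \<psi>: "strict_mono (\<psi> :: nat \<Rightarrow> nat)" "incseq ((\<lambda>n. a (\<phi> n) v) \<circ> \<psi>)"
      using nat_seq_incseq_subseq by blast
    show ?case
    proof (intro exI[of _ "\<phi> \<circ> \<psi>"] conjI ballI)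
      show "strict_mono (\<phi> \<circ> \<psi>)" using \<phi>(1) \<psi>(1) by (simp add: strict_mono_o)
      fix w assume "w \<in> insert v V"
      then show "incseq (\<lambda>n. a ((\<phi> \<circ> \<psi>) n) w)"
        using \<phi>(2) \<psi> strict_mono_mono[OF \<psi>(1)] by (fastforce simp: incseq_def comp_def dest: monoD)
    qed
  qed
  from this[of UNIV] obtain \<phi> where "strict_mono (\<phi> :: nat \<Rightarrow> nat)" "\<forall>v. incseq (\<lambda>n. a (\<phi> n) v)" by auto
  then show ?thesis
    by (intro exI[of _ "\<phi> 0"] exI[of _ "\<phi> 1"]) (auto simp: strict_mono_def incseq_def)
qed

lemma monom_nonneg: "0 \<le> m" for m :: "('n::{finite,linorder} var \<Rightarrow>\<^sub>0 nat)"
proof (rule leI, rule notI)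
  assume "m < 0"
  then show False by (simp add: less_poly_mapping.rep_eq less_fun_def)
qed

lemma monom_le:
  fixes a b :: "('n::{finite,linorder} var \<Rightarrow>\<^sub>0 nat)"
  assumes "\<And>v. Poly_Mapping.lookup a v \<le> Poly_Mapping.lookup b v"
  shows "b = a + (b - a)" and "a \<le> b"
proof -
  show *: "b = a + (b - a)"
    by (rule poly_mapping_eqI) (simp add: lookup_add lookup_minus assms)
  have "a + 0 \<le> a + (b - a)" by (rule add_left_mono) (rule monom_nonneg)
  then show "a \<le> b" using * by simp
qed

text \<open>By Dickson's lemma an infinite descending chain would contain a monomial dividing a
  later one, but a divisor is never larger.\<close>

lemma wf_monom: "wf {(a, b). a < (b :: ('n::{finite,linorder} var \<Rightarrow>\<^sub>0 nat))}"
  unfolding wf_iff_no_infinite_down_chain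
proof
  assume "\<exists>f. \<forall>i. (f (Suc i), f i) \<in> {(a, b). a < (b :: ('n var \<Rightarrow>\<^sub>0 nat))}"
  then obtain f where f: "\<And>i. f (Suc i) < (f i :: ('n var \<Rightarrow>\<^sub>0 nat))" by auto
  obtain i j where "i < j" "\<forall>v. Poly_Mapping.lookup (f i) v \<le> Poly_Mapping.lookup (f j) v"
    using dickson[of "\<lambda>i. Poly_Mapping.lookup (f i)"] by blast
  then have "f i \<le> f j" by (auto intro: monom_le)
  moreover have "f j < f i"
    using \<open>i < j\<close> by (induction j) (auto simp: less_Suc_eq intro: f less_trans[OF f])
  ultimately show False by simp
qed

section \<open>Hilbert's basis theorem\<close>

lemma lookup_single_mult:
  "Poly_Mapping.lookup (Poly_Mapping.single m c * f) (m + k) = c * Poly_Mapping.lookup f k"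
  for f :: "('n, 'k::field) xy_poly"
  by (induction f rule: poly_add_induct)
    (simp_all add: mult_single lookup_single when_def distrib_left lookup_add)

definition lead_monom :: "('n::{finite,linorder}, 'k::field) xy_poly \<Rightarrow> ('n var \<Rightarrow>\<^sub>0 nat)" where
  "lead_monom f = Max (Poly_Mapping.keys f)"

text \<open>Otherwise one could forever choose elements outside the span of their predecessors, each
  with minimal leading monomial. Dickson's lemma finds one whose leading monomial divides a later
  one; reducing the later element by it stays outside the same span and lowers the leading
  monomial.\<close>

lemma hilbert_basis:
  fixes I :: "('n::{finite,linorder}, 'k::field) xy_poly set"
  assumes I: "is_ideal I"
  shows "\<exists>S. finite S \<and> S \<subseteq> I \<and> I \<subseteq> ideal_span S"
proof (rule ccontr)
  assume "\<not> ?thesis"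
  then have ne: "I - ideal_span S \<noteq> {}" if "finite S" "S \<subseteq> I" for S using that by blast
  have "\<exists>f. f \<in> I - ideal_span S \<and> (\<forall>g\<in>I - ideal_span S. \<not> lead_monom g < lead_monom f)"
    if S: "finite S" "S \<subseteq> I" for S
  proof -
    obtain m where "m \<in> lead_monom ` (I - ideal_span S)"
      "\<And>y. y < m \<Longrightarrow> y \<notin> lead_monom ` (I - ideal_span S)"
      using wfE_min'[OF wf_monom, of "lead_monom ` (I - ideal_span S)"] ne[OF S] by auto
    then show ?thesis by blast
  qed
  then obtain pick where pick: "\<And>S. finite S \<Longrightarrow> S \<subseteq> I \<Longrightarrow>
      pick S \<in> I - ideal_span S \<and> (\<forall>g\<in>I - ideal_span S. \<not> lead_monom g < lead_monom (pick S))"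
    by metis
  define F where "F = rec_nat {} (\<lambda>_ S. insert (pick S) S)"
  have F0: "F 0 = {}" and FS: "F (Suc n) = insert (pick (F n)) (F n)" for n by (simp_all add: F_def)
  have F: "finite (F n) \<and> F n \<subseteq> I" for n
    by (induction n) (use pick in \<open>auto simp: F0 FS\<close>)
  define f where "f n = pick (F n)" for n
  have f: "f n \<in> I" "f n \<notin> ideal_span (F n)"
    "\<And>g. g \<in> I \<Longrightarrow> g \<notin> ideal_span (F n) \<Longrightarrow> \<not> lead_monom g < lead_monom (f n)" for n
    using pick F by (auto simp: f_def)
  have F_mem: "i < j \<Longrightarrow> f i \<in> F j" for i j
    by (induction j) (auto simp: FS f_def less_Suc_eq)
  obtain i j where ij: "i < j"
    and le: "\<And>v. Poly_Mapping.lookup (lead_monom (f i)) v \<le> Poly_Mapping.lookup (lead_monom (f j)) v"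
    using dickson[of "\<lambda>i. Poly_Mapping.lookup (lead_monom (f i))"] by blast
  define \<delta> where "\<delta> = lead_monom (f j) - lead_monom (f i)"
  have lm: "lead_monom (f j) = \<delta> + lead_monom (f i)"
    using monom_le(1)[OF le] by (simp add: \<delta>_def add.commute)
  have f_ne: "f n \<noteq> 0" for n using f(2)[of n] ring_module.span_zero by metis
  have key: "lead_monom (f n) \<in> Poly_Mapping.keys (f n)" for n
    unfolding lead_monom_def by (rule Max_in) (use f_ne in auto)
  \<comment> \<open>\<open>c\<close> and the shift \<open>\<delta>\<close> are chosen to cancel the
    leading term of \<open>f j\<close>.\<close>
  define c where "c = Poly_Mapping.lookup (f j) (lead_monom (f j)) / Poly_Mapping.lookup (f i) (lead_monom (f i))"
  define g where "g = f j - Poly_Mapping.single \<delta> c * f i"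
  have fi: "f i \<in> ideal_span (F j)" using F_mem[OF ij] by (rule ring_module.span_base)
  have "g \<in> I"
    unfolding g_def by (intro ring_module.subspace_diff[OF I] ideal_mult_left[OF I] f)
  moreover have g_notin: "g \<notin> ideal_span (F j)"
  proof
    assume "g \<in> ideal_span (F j)"
    then have "g + Poly_Mapping.single \<delta> c * f i \<in> ideal_span (F j)"
      using fi by (intro ring_module.span_add ring_module.span_scale)
    then show False using f(2)[of j] by (simp add: g_def)
  qed
  ultimately have "\<not> lead_monom g < lead_monom (f j)" by (rule f(3))
  moreover have "lead_monom g < lead_monom (f j)"
  proof -
    have "g \<noteq> 0" using g_notin ring_module.span_zero by metis
    then have "lead_monom g \<in> Poly_Mapping.keys g"
      unfolding lead_monom_def by (intro Max_in) auto
    moreover have "k < lead_monom (f j)" if k: "k \<in> Poly_Mapping.keys g" for k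
    proof -
      have "k \<noteq> lead_monom (f j)"
      proof
        assume "k = lead_monom (f j)"
        moreover have "Poly_Mapping.lookup g (lead_monom (f j)) = 0"
          using key[of i] unfolding g_def lookup_minus
          by (simp add: lm lookup_single_mult c_def in_keys_iff)
        ultimately show False using k by (simp add: in_keys_iff)
      qed
      moreover have "k \<le> lead_monom (f j)"
      proof (cases "k \<in> Poly_Mapping.keys (f j)")
        case True
        then show ?thesis by (simp add: lead_monom_def)
      next
        case False
        then have "k \<in> Poly_Mapping.keys (Poly_Mapping.single \<delta> c * f i)"
          using k by (auto simp: g_def in_keys_iff lookup_minus)
        then obtain b where b: "k = \<delta> + b" "b \<in> Poly_Mapping.keys (f i)"
          using keys_mult[of "Poly_Mapping.single \<delta> c" "f i"] by (auto split: if_splits)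
        then have "b \<le> lead_monom (f i)" by (simp add: lead_monom_def)
        then show ?thesis unfolding lm b(1) by (rule add_left_mono)
      qed
      ultimately show ?thesis by simp
    qed
    ultimately show ?thesis by blast
  qed
  ultimately show False by blast
qed

section \<open>Submodules of finite free modules\<close>

lemma sum_fun_apply: "(\<Sum>a\<in>A. f a) x = (\<Sum>a\<in>A. f a x)"
  by (induction A rule: infinite_finite_induct) auto

definition vscale :: "'a::comm_ring_1 \<Rightarrow> (nat \<Rightarrow> 'a) \<Rightarrow> nat \<Rightarrow> 'a" where
  "vscale a f = (\<lambda>r. a * f r)"

lemma vscale_apply: "vscale a f r = a * f r"
  by (simp add: vscale_def)

interpretation fun_module: Modules.module vscale
  by unfold_locales (auto simp: fun_eq_iff vscale_apply distrib_left distrib_right mult.assoc)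

text \<open>The values of the last coordinate form an ideal. Lifts of its generators, together with
  generators of the submodule on which this coordinate vanishes, suffice.\<close>

lemma submodule_finitely_generated:
  fixes N :: "(nat \<Rightarrow> ('n::{finite,linorder}, 'k::field) xy_poly) set"
  assumes "fun_module.subspace N" and "\<And>f r. f \<in> N \<Longrightarrow> r \<ge> l \<Longrightarrow> f r = 0"
  shows "\<exists>S. finite S \<and> S \<subseteq> N \<and> N \<subseteq> fun_module.span S"
  using assms
proof (induction l arbitrary: N)
  case 0
  have "N \<subseteq> fun_module.span {}"
  proof
    fix f assume "f \<in> N"
    then have "f = 0" using 0 by (auto simp: fun_eq_iff)
    then show "f \<in> fun_module.span {}" using fun_module.span_zero by metis
  qed
  then show ?case by (intro exI[of _ "{}"]) auto
next
  case (Suc l)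
  define J where "J = {f l | f. f \<in> N}"
  have "is_ideal J"
    unfolding ring_module.subspace_def
  proof (intro conjI ballI allI)
    have J: "f l \<in> J" if "f \<in> N" for f using that unfolding J_def by blast
    show "0 \<in> J" using J[OF fun_module.subspace_0[OF Suc.prems(1)]] by simp
    fix x assume "x \<in> J"
    then obtain f where f: "f \<in> N" "x = f l" unfolding J_def by blast
    show "c * x \<in> J" for c using J[OF fun_module.subspace_scale[OF Suc.prems(1) f(1), of c]] f(2) by (simp add: vscale_apply)
    fix y assume "y \<in> J"
    then obtain g where g: "g \<in> N" "y = g l" unfolding J_def by blast
    show "x + y \<in> J" using J[OF fun_module.subspace_add[OF Suc.prems(1) f(1) g(1)]] f(2) g(2) by simp
  qed
  then obtain S where S: "finite S" "S \<subseteq> J" "J \<subseteq> ideal_span S" using hilbert_basis by blast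
  then have "\<forall>s\<in>S. \<exists>f. f \<in> N \<and> f l = s" unfolding J_def by blast
  then obtain F where F: "\<And>s. s \<in> S \<Longrightarrow> F s \<in> N \<and> F s l = s" by metis
  define N' where "N' = {f \<in> N. f l = 0}"
  have "fun_module.subspace N'"
    unfolding fun_module.subspace_def[of N']
  proof (intro conjI ballI allI)
    have N': "f \<in> N'" if "f \<in> N" "f l = 0" for f using that unfolding N'_def by blast
    show "0 \<in> N'" by (rule N'[OF fun_module.subspace_0[OF Suc.prems(1)]]) simp
    fix f assume "f \<in> N'"
    then have f: "f \<in> N" "f l = 0" unfolding N'_def by blast+
    show "vscale c f \<in> N'" for c
      by (rule N'[OF fun_module.subspace_scale[OF Suc.prems(1) f(1), of c]]) (simp add: vscale_apply f(2))
    fix g assume "g \<in> N'"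
    then have g: "g \<in> N" "g l = 0" unfolding N'_def by blast+
    show "f + g \<in> N'"
      by (rule N'[OF fun_module.subspace_add[OF Suc.prems(1) f(1) g(1)]]) (simp add: f(2) g(2))
  qed
  moreover have "f r = 0" if "f \<in> N'" "r \<ge> l" for f r
    using that Suc.prems(2) unfolding N'_def by (cases "r = l") auto
  ultimately obtain T where T: "finite T" "T \<subseteq> N'" "N' \<subseteq> fun_module.span T" using Suc.IH[of N'] by blast
  have "N \<subseteq> fun_module.span (F ` S \<union> T)"
  proof
    fix f assume f: "f \<in> N"
    then have "f l \<in> ideal_span S" using S(3) unfolding J_def by blast
    then obtain u where u: "f l = (\<Sum>s\<in>S. u s * s)" unfolding ring_module.span_finite[OF S(1)] by blast
    define h where "h = (\<Sum>s\<in>S. vscale (u s) (F s))"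
    have hN: "h \<in> N" unfolding h_def
      by (intro fun_module.subspace_sum[OF Suc.prems(1)] fun_module.subspace_scale[OF Suc.prems(1)]) (use F in auto)
    have hS: "h \<in> fun_module.span (F ` S \<union> T)" unfolding h_def
      by (intro fun_module.span_sum fun_module.span_scale fun_module.span_base) auto
    have "h l = (\<Sum>s\<in>S. u s * F s l)" unfolding h_def by (simp add: sum_fun_apply vscale_apply)
    also have "\<dots> = f l" unfolding u by (rule sum.cong) (use F in auto)
    finally have "f - h \<in> N'"
      using fun_module.subspace_diff[OF Suc.prems(1) f hN] by (simp add: N'_def)
    then have "f - h \<in> fun_module.span (F ` S \<union> T)"
      using T(3) fun_module.span_mono[of T "F ` S \<union> T"] by blast
    from fun_module.span_add[OF this hS] show "f \<in> fun_module.span (F ` S \<union> T)" by simp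
  qed
  moreover have "finite (F ` S \<union> T)" "F ` S \<union> T \<subseteq> N" using S T F unfolding N'_def by auto
  ultimately show ?case by blast
qed

section \<open>Minimal graded free resolutions\<close>

text \<open>The homogeneous component in the direct sum of the shifted modules R(-d), d in
  \<open>D\<close>.\<close>

definition hcomp_vec :: "nat list \<Rightarrow> int \<Rightarrow> (nat \<Rightarrow> ('n, 'k::field) xy_poly) \<Rightarrow> nat \<Rightarrow> ('n, 'k) xy_poly" where
  "hcomp_vec D e f r = hcomp (e - int (D ! r)) (f r)"

text \<open>Minimality is phrased through homogeneous relations, whose coefficients must lie in the
  irrelevant ideal. In this form it says directly that the entries of the next differential lie
  there.\<close>

definition minimal_generators ::
  "nat list \<Rightarrow> (nat \<Rightarrow> ('n, 'k::field) xy_poly) set \<Rightarrow> nat list \<Rightarrow> (nat \<Rightarrow> nat \<Rightarrow> ('n, 'k) xy_poly) \<Rightarrow> bool" where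
  "minimal_generators D N D' m \<longleftrightarrow>
    (\<forall>r<length D. \<forall>c<length D'. m r c \<in> graded_component (int (D' ! c) - int (D ! r))) \<and>
    N = {f. (\<forall>r\<ge>length D. f r = 0) \<and> (\<exists>g. \<forall>r<length D. f r = (\<Sum>c<length D'. m r c * g c))} \<and>
    (\<forall>e a. (\<forall>c<length D'. a c \<in> graded_component (e - int (D' ! c))) \<longrightarrow>
      (\<forall>r<length D. (\<Sum>c<length D'. m r c * a c) = 0) \<longrightarrow> (\<forall>c<length D'. a c \<in> irrelevant_ideal))"

lemma sum_list_index:
  assumes "distinct xs"
  shows "(\<Sum>x\<in>set xs. h x) = (\<Sum>c<length xs. h (xs ! c))"
  using sum.reindex_bij_betw[OF bij_betw_nth[OF assms refl refl], of h] by simp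

text \<open>Take a homogeneous generating set of least cardinality. A homogeneous relation with a
  coefficient outside the irrelevant ideal would have a unit coefficient and make one generator
  redundant.\<close>

lemma exists_minimal_generators:
  fixes N :: "(nat \<Rightarrow> ('n::{finite,linorder}, 'k::field) xy_poly) set"
  assumes N: "fun_module.subspace N" and supp: "\<And>f r. f \<in> N \<Longrightarrow> r \<ge> length D \<Longrightarrow> f r = 0"
    and graded: "\<And>f e. f \<in> N \<Longrightarrow> hcomp_vec D e f \<in> N"
  shows "\<exists>D' m. minimal_generators D N D' m"
proof -
  define good where "good G \<longleftrightarrow> finite G \<and> G \<subseteq> N \<and> N \<subseteq> fun_module.span G \<and> (\<forall>g\<in>G. \<exists>e. hcomp_vec D e g = g)" for G
  have hh: "hcomp_vec D e (hcomp_vec D e f) = hcomp_vec D e f" for e and f :: "nat \<Rightarrow> ('n, 'k) xy_poly"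
    by (auto simp: hcomp_vec_def fun_eq_iff hcomp_graded_component[OF hcomp_graded])
  have "\<exists>G. good G"
  proof -
    obtain S where S: "finite S" "S \<subseteq> N" "N \<subseteq> fun_module.span S"
      using submodule_finitely_generated[OF N, of "length D"] supp by blast
    \<comment> \<open>The total degrees occurring in \<open>S\<close>; the homogeneous parts in
      these degrees replace \<open>S\<close>.\<close>
    define E where "E = (\<Union>s\<in>S. \<Union>r<length D. (\<lambda>d. d + int (D ! r)) ` degrees (s r))"
    have E: "finite E" using S(1) by (auto simp: E_def)
    let ?G = "(\<lambda>(e, s). hcomp_vec D e s) ` (E \<times> S)"
    have "s \<in> fun_module.span ?G" if s: "s \<in> S" for s
    proof -
      have "s = (\<Sum>e\<in>E. hcomp_vec D e s)"
      proof
        fix r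
        show "s r = (\<Sum>e\<in>E. hcomp_vec D e s) r"
        proof (cases "r < length D")
          case True
          let ?h = "\<lambda>e. e - int (D ! r)"
          have "(\<Sum>e\<in>E. hcomp_vec D e s r) = (\<Sum>d\<in>?h ` E. hcomp d (s r))"
            unfolding hcomp_vec_def by (subst sum.reindex) (auto simp: inj_on_def)
          also have "\<dots> = s r"
          proof (rule sum_hcomp)
            show "degrees (s r) \<subseteq> ?h ` E"
            proof
              fix d assume "d \<in> degrees (s r)"
              then have "d + int (D ! r) \<in> E" using s True unfolding E_def by blast
              then show "d \<in> ?h ` E" by force
            qed
          qed (use E in auto)
          finally show ?thesis by (simp add: sum_fun_apply)
        next
          case False
          then have "s r = 0" using supp s S(2) by auto
          then show ?thesis by (simp add: sum_fun_apply hcomp_vec_def)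
        qed
      qed
      also have "\<dots> \<in> fun_module.span ?G"
        by (intro fun_module.span_sum fun_module.span_base) (use s in auto)
      finally show ?thesis .
    qed
    then have "fun_module.span S \<subseteq> fun_module.span ?G" by (intro fun_module.span_minimal fun_module.subspace_span) auto
    moreover have "?G \<subseteq> N" using graded S(2) by auto
    moreover have "\<forall>g\<in>?G. \<exists>e. hcomp_vec D e g = g" using hh by auto
    ultimately have "good ?G" unfolding good_def using S(1,3) E by auto
    then show ?thesis by blast
  qed
  then obtain G where G: "good G" and G_min: "\<And>G'. good G' \<Longrightarrow> card G \<le> card G'"
    using ex_has_least_nat[of good _ card] by blast
  have fin: "finite G" and GN: "G \<subseteq> N" and NG: "N \<subseteq> fun_module.span G" using G by (auto simp: good_def)
  obtain deg where deg: "\<And>g. g \<in> G \<Longrightarrow> hcomp_vec D (deg g) g = g" using G unfolding good_def by metis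
  have irredundant: "g \<notin> fun_module.span (G - {g})" if g: "g \<in> G" for g
  proof
    assume *: "g \<in> fun_module.span (G - {g})"
    have "G \<subseteq> fun_module.span (G - {g})" using * fun_module.span_base[of _ "G - {g}"] by blast
    then have "fun_module.span G \<subseteq> fun_module.span (G - {g})" by (intro fun_module.span_minimal fun_module.subspace_span)
    then have "good (G - {g})" using G unfolding good_def by auto
    from G_min[OF this] show False using fin g by (metis card_Diff1_less not_less)
  qed
  \<comment> \<open>Degrees are stored as naturals, so negative ones must be excluded: some
    coordinate of \<open>g\<close> is nonzero, and its monomials have degree \<open>deg g\<close>
    minus a natural number.\<close>
  have deg_nonneg: "deg g \<ge> 0" if g: "g \<in> G" for g
  proof -
    have "g \<noteq> 0" using irredundant[OF g] fun_module.span_zero by metis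
    then obtain r where r: "g r \<noteq> 0" by (auto simp: fun_eq_iff)
    have "hcomp (deg g - int (D ! r)) (g r) = g r" using deg[OF g] by (metis hcomp_vec_def)
    then have "g r \<in> graded_component (deg g - int (D ! r))" by (metis hcomp_graded)
    moreover obtain k where "k \<in> Poly_Mapping.keys (g r)" using r by fastforce
    ultimately have "int (monom_degree k) = deg g - int (D ! r)" by (auto simp: graded_component_def)
    then show ?thesis by linarith
  qed
  obtain gs where gs: "distinct gs" "set gs = G" using finite_distinct_list[OF fin] by blast
  define D' where "D' = map (\<lambda>g. nat (deg g)) gs"
  define m where "m r c = (gs ! c) r" for r c
  have len: "length D' = length gs" by (simp add: D'_def)
  have D': "int (D' ! c) = deg (gs ! c)" if "c < length gs" for c
    using that deg_nonneg gs(2) by (auto simp: D'_def)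
  have span: "f \<in> fun_module.span G \<longleftrightarrow> (\<exists>g. f = (\<lambda>r. \<Sum>c<length gs. m r c * g c))" for f
  proof
    assume "f \<in> fun_module.span G"
    then obtain u where "f = (\<Sum>g\<in>G. vscale (u g) g)" unfolding fun_module.span_finite[OF fin] by blast
    then have "f r = (\<Sum>c<length gs. m r c * u (gs ! c))" for r
      unfolding m_def gs(2)[symmetric]
      by (simp add: sum_fun_apply vscale_apply sum_list_index[OF gs(1)] mult.commute)
    then show "\<exists>g. f = (\<lambda>r. \<Sum>c<length gs. m r c * g c)"
      by (intro exI[of _ "\<lambda>c. u (gs ! c)"]) auto
  next
    assume "\<exists>g. f = (\<lambda>r. \<Sum>c<length gs. m r c * g c)"
    then obtain g where "f = (\<lambda>r. \<Sum>c<length gs. m r c * g c)" by blast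
    then have "f = (\<Sum>c<length gs. vscale (g c) (gs ! c))"
      by (auto simp: fun_eq_iff sum_fun_apply vscale_apply m_def mult.commute)
    also have "\<dots> \<in> fun_module.span G"
      using gs(2) by (intro fun_module.span_sum fun_module.span_scale fun_module.span_base) auto
    finally show "f \<in> fun_module.span G" .
  qed
  have spanN: "fun_module.span G = N" using NG fun_module.span_minimal[OF GN N] by blast
  have m0: "m r c = 0" if "r \<ge> length D" "c < length gs" for r c
    unfolding m_def by (rule supp) (use that GN gs(2) in auto)
  have "minimal_generators D N D' m"
    unfolding minimal_generators_def len
  proof (intro conjI allI impI)
    fix r c assume c: "c < length gs"
    have "hcomp_vec D (deg (gs ! c)) (gs ! c) = gs ! c" using deg gs(2) c by auto
    then have "hcomp (deg (gs ! c) - int (D ! r)) ((gs ! c) r) = (gs ! c) r" by (metis hcomp_vec_def)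
    then show "m r c \<in> graded_component (int (D' ! c) - int (D ! r))"
      unfolding m_def D'[OF c] by (metis hcomp_graded)
  next
    show "N = {f. (\<forall>r\<ge>length D. f r = 0) \<and> (\<exists>g. \<forall>r<length D. f r = (\<Sum>c<length gs. m r c * g c))}" (is "_ = ?R")
    proof (intro equalityI subsetI)
      fix f assume f: "f \<in> N"
      then obtain g where "f = (\<lambda>r. \<Sum>c<length gs. m r c * g c)" using span spanN by blast
      moreover have "\<forall>r\<ge>length D. f r = 0" using supp[OF f] by blast
      ultimately show "f \<in> ?R" by blast
    next
      fix f assume "f \<in> ?R"
      then obtain g where f: "\<And>r. r \<ge> length D \<Longrightarrow> f r = 0"
        and g: "\<And>r. r < length D \<Longrightarrow> f r = (\<Sum>c<length gs. m r c * g c)" by auto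
      have "f = (\<lambda>r. \<Sum>c<length gs. m r c * g c)"
      proof
        fix r
        show "f r = (\<Sum>c<length gs. m r c * g c)"
          by (cases "r < length D") (simp_all add: f g m0)
      qed
      then show "f \<in> N" using span spanN by blast
    qed
  next
    fix e a c
    assume a: "\<forall>c<length gs. a c \<in> graded_component (e - int (D' ! c))"
      and rel: "\<forall>r<length D. (\<Sum>c<length gs. m r c * a c) = 0" and c: "c < length gs"
    show "a c \<in> irrelevant_ideal"
    proof (rule ccontr)
      assume *: "a c \<notin> irrelevant_ideal"
      then have "e - int (D' ! c) = 0" using graded_component_irrelevant a c by blast
      then have "a c \<in> graded_component 0" using a c by metis
      then have ac: "a c = cst (Poly_Mapping.lookup (a c) 0)" by (rule graded_component_0_eq_const)
      define u where "u = Poly_Mapping.lookup (a c) 0"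
      have u: "u \<noteq> 0" using * by (simp add: irrelevant_ideal_iff u_def)
      have inv: "cst (inverse u) * a c = 1" using ac u by (simp add: u_def[symmetric] mult_single)
      have rel': "(\<Sum>b<length gs. m r b * a b) = 0" for r
        using rel m0 by (cases "r < length D") auto
      \<comment> \<open>The coefficient of \<open>gs ! c\<close> is a nonzero constant, so the
        relation can be solved for this generator.\<close>
      have "gs ! c = (\<Sum>b\<in>{..<length gs} - {c}. vscale (- cst (inverse u) * a b) (gs ! b))"
      proof
        fix r
        have "0 = cst (inverse u) * (m r c * a c + (\<Sum>b\<in>{..<length gs} - {c}. m r b * a b))"
          using rel'[of r] c by (simp add: sum.remove[of "{..<length gs}" c])
        also have "\<dots> = (cst (inverse u) * a c) * m r c + (\<Sum>b\<in>{..<length gs} - {c}. cst (inverse u) * a b * m r b)"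
          by (simp add: distrib_left sum_distrib_left ac_simps)
        finally show "(gs ! c) r = (\<Sum>b\<in>{..<length gs} - {c}. vscale (- cst (inverse u) * a b) (gs ! b)) r"
          unfolding inv by (simp add: sum_fun_apply vscale_apply m_def sum_negf eq_neg_iff_add_eq_0)
      qed
      also have "\<dots> \<in> fun_module.span (G - {gs ! c})"
      proof (intro fun_module.span_sum fun_module.span_scale fun_module.span_base)
        fix b assume "b \<in> {..<length gs} - {c}"
        then show "gs ! b \<in> G - {gs ! c}" using gs c by (auto simp: nth_eq_iff_index_eq)
      qed
      finally show False using irredundant gs(2) c by auto
    qed
  qed
  then show ?thesis by blast
qed

lemma minimal_generators_column:
  assumes "minimal_generators D N D' m" and "c < length D'"
  shows "(\<lambda>r. if r < length D then m r c else 0) \<in> N"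
proof -
  have "(\<Sum>b<length D'. m r b * (if b = c then 1 else 0)) = m r c" for r
    using assms(2) by (simp add: if_distrib[of "\<lambda>x. _ * x"] cong: if_cong)
  then have "\<exists>g. \<forall>r<length D. (if r < length D then m r c else 0) = (\<Sum>b<length D'. m r b * g b)"
    by (intro exI[of _ "\<lambda>b. if b = c then 1 else 0"]) simp
  moreover have "N = {f. (\<forall>r\<ge>length D. f r = 0) \<and> (\<exists>g. \<forall>r<length D. f r = (\<Sum>c<length D'. m r c * g c))}"
    using assms(1) unfolding minimal_generators_def by blast
  ultimately show ?thesis by simp
qed

lemma minimal_generators_relation:
  assumes "minimal_generators D N D' m"
    and "\<And>c. c < length D' \<Longrightarrow> a c \<in> graded_component (e - int (D' ! c))"
    and "\<And>r. r < length D \<Longrightarrow> (\<Sum>c<length D'. m r c * a c) = 0" and "c < length D'"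
  shows "a c \<in> irrelevant_ideal"
proof -
  have "(\<forall>c<length D'. a c \<in> graded_component (e - int (D' ! c))) \<longrightarrow>
      (\<forall>r<length D. (\<Sum>c<length D'. m r c * a c) = 0) \<longrightarrow> (\<forall>c<length D'. a c \<in> irrelevant_ideal)"
    using assms(1) unfolding minimal_generators_def by blast
  then show ?thesis using assms(2-4) by blast
qed

section \<open>Construction of a minimal resolution\<close>

definition kernel_funs :: "nat \<Rightarrow> nat \<Rightarrow> (nat \<Rightarrow> nat \<Rightarrow> 'a::comm_ring_1) \<Rightarrow> (nat \<Rightarrow> 'a) set" where
  "kernel_funs nr nc m = {f. (\<forall>c\<ge>nc. f c = 0) \<and> (\<forall>r<nr. (\<Sum>c<nc. m r c * f c) = 0)}"

lemma subspace_kernel_funs: "fun_module.subspace (kernel_funs nr nc m)"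
  unfolding fun_module.subspace_def kernel_funs_def
  by (auto simp: vscale_apply distrib_left sum.distrib mult.left_commute sum_distrib_left[symmetric])

lemma hcomp_kernel_funs:
  fixes m :: "nat \<Rightarrow> nat \<Rightarrow> ('n::finite, 'k::field) xy_poly"
  assumes m: "\<And>r c. r < length D \<Longrightarrow> c < length D' \<Longrightarrow> m r c \<in> graded_component (int (D' ! c) - int (D ! r))"
    and f: "f \<in> kernel_funs (length D) (length D') m"
  shows "hcomp_vec D' e f \<in> kernel_funs (length D) (length D') m"
  unfolding kernel_funs_def
proof safe
  fix c assume "length D' \<le> c"
  then show "hcomp_vec D' e f c = 0" using f by (simp add: kernel_funs_def hcomp_vec_def)
next
  fix r assume r: "r < length D"
  have "hcomp (e - int (D ! r)) (m r c * f c) = m r c * hcomp_vec D' e f c" if c: "c < length D'" for c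
    using hcomp_mult[OF m[OF r c], of "e - int (D ! r)" "f c"] by (simp add: hcomp_vec_def mult.commute)
  then have "(\<Sum>c<length D'. m r c * hcomp_vec D' e f c) = hcomp (e - int (D ! r)) (\<Sum>c<length D'. m r c * f c)"
    by (simp add: hcomp_sum)
  then show "(\<Sum>c<length D'. m r c * hcomp_vec D' e f c) = 0" using f r by (simp add: kernel_funs_def)
qed

lemma mult_mat_vec_nth:
  assumes "A \<in> carrier_mat nr nc" and "v \<in> carrier_vec nc" and "r < nr"
  shows "(A *\<^sub>v v) $ r = (\<Sum>c<nc. A $$ (r, c) * v $ c)"
  using assms by (auto simp: scalar_prod_def lessThan_atLeast0 intro!: sum.cong)

lemma exists_minimal_graded_free_resolution:
  fixes I :: "('n::{finite,linorder}, 'k::field) xy_poly set"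
  assumes I: "graded_ideal I" and irr: "I \<subseteq> irrelevant_ideal"
  shows "\<exists>D M. minimal_graded_free_resolution I D M"
proof -
  define N0 where "N0 = {f :: nat \<Rightarrow> ('n, 'k) xy_poly. f 0 \<in> I \<and> (\<forall>r\<ge>1. f r = 0)}"
  have Ii: "is_ideal I" using I by (simp add: graded_ideal_def)
  have "fun_module.subspace N0"
    unfolding fun_module.subspace_def N0_def
    by (simp add: vscale_apply ring_module.subspace_0[OF Ii] ring_module.subspace_add[OF Ii] ideal_mult_left[OF Ii])
  moreover have "hcomp_vec [0] e f \<in> N0" if "f \<in> N0" for e f
    using that I by (auto simp: N0_def hcomp_vec_def graded_ideal_def)
  moreover have "f r = 0" if "f \<in> N0" "r \<ge> length [0 :: nat]" for f r
    using that by (simp add: N0_def)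
  ultimately obtain D1 m0 where m0: "minimal_generators [0] N0 D1 m0"
    using exists_minimal_generators[of N0 "[0]"] by blast
  \<comment> \<open>A state holds the degree lists of two consecutive steps and the differential
    between them. \<open>P\<close> carries the homogeneity that makes its kernel graded;
    \<open>Q\<close> says that the next differential minimally generates this kernel.\<close>
  define P where "P i s \<longleftrightarrow> (case s of (A, B, m) \<Rightarrow>
      (\<forall>r<length A. \<forall>c<length B. m r c \<in> graded_component (int (B ! c) - int (A ! r))) \<and>
      (i = 0 \<longrightarrow> A = [0] \<and> minimal_generators A N0 B m))"
    for i :: nat and s :: "nat list \<times> nat list \<times> (nat \<Rightarrow> nat \<Rightarrow> ('n, 'k) xy_poly)"
  define Q where "Q s s' \<longleftrightarrow> (case s of (A, B, m) \<Rightarrow> case s' of (A', B', m') \<Rightarrow>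
      A' = B \<and> minimal_generators B (kernel_funs (length A) (length B) m) B' m')"
    for s s' :: "nat list \<times> nat list \<times> (nat \<Rightarrow> nat \<Rightarrow> ('n, 'k) xy_poly)"
  have "\<exists>s. \<forall>i. P i (s i) \<and> Q (s i) (s (Suc i))"
  proof (rule dependent_nat_choice)
    show "\<exists>s. P 0 s"
      by (rule exI[of _ "([0], D1, m0)"]) (use m0 in \<open>auto simp: P_def minimal_generators_def\<close>)
  next
    fix s i assume s: "P i s"
    obtain A B m where sA: "s = (A, B, m)" by (cases s)
    then have m: "\<And>r c. r < length A \<Longrightarrow> c < length B \<Longrightarrow> m r c \<in> graded_component (int (B ! c) - int (A ! r))"
      using s by (auto simp: P_def)
    obtain B' m' where "minimal_generators B (kernel_funs (length A) (length B) m) B' m'"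
      using exists_minimal_generators[OF subspace_kernel_funs[of "length A" "length B" m], of B]
        hcomp_kernel_funs[OF m] by (auto simp: kernel_funs_def)
    then show "\<exists>s'. P (Suc i) s' \<and> Q s s'"
      by (intro exI[of _ "(B, B', m')"]) (auto simp: P_def Q_def sA minimal_generators_def)
  qed
  then obtain s where s: "\<And>i. P i (s i)" "\<And>i. Q (s i) (s (Suc i))" by blast
  define D where "D i = fst (s i)" for i
  define m where "m i = snd (snd (s i))" for i
  have D_Suc: "D (Suc i) = fst (snd (s i))" for i
    using s(2)[of i] by (auto simp: Q_def D_def split: prod.splits)
  have si: "s i = (D i, D (Suc i), m i)" for i by (simp add: D_Suc) (simp add: D_def m_def)
  have m: "m i r c \<in> graded_component (int (D (Suc i) ! c) - int (D i ! r))"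
    if "r < length (D i)" "c < length (D (Suc i))" for i r c
    using s(1)[of i] that by (simp add: P_def si)
  have D0: "D 0 = [0]" and g0: "minimal_generators [0] N0 (D (Suc 0)) (m 0)"
    using s(1)[of 0] unfolding P_def si by auto
  have gS: "minimal_generators (D (Suc i)) (kernel_funs (length (D i)) (length (D (Suc i))) (m i))
      (D (Suc (Suc i))) (m (Suc i))" for i
    using s(2)[of i] by (simp add: Q_def si)
  define M where "M i = mat (length (D (i - 1))) (length (D i)) (\<lambda>(r, c). m (i - 1) r c)" for i
  have M: "M i \<in> carrier_mat (length (D (i - 1))) (length (D i))" for i by (simp add: M_def)
  have M_nth: "M (Suc i) $$ (r, c) = m i r c" if "r < length (D i)" "c < length (D (Suc i))" for i r c
    using that by (simp add: M_def)
  have Mv: "(M (Suc i) *\<^sub>v v) $ r = (\<Sum>c<length (D (Suc i)). m i r c * v $ c)"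
    if "v \<in> carrier_vec (length (D (Suc i)))" "r < length (D i)" for i v r
    using mult_mat_vec_nth[OF M, of v "Suc i" r] that by (simp add: M_nth)
  have Mdim: "dim_vec (M (Suc i) *\<^sub>v v) = length (D i)" for i v by (simp add: M_def)
  have image: "{M (Suc i) *\<^sub>v v | v. v \<in> carrier_vec (length (D (Suc i)))} =
      {w \<in> carrier_vec (length (D i)). (\<lambda>r. if r < length (D i) then w $ r else 0) \<in> N}"
    if gen: "minimal_generators (D i) N (D (Suc i)) (m i)" for i N
  proof -
    have N: "N = {f. (\<forall>r\<ge>length (D i). f r = 0) \<and>
        (\<exists>g. \<forall>r<length (D i). f r = (\<Sum>c<length (D (Suc i)). m i r c * g c))}"
      using gen unfolding minimal_generators_def by blast
    show ?thesis
    proof (intro equalityI subsetI)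
      fix w assume "w \<in> {M (Suc i) *\<^sub>v v | v. v \<in> carrier_vec (length (D (Suc i)))}"
      then obtain v where v: "v \<in> carrier_vec (length (D (Suc i)))" "w = M (Suc i) *\<^sub>v v" by blast
      then have "w \<in> carrier_vec (length (D i))" using Mdim by (intro carrier_vecI) simp
      moreover have "(\<lambda>r. if r < length (D i) then w $ r else 0) \<in> N"
        unfolding N using Mv[OF v(1)] v(2) by (auto intro!: exI[of _ "\<lambda>c. v $ c"])
      ultimately show "w \<in> {w \<in> carrier_vec (length (D i)). (\<lambda>r. if r < length (D i) then w $ r else 0) \<in> N}"
        by simp
    next
      fix w assume "w \<in> {w \<in> carrier_vec (length (D i)). (\<lambda>r. if r < length (D i) then w $ r else 0) \<in> N}"
      then obtain g where w: "w \<in> carrier_vec (length (D i))"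
        and g: "\<And>r. r < length (D i) \<Longrightarrow> w $ r = (\<Sum>c<length (D (Suc i)). m i r c * g c)"
        unfolding N by auto
      have "w = M (Suc i) *\<^sub>v vec (length (D (Suc i))) g"
        by (rule eq_vecI) (use w g Mdim Mv in auto)
      then show "w \<in> {M (Suc i) *\<^sub>v v | v. v \<in> carrier_vec (length (D (Suc i)))}" by auto
    qed
  qed
  \<comment> \<open>At the first step the entries lie in \<open>I\<close>. Later each column is a
    homogeneous relation among the minimal generators of the previous step.\<close>
  have irrelevant: "m i r c \<in> irrelevant_ideal" if r: "r < length (D i)" and c: "c < length (D (Suc i))" for i r c
  proof (cases i)
    case 0
    have "m 0 0 c \<in> I" using minimal_generators_column[OF g0, of c] c 0 by (simp add: N0_def)
    then show ?thesis using irr r 0 D0 by auto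
  next
    case (Suc j)
    let ?a = "\<lambda>b. m (Suc j) b c"
    have "(\<lambda>b. if b < length (D (Suc j)) then m (Suc j) b c else 0)
        \<in> kernel_funs (length (D j)) (length (D (Suc j))) (m j)"
      using minimal_generators_column[OF gS] c Suc by simp
    then have rel: "(\<Sum>b<length (D (Suc j)). m j q b * ?a b) = 0" if "q < length (D j)" for q
      using that by (simp add: kernel_funs_def)
    have hom: "?a b \<in> graded_component (int (D (Suc i) ! c) - int (D (Suc j) ! b))"
      if "b < length (D (Suc j))" for b
      using m[of b "Suc j" c] c Suc that by simp
    obtain N where "minimal_generators (D j) N (D (Suc j)) (m j)"
      using g0 gS D0 by (cases j) auto
    from minimal_generators_relation[OF this hom rel] show ?thesis using r Suc by simp
  qed
  have "minimal_graded_free_resolution I D M"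
    unfolding minimal_graded_free_resolution_def
  proof (intro conjI allI impI)
    show "D 0 = [0]" by (rule D0)
  next
    fix i :: nat assume "1 \<le> i"
    then obtain j where i: "i = Suc j" by (cases i) auto
    show "M i \<in> carrier_mat (length (D (i - 1))) (length (D i))" by (rule M)
    show "M i $$ (r, c) \<in> graded_component (int (D i ! c) - int (D (i - 1) ! r))"
      and "M i $$ (r, c) \<in> irrelevant_ideal" if "r < length (D (i - 1))" "c < length (D i)" for r c
      using that m irrelevant by (simp_all add: i M_nth)
    have "(\<lambda>r. if r < length (D (Suc j)) then w $ r else 0)
        \<in> kernel_funs (length (D j)) (length (D (Suc j))) (m j) \<longleftrightarrow> M (Suc j) *\<^sub>v w = 0\<^sub>v (length (D j))"
      if "w \<in> carrier_vec (length (D (Suc j)))" for w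
      using Mv[OF that] Mdim by (auto simp: kernel_funs_def vec_eq_iff)
    then show "{M (i + 1) *\<^sub>v v | v. v \<in> carrier_vec (length (D (i + 1)))} = mat_kernel (M i)"
      using image[OF gS, of j] M[of "Suc j"] by (auto simp: i mat_kernel_def)
  next
    show "{M 1 *\<^sub>v v | v. v \<in> carrier_vec (length (D 1))} = {w \<in> carrier_vec 1. w $ 0 \<in> I}"
      using image[of 0 N0] g0 D0 by (simp add: N0_def)
  qed
  then show ?thesis by blast
qed

section \<open>From matrix resolutions to the regularity\<close>

lemma graded_resolution_of_minimal:
  fixes I :: "('n::{finite,linorder}, 'k::field) xy_poly set"
  assumes I: "is_ideal I" and res: "minimal_graded_free_resolution I D M"
  shows "graded_resolution I (\<lambda>i. length (D i)) (\<lambda>i r. int (D i ! r)) (\<lambda>i r c. M (Suc i) $$ (r, c))"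
proof -
  have D0: "D 0 = [0]" and M: "M (Suc i) \<in> carrier_mat (length (D i)) (length (D (Suc i)))"
    and gr: "r < length (D i) \<Longrightarrow> c < length (D (Suc i)) \<Longrightarrow>
      M (Suc i) $$ (r, c) \<in> graded_component (int (D (Suc i) ! c) - int (D i ! r))"
    and im: "{M 1 *\<^sub>v v | v. v \<in> carrier_vec (length (D 1))} = {w \<in> carrier_vec 1. w $ 0 \<in> I}"
    and ker: "{M (Suc (Suc i)) *\<^sub>v v | v. v \<in> carrier_vec (length (D (Suc (Suc i))))} = mat_kernel (M (Suc i))"
    for i r c
    using res unfolding minimal_graded_free_resolution_def
    by (auto dest: spec[of _ "Suc i"])
  have Mv: "(M (Suc i) *\<^sub>v vec (length (D (Suc i))) g) $ r = (\<Sum>c<length (D (Suc i)). M (Suc i) $$ (r, c) * g c)"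
    if "r < length (D i)" for i g r
    using mult_mat_vec_nth[OF M, of "vec (length (D (Suc i))) g" i r] that by simp
  have dim: "dim_vec (M (Suc i) *\<^sub>v v) = length (D i)" for i v using M[of i] by simp
  show ?thesis
  proof
    show "is_ideal I" by (rule I)
    show "length (D 0) = 1" "int (D 0 ! 0) = 0" using D0 by simp_all
    show "M (Suc i) $$ (r, c) \<in> graded_component (int (D (Suc i) ! c) - int (D i ! r))"
      if "r < length (D i)" "c < length (D (Suc i))" for i r c using gr that .
    show "{\<Sum>c<length (D 1). M (Suc 0) $$ (0, c) * g c | g. True} = I"
    proof (intro equalityI subsetI)
      fix f assume "f \<in> {\<Sum>c<length (D 1). M (Suc 0) $$ (0, c) * g c | g. True}"
      then obtain g where "f = (\<Sum>c<length (D 1). M (Suc 0) $$ (0, c) * g c)" by blast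
      then have "f = (M 1 *\<^sub>v vec (length (D 1)) g) $ 0" using Mv[of 0 0 g] D0 by simp
      moreover have "M 1 *\<^sub>v vec (length (D 1)) g \<in> {w \<in> carrier_vec 1. w $ 0 \<in> I}"
        unfolding im[symmetric] by auto
      ultimately show "f \<in> I" by simp
    next
      fix f assume "f \<in> I"
      then have "vec 1 (\<lambda>_. f) \<in> {w \<in> carrier_vec 1. w $ 0 \<in> I}" by simp
      then obtain v where v: "vec 1 (\<lambda>_. f) = M 1 *\<^sub>v v" "v \<in> carrier_vec (length (D 1))"
        unfolding im[symmetric] by blast
      have "f = vec 1 (\<lambda>_. f) $ 0" by simp
      also have "\<dots> = (\<Sum>c<length (D 1). M (Suc 0) $$ (0, c) * v $ c)"
        unfolding v(1) using mult_mat_vec_nth[OF M[of 0], of v 0] v(2) D0 by simp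
      finally show "f \<in> {\<Sum>c<length (D 1). M (Suc 0) $$ (0, c) * g c | g. True}" by blast
    qed
  next
    fix i g r assume r: "r < length (D i)"
    define w where "w = M (Suc (Suc i)) *\<^sub>v vec (length (D (Suc (Suc i)))) g"
    have "w \<in> mat_kernel (M (Suc i))" unfolding ker[symmetric] w_def by auto
    then have w: "w \<in> carrier_vec (length (D (Suc i)))" "M (Suc i) *\<^sub>v w = 0\<^sub>v (length (D i))"
      using M[of i] by (auto simp: mat_kernel_def)
    have "(\<Sum>c<length (D (Suc i)). M (Suc i) $$ (r, c) * w $ c) = 0"
      using mult_mat_vec_nth[OF M w(1) r] w(2) r by simp
    then show "(\<Sum>c<length (D (Suc i)). M (Suc i) $$ (r, c) *
        (\<Sum>b<length (D (Suc (Suc i))). M (Suc (Suc i)) $$ (c, b) * g b)) = 0"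
      by (simp add: w_def Mv)
  next
    fix i f
    assume f: "\<And>r. r < length (D i) \<Longrightarrow> (\<Sum>c<length (D (Suc i)). M (Suc i) $$ (r, c) * f c) = 0"
    have "M (Suc i) *\<^sub>v vec (length (D (Suc i))) f = 0\<^sub>v (length (D i))"
      by (rule eq_vecI) (use f dim Mv in auto)
    then have "vec (length (D (Suc i))) f \<in> mat_kernel (M (Suc i))" using M[of i] by (auto simp: mat_kernel_def)
    then obtain v where v: "vec (length (D (Suc i))) f = M (Suc (Suc i)) *\<^sub>v v"
      "v \<in> carrier_vec (length (D (Suc (Suc i))))" unfolding ker[symmetric] by blast
    have "f r = (\<Sum>b<length (D (Suc (Suc i))). M (Suc (Suc i)) $$ (r, b) * v $ b)" if "r < length (D (Suc i))" for r
      using mult_mat_vec_nth[OF M v(2) that] that unfolding v(1)[symmetric] by simp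
    then show "\<exists>g. \<forall>r<length (D (Suc i)). f r = (\<Sum>b<length (D (Suc (Suc i))). M (Suc (Suc i)) $$ (r, b) * g b)"
      by blast
  qed
qed

text \<open>Existence guarantees that the choice inside \<open>graded_betti\<close> is a resolution,
  so a degree found in every resolution is found in the chosen one.\<close>

lemma regularity_ge:
  fixes I :: "('n::{finite,linorder}, 'k::field) xy_poly set"
  assumes I: "graded_ideal I" "I \<subseteq> irrelevant_ideal"
    and ge: "\<And>D M. minimal_graded_free_resolution I D M \<Longrightarrow> \<exists>r<length (D i). int (D i ! r) \<ge> d + int i"
  shows "ereal (real_of_int d) \<le> regularity I"
proof -
  define D where "D = (SOME D. \<exists>M. minimal_graded_free_resolution I D M)"
  have "\<exists>M. minimal_graded_free_resolution I D M"
    using someI_ex[OF exists_minimal_graded_free_resolution[OF I]] by (simp add: D_def)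
  then obtain r where r: "r < length (D i)" "int (D i ! r) \<ge> d + int i" using ge by blast
  then have "graded_betti I i (D i ! r) \<noteq> 0"
    unfolding graded_betti_def D_def[symmetric] by (simp add: count_list_0_iff)
  then have "ereal (real (D i ! r) - real i) \<le> regularity I"
    unfolding regularity_def by (intro Sup_upper) blast
  moreover have "real_of_int d \<le> real (D i ! r) - real i" using r(2) by linarith
  ultimately show ?thesis using order_trans ereal_less_eq(3) by blast
qed

section \<open>Linear specializations\<close>

text \<open>A linear specialization that keeps the variables in \<open>U\<close>; every other
  variable goes to the variable prescribed by \<open>\<rho>\<close>, or to 0 for
  \<open>None\<close>.\<close>

definition special :: "'n var set \<Rightarrow> ('n var \<Rightarrow> 'n var option) \<Rightarrow> 'n var \<Rightarrow> ('n, 'k::field) xy_poly" where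
  "special U \<rho> v = (if v \<in> U then varp v else case \<rho> v of None \<Rightarrow> 0 | Some u \<Rightarrow> varp u)"

lemma varp_inj: "varp u = (varp v :: ('n, 'k::field) xy_poly) \<longleftrightarrow> u = v"
  and varp_nonzero: "varp v \<noteq> (0 :: ('n, 'k::field) xy_poly)"
proof -
  have "Poly_Mapping.lookup (varp v :: ('n, 'k) xy_poly) (Poly_Mapping.single v 1) = 1" by (simp add: varp_def)
  then show "varp v \<noteq> (0 :: ('n, 'k) xy_poly)" by auto
  have "u = v" if "varp u = (varp v :: ('n, 'k) xy_poly)"
  proof -
    have "Poly_Mapping.keys (varp u :: ('n, 'k) xy_poly) = Poly_Mapping.keys (varp v :: ('n, 'k) xy_poly)"
      using that by simp
    then have "Poly_Mapping.single u (1::nat) = Poly_Mapping.single v 1" by (simp add: varp_def)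
    then have "Poly_Mapping.keys (Poly_Mapping.single u (1::nat)) = Poly_Mapping.keys (Poly_Mapping.single v (1::nat))"
      by simp
    then show ?thesis by simp
  qed
  then show "varp u = (varp v :: ('n, 'k) xy_poly) \<longleftrightarrow> u = v" by auto
qed

text \<open>The linear coordinates are the forms generating the kernel of the specialization,
  followed by the variables in \<open>U\<close>. Each partial ideal is the kernel of an explicit
  substitution, hence prime, and does not contain the next form, which is thus a
  nonzerodivisor.\<close>

lemma regularity_ge_specialization:
  fixes I :: "('n::{finite,linorder}, 'k::field) xy_poly set"
  assumes I: "graded_ideal I" "I \<subseteq> irrelevant_ideal"
    and \<rho>: "\<And>v u. \<rho> v = Some u \<Longrightarrow> u \<in> U"
    and nilp: "\<And>u. u \<in> U \<Longrightarrow> \<exists>M. \<exists>b\<in>I. subst_poly (special U \<rho>) b = varp u ^ M"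
    and w: "w \<in> graded_component d"
    and w_notin: "\<And>b. b \<in> I \<Longrightarrow> subst_poly (special U \<rho>) b \<noteq> subst_poly (special U \<rho>) w"
  shows "ereal (real_of_int d) \<le> regularity I"
proof -
  define z :: "'n var \<Rightarrow> ('n, 'k) xy_poly" where
    "z v = (if v \<in> U then varp v else varp v - (case \<rho> v of None \<Rightarrow> 0 | Some u \<Rightarrow> varp u))" for v
  \<comment> \<open>\<open>g W\<close> solves the equations \<open>z v = 0\<close> for
    \<open>v\<close> in \<open>W\<close>. A variable outside \<open>U\<close> whose target under
    \<open>\<rho>\<close> is also in \<open>W\<close> becomes 0, as the target does.\<close>
  define g :: "'n var set \<Rightarrow> 'n var \<Rightarrow> ('n, 'k) xy_poly" where
    "g W v = (if v \<notin> W then varp v else if v \<in> U then 0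
      else case \<rho> v of None \<Rightarrow> 0 | Some u \<Rightarrow> if u \<in> W then 0 else varp u)" for W v
  have gU: "g W u = (if u \<in> W then 0 else varp u)" if "u \<in> U" for u W using that by (simp add: g_def)
  have ker: "{f. subst_poly (g W) f = 0} = ideal_span (z ` W)" for W
  proof (rule kernel_subst_poly_eq_span)
    fix f assume "f \<in> z ` W"
    then obtain v where v: "v \<in> W" "f = z v" by blast
    show "subst_poly (g W) f = 0"
    proof (cases "v \<in> U")
      case True
      then show ?thesis using v by (simp add: z_def gU)
    next
      case False
      show ?thesis
      proof (cases "\<rho> v")
        case None
        then show ?thesis using v False by (simp add: z_def) (simp add: g_def)
      next
        case (Some u)
        then have "subst_poly (g W) f = g W v - g W u"
          using v False by (simp add: z_def subst_poly_diff)
        also have "\<dots> = 0" using v False Some gU[OF \<rho>[OF Some]] by (simp add: g_def)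
        finally show ?thesis .
      qed
    qed
  next
    fix v
    have zW: "z v \<in> ideal_span (z ` W)" if "v \<in> W" for v using that by (intro ring_module.span_base) auto
    show "varp v - g W v \<in> ideal_span (z ` W)"
    proof (cases "v \<in> W \<and> v \<notin> U")
      case False
      show ?thesis
      proof (cases "v \<in> W")
        case True
        then show ?thesis using False zW[of v] gU[of v W] by (simp add: z_def)
      next
        case False
        then show ?thesis by (simp add: g_def ring_module.span_zero)
      qed
    next
      case v: True
      show ?thesis
      proof (cases "\<rho> v")
        case None
        then show ?thesis using v zW[of v] by (simp add: g_def z_def)
      next
        case (Some u)
        show ?thesis
        proof (cases "u \<in> W")
          case True
          have "varp v - g W v = z v + z u"
            using v Some True \<rho>[OF Some] by (simp add: g_def z_def)
          then show ?thesis using zW v True by (simp add: ring_module.span_add)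
        next
          case False
          then have "varp v - g W v = z v" using v Some by (simp add: g_def z_def)
          then show ?thesis using zW v by simp
        qed
      qed
    qed
  qed
  have z_notin: "z v \<notin> ideal_span (z ` W)" if v: "v \<notin> W" for v W
  proof
    assume "z v \<in> ideal_span (z ` W)"
    then have 0: "subst_poly (g W) (z v) = 0" using ker[of W] by blast
    have "g W v = varp v" using v by (simp add: g_def)
    have nz: "(varp v :: ('n, 'k) xy_poly) \<noteq> 0" by (rule varp_nonzero)
    show False
    proof (cases "v \<in> U")
      case False
      show ?thesis
      proof (cases "\<rho> v")
        case None
        then show ?thesis using 0 \<open>g W v = varp v\<close> False nz by (simp add: z_def)
      next
        case (Some u)
        then have "varp v = g W u" using 0 \<open>g W v = varp v\<close> False by (simp add: z_def subst_poly_diff)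
        moreover have "g W u = 0 \<or> g W u = varp u" using gU[OF \<rho>[OF Some]] by auto
        ultimately show ?thesis using nz \<rho>[OF Some] False by (metis varp_inj)
      qed
    qed (use 0 \<open>g W v = varp v\<close> nz in \<open>simp add: z_def\<close>)
  qed
  \<comment> \<open>The variables outside \<open>U\<close> come first, so that after
    \<open>a\<close> forms the ideal is exactly the kernel of the specialization.\<close>
  obtain es where es: "set es = - U" "distinct es" using finite_distinct_list[of "- U"] by auto
  obtain us where us: "set us = U" "distinct us" using finite_distinct_list[of U] by auto
  define vs where "vs = es @ us"
  define a where "a = length es"
  define l where "l = length us"
  have vs: "distinct vs" "set vs = UNIV" "length vs = a + l"
    using es us by (auto simp: vs_def a_def l_def)
  define Q where "Q p = ideal_span (z ` set (take p vs))" for p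
  have take_Suc: "set (take (Suc p) vs) = insert (vs ! p) (set (take p vs))" if "p < a + l" for p
    using that vs by (simp add: take_Suc_conv_app_nth)
  have notin: "vs ! p \<notin> set (take p vs)" if "p < a + l" for p
    using that vs distinct_take[of vs "Suc p"] by (simp add: take_Suc_conv_app_nth)
  have z1: "z v \<in> graded_component 1" for v
    by (auto simp: z_def intro!: graded_component_diff split: option.split)
  have Qa: "Q a = {f. subst_poly (special U \<rho>) f = 0}"
  proof -
    have "set (take a vs) = - U" using es by (simp add: vs_def a_def)
    moreover have "g (- U) = special U \<rho>"
    proof
      fix v
      show "g (- U) v = special U \<rho> v"
        using \<rho> by (auto simp: g_def special_def split: option.split)
    qed
    ultimately show ?thesis using ker[of "- U"] by (simp add: Q_def)
  qed
  show ?thesis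
  proof (rule regularity_ge[OF I])
    fix D M assume "minimal_graded_free_resolution I D M"
    then interpret graded_resolution I "\<lambda>i. length (D i)" "\<lambda>i r. int (D i ! r)" "\<lambda>i r c. M (Suc i) $$ (r, c)"
      by (rule graded_resolution_of_minimal[rotated]) (use I(1) in \<open>simp add: graded_ideal_def\<close>)
    show "\<exists>r<length (D l). int (D l ! r) \<ge> d + int l"
    proof (rule generator_degree_ge[where Q = Q and a = a and z = "\<lambda>p. z (vs ! p)"])
      show "Q 0 = {0}" by (simp add: Q_def)
      show "graded_ideal (Q p)" for p unfolding Q_def by (rule graded_ideal_span) (use z1 in blast)
      show "z (vs ! p) \<in> graded_component 1" for p by (rule z1)
      show "f \<in> Q (Suc p) \<longleftrightarrow> (\<exists>a q. q \<in> Q p \<and> f = z (vs ! p) * a + q)" if p: "p < a + l" for p f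
      proof
        assume "f \<in> Q (Suc p)"
        then show "\<exists>a q. q \<in> Q p \<and> f = z (vs ! p) * a + q"
          unfolding Q_def take_Suc[OF p] image_insert by (rule ideal_span_insert_mem)
      next
        assume "\<exists>a q. q \<in> Q p \<and> f = z (vs ! p) * a + q"
        then obtain b q where bq: "q \<in> Q p" "f = z (vs ! p) * b + q" by blast
        have "Q p \<subseteq> Q (Suc p)" unfolding Q_def take_Suc[OF p] by (intro ring_module.span_mono) auto
        moreover have "b * z (vs ! p) \<in> Q (Suc p)"
          unfolding Q_def take_Suc[OF p] by (intro ring_module.span_scale ring_module.span_base) auto
        ultimately show "f \<in> Q (Suc p)"
          using bq ring_module.span_add[of "b * z (vs ! p)" _ q] by (auto simp: Q_def mult.commute)
      qed
      show "f \<in> Q p" if "p < a + l" "z (vs ! p) * f \<in> Q p" for p f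
        using prime_kernel_subst_poly[of "g (set (take p vs))"] z_notin[OF notin[OF that(1)]] that(2)
        unfolding ker Q_def is_prime_ideal_def by blast
      show "\<exists>M b. b \<in> I \<and> z (vs ! p) ^ M - b \<in> Q a" if "a \<le> p" "p < a + l" for p
      proof -
        have "vs ! p \<in> U" using that us by (auto simp: vs_def nth_append a_def l_def)
        then obtain M b where "b \<in> I" "subst_poly (special U \<rho>) b = varp (vs ! p) ^ M"
          using nilp by blast
        then show ?thesis using \<open>vs ! p \<in> U\<close> unfolding Qa
          by (intro exI[of _ M] exI[of _ b]) (simp add: z_def subst_poly_simps special_def)
      qed
      show "irrelevant_ideal \<subseteq> Q (a + l)"
      proof -
        have "Q (a + l) = {f. subst_poly (g UNIV) f = 0}" using vs ker[of UNIV] by (simp add: Q_def)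
        moreover have "g UNIV v = 0" for v by (simp add: g_def split: option.split)
        ultimately show ?thesis
          unfolding irrelevant_ideal_eq by (intro ring_module.span_minimal) (auto simp: is_ideal_subst_kernel)
      qed
      show "w \<in> graded_component d" by (rule w)
      show "w - b \<notin> Q a" if "b \<in> I" for b
        using w_notin[OF that] unfolding Qa by (simp add: subst_poly_diff)
    qed
  qed
qed

section \<open>Powers of a complete intersection of quadrics\<close>

text \<open>The quadrics \<open>q i = u\<^sub>i\<^sup>2 - u\<^bsub>i-1\<^esub> u\<^bsub>i+1\<^esub>\<close> have leading monomials \<open>u\<^sub>i\<^sup>2\<close> for the strictly concave
  weights \<open>l\<^sup>2 - i\<^sup>2\<close>. Hence the products of powers of the \<open>q i\<close> with monomials of degree at most 1 in each \<open>u\<^sub>i\<close>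
  form a vector space basis, indexed by the leading monomials.\<close>

locale path_quadrics =
  fixes l :: nat and u :: "nat \<Rightarrow> 'n::{finite,linorder} var" and ty :: "'k::field itself"
  assumes u_inj: "inj_on u {..<l}"
begin

text \<open>The value 0 from index \<open>l\<close> on, and the explicit 0 at index 0 in
  \<open>quadric\<close>, make the first and the last quadric pure squares.\<close>

definition uvar :: "nat \<Rightarrow> ('n, 'k) xy_poly" where
  "uvar i = (if i < l then varp (u i) else 0)"

definition quadric :: "nat \<Rightarrow> ('n, 'k) xy_poly" where
  "quadric i = uvar i ^ 2 - (if i = 0 then 0 else uvar (i - 1)) * uvar (Suc i)"

definition expo :: "nat \<Rightarrow> ('n var \<Rightarrow>\<^sub>0 nat) \<Rightarrow> nat" where
  "expo i m = Poly_Mapping.lookup m (u i)"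

definition weight :: "('n var \<Rightarrow>\<^sub>0 nat) \<Rightarrow> nat" where
  "weight m = (\<Sum>i<l. (l * l - i * i) * expo i m)"

definition squares :: "(nat \<Rightarrow> nat) \<Rightarrow> 'n var \<Rightarrow>\<^sub>0 nat" where
  "squares \<alpha> = (\<Sum>i<l. Poly_Mapping.single (u i) (2 * \<alpha> i))"

definition mixed :: "('n var \<Rightarrow>\<^sub>0 nat) \<Rightarrow> (nat \<Rightarrow> nat) \<Rightarrow> ('n, 'k) xy_poly" where
  "mixed \<delta> \<alpha> = xmon \<delta> * (\<Prod>i<l. quadric i ^ \<alpha> i)"

definition below :: "nat \<Rightarrow> ('n, 'k) xy_poly \<Rightarrow> bool" where
  "below t f \<longleftrightarrow> (\<forall>m\<in>Poly_Mapping.keys f. weight m < t)"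

text \<open>All other terms have strictly smaller weight, so a weight suffices and no ties have to
  be broken; the leading coefficient is 1.\<close>

definition leads :: "('n, 'k) xy_poly \<Rightarrow> ('n var \<Rightarrow>\<^sub>0 nat) \<Rightarrow> bool" where
  "leads f m \<longleftrightarrow> below (weight m) (f - xmon m)"

lemma expo_add: "expo i (m + m') = expo i m + expo i m'"
  by (simp add: expo_def lookup_add)

lemma expo_single: "i < l \<Longrightarrow> j < l \<Longrightarrow> expo i (Poly_Mapping.single (u j) e) = (if i = j then e else 0)"
  using u_inj by (auto simp: expo_def lookup_single when_def inj_on_def)

lemma weight_add: "weight (m + m') = weight m + weight m'"
  by (simp add: weight_def expo_add distrib_left sum.distrib)

lemma weight_single: "j < l \<Longrightarrow> weight (Poly_Mapping.single (u j) e) = (l * l - j * j) * e"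
  by (simp add: weight_def expo_single if_distrib[of "\<lambda>x. _ * x"] cong: if_cong)

lemma expo_squares: "i < l \<Longrightarrow> expo i (squares \<alpha>) = 2 * \<alpha> i"
proof -
  assume i: "i < l"
  have "expo i (squares \<alpha>) = (\<Sum>j<l. expo i (Poly_Mapping.single (u j) (2 * \<alpha> j)))"
    by (simp add: expo_def squares_def lookup_sum)
  also have "\<dots> = (\<Sum>j<l. if i = j then 2 * \<alpha> j else 0)" by (rule sum.cong) (auto simp: expo_single i)
  finally show ?thesis using i by simp
qed

lemma below_add: "below t f \<Longrightarrow> below t g \<Longrightarrow> below t (f + g)"
  using keys_add[of f g] unfolding below_def by blast

lemma below_mult: "below s f \<Longrightarrow> (\<And>m. m \<in> Poly_Mapping.keys g \<Longrightarrow> weight m \<le> t) \<Longrightarrow> below (s + t) (f * g)"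
  using keys_mult[of f g] unfolding below_def by (fastforce simp: weight_add)

lemma leads_keys: "leads f m \<Longrightarrow> k \<in> Poly_Mapping.keys f \<Longrightarrow> weight k \<le> weight m"
proof (cases "k = m")
  case False
  assume "leads f m" "k \<in> Poly_Mapping.keys f"
  then have "k \<in> Poly_Mapping.keys (f - xmon m)"
    using False by (simp add: in_keys_iff lookup_minus lookup_single)
  then show ?thesis using \<open>leads f m\<close> unfolding leads_def below_def by fastforce
qed simp

lemma leads_lookup:
  assumes "leads f m" and "weight m \<le> weight k"
  shows "Poly_Mapping.lookup f k = (if k = m then 1 else 0)"
proof -
  have "k \<notin> Poly_Mapping.keys (f - xmon m)" using assms unfolding leads_def below_def by fastforce
  then show ?thesis by (auto simp: in_keys_iff lookup_minus lookup_single when_def)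
qed

lemma leads_mult: "leads f m \<Longrightarrow> leads g m' \<Longrightarrow> leads (f * g) (m + m')"
proof -
  assume f: "leads f m" and g: "leads g m'"
  have "f * g - xmon (m + m') = (f - xmon m) * g + (g - xmon m') * xmon m"
    by (simp add: xmon_add algebra_simps)
  moreover have "below (weight m + weight m') ((f - xmon m) * g)"
    using f leads_keys[OF g] by (intro below_mult) (auto simp: leads_def)
  moreover have "below (weight m' + weight m) ((g - xmon m') * xmon m)"
    using g by (intro below_mult) (auto simp: leads_def)
  ultimately show ?thesis unfolding leads_def weight_add by (simp add: below_add add.commute)
qed

lemma leads_xmon: "leads (xmon m) m"
  by (simp add: leads_def below_def)

lemma leads_power: "leads f m \<Longrightarrow> leads (f ^ e) (\<Sum>i<e. m)"
proof (induction e)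
  case 0
  show ?case using leads_xmon[of 0] by simp
next
  case (Suc e)
  then show ?case using leads_mult[of f m "f ^ e" "\<Sum>i<e. m"] by (simp add: add.commute)
qed

lemma single_sum: "(\<Sum>i<e. Poly_Mapping.single v c) = Poly_Mapping.single v (e * c)" for c :: nat
  by (induction e) (simp_all add: single_add[symmetric] add.commute)

lemma uvar_sq: "i < l \<Longrightarrow> uvar i ^ 2 = xmon (Poly_Mapping.single (u i) 2)"
  by (simp add: uvar_def varp_power)

text \<open>Strict since \<open>(i - 1)^2 + (i + 1)^2 = 2 * i^2 + 2\<close>. The bound
  \<open>Suc i < l\<close> keeps the subtractions in \<open>nat\<close> exact.\<close>

lemma weight_concave:
  assumes "0 < i" "Suc i < l"
  shows "(l * l - (i - 1) * (i - 1)) + (l * l - Suc i * Suc i) < (l * l - i * i) * 2"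
proof -
  obtain j where j: "i = Suc j" using assms by (cases i) auto
  have "Suc i * Suc i \<le> l * l" by (rule mult_le_mono) (use assms in auto)
  then show ?thesis by (simp add: j algebra_simps)
qed

lemma leads_quadric:
  assumes i: "i < l"
  shows "leads (quadric i) (Poly_Mapping.single (u i) 2)"
proof -
  have "below (weight (Poly_Mapping.single (u i) 2)) (- ((if i = 0 then 0 else uvar (i - 1)) * uvar (Suc i)))"
  proof (cases "i = 0 \<or> \<not> Suc i < l")
    case True
    then show ?thesis by (auto simp: below_def uvar_def)
  next
    case False
    then have "i - 1 < l" using i by linarith
    then have "uvar (i - 1) * uvar (Suc i) = xmon (Poly_Mapping.single (u (i - 1)) 1 + Poly_Mapping.single (u (Suc i)) 1)"
      using False by (simp add: uvar_def varp_def xmon_add)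
    then show ?thesis using False \<open>i - 1 < l\<close> weight_concave[of i]
      by (simp add: below_def weight_add weight_single)
  qed
  then show ?thesis unfolding leads_def quadric_def uvar_sq[OF i] by simp
qed

lemma leads_mixed: "leads (mixed \<delta> \<alpha>) (\<delta> + squares \<alpha>)"
proof -
  have "leads (\<Prod>i<j. quadric i ^ \<alpha> i) (\<Sum>i<j. Poly_Mapping.single (u i) (2 * \<alpha> i))" if "j \<le> l" for j
    using that
  proof (induction j)
    case 0
    show ?case using leads_xmon[of 0] by simp
  next
    case (Suc j)
    have "leads (quadric j ^ \<alpha> j) (Poly_Mapping.single (u j) (2 * \<alpha> j))"
      using leads_power[OF leads_quadric[of j], of "\<alpha> j"] Suc.prems by (simp add: single_sum mult.commute)
    from leads_mult[OF Suc.IH this] show ?case using Suc.prems by simp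
  qed
  from leads_mult[OF leads_xmon this[of l]] show ?thesis by (simp add: mixed_def squares_def)
qed

section \<open>The basis and its filtration by the number of quadric factors\<close>

definition half :: "('n var \<Rightarrow>\<^sub>0 nat) \<Rightarrow> nat \<Rightarrow> nat" where
  "half \<gamma> i = expo i \<gamma> div 2"

text \<open>The exponent of each u_i in \<open>\<gamma>\<close> is split by division by 2: the
  quotient becomes a power of the quadric, the remainder stays in the monomial. The leading monomial
  is again \<open>\<gamma>\<close>.\<close>

definition basis :: "('n var \<Rightarrow>\<^sub>0 nat) \<Rightarrow> ('n, 'k) xy_poly" where
  "basis \<gamma> = mixed (\<gamma> - squares (half \<gamma>)) (half \<gamma>)"

definition level :: "('n var \<Rightarrow>\<^sub>0 nat) \<Rightarrow> nat" where
  "level \<gamma> = (\<Sum>i<l. half \<gamma> i)"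

lemma lookup_squares_other: "v \<notin> u ` {..<l} \<Longrightarrow> Poly_Mapping.lookup (squares \<alpha>) v = 0"
  unfolding squares_def lookup_sum by (intro sum.neutral) (auto simp: lookup_single when_def)

lemma squares_half_le: "\<gamma> - squares (half \<gamma>) + squares (half \<gamma>) = \<gamma>"
proof (rule poly_mapping_eqI)
  fix v
  have "Poly_Mapping.lookup (squares (half \<gamma>)) v \<le> Poly_Mapping.lookup \<gamma> v"
  proof (cases "v \<in> u ` {..<l}")
    case True
    then obtain i where "i < l" "v = u i" by blast
    then show ?thesis using expo_squares[of i "half \<gamma>"] by (simp add: expo_def half_def)
  qed (simp add: lookup_squares_other)
  then show "Poly_Mapping.lookup (\<gamma> - squares (half \<gamma>) + squares (half \<gamma>)) v = Poly_Mapping.lookup \<gamma> v"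
    by (simp add: lookup_add lookup_minus)
qed

lemma leads_basis: "leads (basis \<gamma>) \<gamma>"
  using leads_mixed[of "\<gamma> - squares (half \<gamma>)" "half \<gamma>"] by (simp add: basis_def squares_half_le)

lemma mixed_cong: "(\<And>i. i < l \<Longrightarrow> \<alpha> i = \<beta> i) \<Longrightarrow> mixed \<delta> \<alpha> = mixed \<delta> \<beta>"
  by (simp add: mixed_def)

lemma mixed_eq_basis:
  assumes "\<And>i. i < l \<Longrightarrow> expo i \<delta> < 2"
  shows "mixed \<delta> \<alpha> = basis (\<delta> + squares \<alpha>)" and "level (\<delta> + squares \<alpha>) = (\<Sum>i<l. \<alpha> i)"
proof -
  have half: "half (\<delta> + squares \<alpha>) i = \<alpha> i" if "i < l" for i
    using assms[OF that] by (simp add: half_def expo_add expo_squares that)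
  then have "squares (half (\<delta> + squares \<alpha>)) = squares \<alpha>" by (simp add: squares_def)
  then show "mixed \<delta> \<alpha> = basis (\<delta> + squares \<alpha>)" using mixed_cong[OF half] by (simp add: basis_def)
  show "level (\<delta> + squares \<alpha>) = (\<Sum>i<l. \<alpha> i)" using half by (simp add: level_def)
qed

text \<open>The linear span of the basis elements with at least \<open>j\<close> quadric factors.
  Once it is known to be an ideal, it bounds the \<open>j\<close>-th power, and leading monomials
  decide what lies outside.\<close>

inductive_set filt :: "nat \<Rightarrow> ('n, 'k) xy_poly set" for j where
  zero: "0 \<in> filt j"
| step: "f \<in> filt j \<Longrightarrow> level \<gamma> \<ge> j \<Longrightarrow> f + cst a * basis \<gamma> \<in> filt j"

lemma filt_add: "g \<in> filt j \<Longrightarrow> f \<in> filt j \<Longrightarrow> f + g \<in> filt j"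
proof (induction rule: filt.induct)
  case (step g \<gamma> a)
  then show ?case using filt.step[of "f + g" j \<gamma> a] by (simp add: add.assoc)
qed simp

lemma filt_cst: "f \<in> filt j \<Longrightarrow> cst c * f \<in> filt j"
proof (induction rule: filt.induct)
  case zero
  show ?case using filt.zero by simp
next
  case (step f \<gamma> a)
  have "cst c * (f + cst a * basis \<gamma>) = cst c * f + cst (c * a) * basis \<gamma>"
    by (simp add: distrib_left mult.assoc[symmetric] mult_single)
  then show ?case using filt.step[OF step.IH step.hyps(2)] by simp
qed

lemma basis_filt: "level \<gamma> \<ge> j \<Longrightarrow> basis \<gamma> \<in> filt j"
  using filt.step[OF filt.zero, of j \<gamma> 1] by simp

lemma mixed_upd: "i < l \<Longrightarrow> mixed \<delta> (\<alpha>(i := Suc (\<alpha> i))) = quadric i * mixed \<delta> \<alpha>"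
  by (simp add: mixed_def prod.remove[of "{..<l}" i] ac_simps)

lemma mixed_xmon: "mixed (\<delta> + \<delta>') \<alpha> = xmon \<delta> * mixed \<delta>' \<alpha>"
  by (simp add: mixed_def xmon_add mult.assoc)

lemma sum_upd: "i < l \<Longrightarrow> (\<Sum>b<l. (\<alpha>(i := Suc (\<alpha> i))) b) = Suc (\<Sum>b<l. \<alpha> b)" for \<alpha> :: "nat \<Rightarrow> nat"
  by (simp add: sum.remove[of "{..<l}" i])

text \<open>Straightening: replace a square of u_i in \<open>\<delta>\<close> by the quadric plus
  u_(i-1) u_(i+1). Both terms have a monomial part of smaller weight, and the number of quadric
  factors does not drop.\<close>

lemma mixed_filt: "j \<le> (\<Sum>i<l. \<alpha> i) \<Longrightarrow> mixed \<delta> \<alpha> \<in> filt j"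
proof (induction "weight \<delta>" arbitrary: \<delta> \<alpha> rule: less_induct)
  case less
  show ?case
  proof (cases "\<forall>i<l. expo i \<delta> < 2")
    case True
    then show ?thesis using mixed_eq_basis[of \<delta> \<alpha>] basis_filt less.prems by auto
  next
    case False
    then obtain i where i: "i < l" "expo i \<delta> \<ge> 2" by force
    define \<epsilon> where "\<epsilon> = \<delta> - Poly_Mapping.single (u i) 2"
    have \<delta>: "\<delta> = Poly_Mapping.single (u i) 2 + \<epsilon>"
      using i(2) by (intro poly_mapping_eqI)
        (auto simp: \<epsilon>_def lookup_add lookup_minus lookup_single when_def expo_def)
    have "i * i < l * l" using i(1) by (simp add: mult_strict_mono)
    then have "weight \<epsilon> < weight \<delta>" using i(1) by (simp add: \<delta> weight_add weight_single)
    then have T1: "mixed \<epsilon> (\<alpha>(i := Suc (\<alpha> i))) \<in> filt j"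
      by (rule less.hyps) (use less.prems i(1) in \<open>simp add: sum_upd del: fun_upd_apply\<close>)
    have "mixed \<delta> \<alpha> = uvar i ^ 2 * mixed \<epsilon> \<alpha>" using i(1) by (simp add: \<delta> mixed_xmon uvar_sq)
    also have "\<dots> = (if i = 0 then 0 else uvar (i - 1)) * uvar (Suc i) * mixed \<epsilon> \<alpha> + mixed \<epsilon> (\<alpha>(i := Suc (\<alpha> i)))"
      unfolding mixed_upd[OF i(1)] by (simp add: quadric_def algebra_simps)
    finally have eq: "mixed \<delta> \<alpha> = (if i = 0 then 0 else uvar (i - 1)) * uvar (Suc i) * mixed \<epsilon> \<alpha> + mixed \<epsilon> (\<alpha>(i := Suc (\<alpha> i)))" .
    show ?thesis
    proof (cases "i = 0 \<or> \<not> Suc i < l")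
      case True
      then show ?thesis using T1 eq by (auto simp: uvar_def)
    next
      case False
      define \<eta> where "\<eta> = Poly_Mapping.single (u (i - 1)) (1::nat) + Poly_Mapping.single (u (Suc i)) 1"
      have "i - 1 < l" using i(1) by linarith
      then have "weight (\<eta> + \<epsilon>) < weight \<delta>"
        using False weight_concave[of i] i(1) by (simp add: \<delta> \<eta>_def weight_add weight_single)
      then have T2: "mixed (\<eta> + \<epsilon>) \<alpha> \<in> filt j" by (rule less.hyps) (rule less.prems)
      have "uvar (i - 1) * uvar (Suc i) = xmon \<eta>" using False \<open>i - 1 < l\<close> by (simp add: \<eta>_def uvar_def varp_def xmon_add)
      then have "mixed \<delta> \<alpha> = mixed (\<eta> + \<epsilon>) \<alpha> + mixed \<epsilon> (\<alpha>(i := Suc (\<alpha> i)))"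
        using eq False by (simp add: mixed_xmon)
      then show ?thesis using filt_add[OF T1 T2] by simp
    qed
  qed
qed

lemma is_ideal_filt: "is_ideal (filt j)"
proof -
  have "h * f \<in> filt j" if "f \<in> filt j" for h f
  proof (induction h rule: poly_add_induct)
    case (single m c)
    have "xmon m * f \<in> filt j" using that
    proof (induction rule: filt.induct)
      case zero
      show ?case using filt.zero by simp
    next
      case (step f \<gamma> a)
      have "xmon m * basis \<gamma> \<in> filt j"
        unfolding basis_def mixed_xmon[symmetric] by (rule mixed_filt) (use step.hyps(2) in \<open>simp add: level_def\<close>)
      then have "xmon m * f + cst a * (xmon m * basis \<gamma>) \<in> filt j" using step.IH by (intro filt_add filt_cst)
      then show ?case by (simp add: distrib_left mult.left_commute)
    qed
    then have "cst c * (xmon m * f) \<in> filt j" by (rule filt_cst)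
    then show ?case by (simp add: single_split[of m c] mult.assoc)
  qed (simp add: distrib_right filt_add)
  then show ?thesis unfolding ring_module.subspace_def using filt.zero filt_add by blast
qed

lemma quadric_filt:
  assumes i: "i < l" and f: "f \<in> filt j"
  shows "quadric i * f \<in> filt (Suc j)"
  using f
proof (induction rule: filt.induct)
  case zero
  show ?case using filt.zero by simp
next
  case (step f \<gamma> a)
  have "quadric i * basis \<gamma> \<in> filt (Suc j)"
    unfolding basis_def mixed_upd[OF i, symmetric]
    by (rule mixed_filt) (use step.hyps(2) in \<open>simp add: level_def sum_upd[OF i] del: fun_upd_apply\<close>)
  then have "quadric i * f + cst a * (quadric i * basis \<gamma>) \<in> filt (Suc j)" using step.IH by (intro filt_add filt_cst)
  then show ?case by (simp add: distrib_left mult.left_commute)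
qed

lemma ideal_power_subset_filt: "ideal_power (ideal_span (quadric ` {..<l})) k \<subseteq> filt k"
proof (rule ideal_power_subset_filtration)
  have "1 \<in> filt 0" using mixed_filt[of 0 "\<lambda>i. 0" 0] by (simp add: mixed_def)
  then show "filt 0 = UNIV" using ideal_mult_left[OF is_ideal_filt, of 1 0] by auto
qed (auto simp: is_ideal_filt quadric_filt)

text \<open>The inductive definition may add the same index repeatedly; here its coefficients are
  merged.\<close>

lemma filt_sum:
  assumes "f \<in> filt j"
  shows "\<exists>\<Gamma> a. finite \<Gamma> \<and> (\<forall>\<gamma>\<in>\<Gamma>. level \<gamma> \<ge> j) \<and> f = (\<Sum>\<gamma>\<in>\<Gamma>. cst (a \<gamma>) * basis \<gamma>)"
  using assms
proof (induction rule: filt.induct)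
  case zero
  show ?case by (intro exI[of _ "{}"]) auto
next
  case (step f \<gamma> c)
  then obtain \<Gamma> a where \<Gamma>: "finite \<Gamma>" "\<forall>\<gamma>\<in>\<Gamma>. level \<gamma> \<ge> j" "f = (\<Sum>\<gamma>\<in>\<Gamma>. cst (a \<gamma>) * basis \<gamma>)" by blast
  define b where "b \<eta> = (if \<eta> \<in> \<Gamma> then a \<eta> else 0) + (if \<eta> = \<gamma> then c else 0)" for \<eta>
  have "(\<Sum>\<eta>\<in>insert \<gamma> \<Gamma>. cst (b \<eta>) * basis \<eta>) =
      (\<Sum>\<eta>\<in>insert \<gamma> \<Gamma>. cst (if \<eta> \<in> \<Gamma> then a \<eta> else 0) * basis \<eta>) + (\<Sum>\<eta>\<in>insert \<gamma> \<Gamma>. cst (if \<eta> = \<gamma> then c else 0) * basis \<eta>)"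
    by (simp add: b_def single_add distrib_right sum.distrib)
  also have "(\<Sum>\<eta>\<in>insert \<gamma> \<Gamma>. cst (if \<eta> \<in> \<Gamma> then a \<eta> else 0) * basis \<eta>) = f"
    unfolding \<Gamma>(3) by (rule sum.mono_neutral_cong_right) (use \<Gamma>(1) in auto)
  also have "(\<Sum>\<eta>\<in>insert \<gamma> \<Gamma>. cst (if \<eta> = \<gamma> then c else 0) * basis \<eta>) = (\<Sum>\<eta>\<in>{\<gamma>}. cst c * basis \<eta>)"
    by (rule sum.mono_neutral_cong_right) (use \<Gamma>(1) in auto)
  finally have "f + cst c * basis \<gamma> = (\<Sum>\<eta>\<in>insert \<gamma> \<Gamma>. cst (b \<eta>) * basis \<eta>)" by simp
  then show ?case using \<Gamma> step.hyps(2) by (intro exI[of _ "insert \<gamma> \<Gamma>"] exI[of _ b]) auto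
qed

text \<open>Compare coefficients at a monomial of maximal weight among \<open>\<gamma>\<close> and
  the indices with nonzero coefficient. Only the basis element with this very index contributes, so
  the two sides differ.\<close>

lemma basis_not_in_filt:
  assumes "level \<gamma> < j"
  shows "basis \<gamma> \<notin> filt j"
proof
  assume "basis \<gamma> \<in> filt j"
  from filt_sum[OF this]
  obtain \<Gamma> a where \<Gamma>: "finite \<Gamma>" "\<forall>\<eta>\<in>\<Gamma>. level \<eta> \<ge> j" "basis \<gamma> = (\<Sum>\<eta>\<in>\<Gamma>. cst (a \<eta>) * basis \<eta>)"
    by (elim exE conjE)
  have \<gamma>: "\<gamma> \<notin> \<Gamma>" using \<Gamma>(2) assms by auto
  define S where "S = insert \<gamma> {\<eta> \<in> \<Gamma>. a \<eta> \<noteq> 0}"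
  have S: "finite S" "S \<noteq> {}" using \<Gamma>(1) by (auto simp: S_def)
  have "Max (weight ` S) \<in> weight ` S" using S by (intro Max_in) auto
  then obtain \<eta> where \<eta>S: "\<eta> \<in> S" "weight \<eta> = Max (weight ` S)" by auto
  have \<eta>: "weight \<theta> \<le> weight \<eta>" if "\<theta> \<in> S" for \<theta> using that S(1) by (simp add: \<eta>S(2))
  have lk: "Poly_Mapping.lookup (basis \<theta>) \<eta> = (if \<eta> = \<theta> then 1 else 0)" if "\<theta> \<in> S" for \<theta>
    by (rule leads_lookup[OF leads_basis \<eta>[OF that]])
  have lk_cst: "Poly_Mapping.lookup (cst c * f) \<eta> = c * Poly_Mapping.lookup f \<eta>" for c and f :: "('n, 'k) xy_poly"
    using lookup_single_mult[of 0 c f \<eta>] by simp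
  have "Poly_Mapping.lookup (basis \<gamma>) \<eta> = (\<Sum>\<theta>\<in>\<Gamma>. a \<theta> * Poly_Mapping.lookup (basis \<theta>) \<eta>)"
    by (subst \<Gamma>(3)) (simp add: lookup_sum lk_cst)
  also have "\<dots> = (\<Sum>\<theta>\<in>\<Gamma>. if \<theta> = \<eta> then a \<theta> else 0)"
  proof (rule sum.cong)
    fix \<theta> assume "\<theta> \<in> \<Gamma>"
    then show "a \<theta> * Poly_Mapping.lookup (basis \<theta>) \<eta> = (if \<theta> = \<eta> then a \<theta> else 0)"
      using lk[of \<theta>] by (cases "a \<theta> = 0") (auto simp: S_def)
  qed simp
  also have "\<dots> = (if \<eta> \<in> \<Gamma> then a \<eta> else 0)" using \<Gamma>(1) by simp
  finally show False using lk[of \<gamma>] \<eta>S(1) \<gamma> by (auto simp: S_def split: if_splits)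
qed

text \<open>The product of the u_i is squarefree, so the whole element is itself a basis element, of
  level \<open>k\<close>.\<close>

lemma not_in_power:
  assumes l: "0 < l"
  shows "(\<Prod>i<l. uvar i) * quadric 0 ^ k \<notin> ideal_power (ideal_span (quadric ` {..<l})) (Suc k)"
proof -
  define \<delta> where "\<delta> = (\<Sum>i<l. Poly_Mapping.single (u i) (1::nat))"
  define \<alpha> where "\<alpha> i = (if i = 0 then k else 0)" for i :: nat
  have "(\<Prod>i<l. uvar i) = xmon \<delta>" by (simp add: \<delta>_def xmon_sum uvar_def varp_def)
  moreover have "(\<Prod>i<l. quadric i ^ \<alpha> i) = quadric 0 ^ k"
    using l by (simp add: prod.remove[of "{..<l}" 0] \<alpha>_def)
  ultimately have eq: "(\<Prod>i<l. uvar i) * quadric 0 ^ k = mixed \<delta> \<alpha>" by (simp add: mixed_def)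
  have expo: "expo i \<delta> < 2" if "i < l" for i
  proof -
    have "expo i \<delta> = (\<Sum>j<l. expo i (Poly_Mapping.single (u j) 1))" by (simp add: expo_def \<delta>_def lookup_sum)
    also have "\<dots> = (\<Sum>j<l. if i = j then 1 else 0)" by (rule sum.cong) (auto simp: expo_single that)
    finally show ?thesis using that by simp
  qed
  have "(\<Sum>i<l. \<alpha> i) = k" using l by (simp add: sum.remove[of "{..<l}" 0] \<alpha>_def)
  then have "mixed \<delta> \<alpha> \<notin> filt (Suc k)"
    using mixed_eq_basis[of \<delta> \<alpha>] expo basis_not_in_filt[of "\<delta> + squares \<alpha>" "Suc k"] by simp
  then show ?thesis using ideal_power_subset_filt[of "Suc k"] unfolding eq by blast
qed

end

section \<open>Binomial edge ideals\<close>

definition minor :: "'n \<Rightarrow> 'n \<Rightarrow> ('n, 'k::field) xy_poly" where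
  "minor u v = x_var u * y_var v - x_var v * y_var u"

lemma minor_swap: "minor v u = - minor u v"
  by (simp add: minor_def)

lemma minor_same [simp]: "minor u u = 0"
  by (simp add: minor_def)

lemma x_var_nonzero: "x_var u \<noteq> (0 :: ('n, 'k::field) xy_poly)"
  unfolding x_var_eq by (rule varp_nonzero)

lemma minor_graded: "minor u v \<in> graded_component 2" for u :: "'n::finite"
  unfolding minor_def x_var_eq y_var_eq
  by (intro graded_component_diff graded_component_mult[OF graded_component_varp graded_component_varp]) auto

text \<open>Expansion of the vanishing 3 by 3 determinant with rows x, x, y. Up to the factor x_w,
  it routes a minor through the vertex \<open>w\<close>.\<close>

lemma x_var_mult_minor: "x_var w * minor u v = x_var u * minor w v + x_var v * minor u w"
  by (simp add: minor_def algebra_simps)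

lemma minor_mem:
  fixes u :: "'n::linorder"
  assumes "simple_graph G" and "{u, v} \<in> G"
  shows "minor u v \<in> binomial_edge_ideal G"
proof -
  have "u \<noteq> v" using assms unfolding simple_graph_def by force
  have *: "minor i j \<in> binomial_edge_ideal G" if "i < j" "{i, j} \<in> G" for i j
    unfolding binomial_edge_ideal_def minor_def using that by (intro ring_module.span_base) blast
  show ?thesis
  proof (cases "u < v")
    case False
    then have "v < u" using \<open>u \<noteq> v\<close> by simp
    then have "- minor v u \<in> binomial_edge_ideal G"
      using *[of v u] assms(2) unfolding binomial_edge_ideal_def
      by (intro ring_module.span_neg) (auto simp: insert_commute)
    then show ?thesis by (simp add: minor_swap[of u v])
  qed (use * assms(2) in auto)
qed

lemma binomial_edge_ideal_eq: "binomial_edge_ideal G = ideal_span {minor i j | i j. i < j \<and> {i, j} \<in> G}"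
  by (simp add: binomial_edge_ideal_def minor_def)

lemma is_ideal_binomial_edge_ideal: "is_ideal (binomial_edge_ideal G)"
  unfolding binomial_edge_ideal_def by (rule ring_module.subspace_span)

lemma graded_binomial_edge_ideal: "graded_ideal (binomial_edge_ideal G)" for G :: "'n::{finite,linorder} set set"
  unfolding binomial_edge_ideal_eq by (rule graded_ideal_span) (use minor_graded in blast)

lemma binomial_edge_ideal_irrelevant: "binomial_edge_ideal G \<subseteq> irrelevant_ideal" for G :: "'n::{finite,linorder} set set"
  unfolding binomial_edge_ideal_eq
proof (rule ring_module.span_minimal)
  show "is_ideal irrelevant_ideal" unfolding irrelevant_ideal_def by (rule ring_module.subspace_span)
  show "{minor i j | i j. i < j \<and> {i, j} \<in> G} \<subseteq> irrelevant_ideal"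
    using graded_component_irrelevant[OF minor_graded] by auto
qed

lemma subst_binomial_edge_power:
  fixes G :: "'n::{finite,linorder} set set"
  assumes "\<And>i j. {i, j} \<in> G \<Longrightarrow> subst_poly g (minor i j) \<in> I" and "is_ideal I"
    and "f \<in> ideal_power (binomial_edge_ideal G) k"
  shows "subst_poly g f \<in> ideal_power I k"
proof -
  have "ideal_power (binomial_edge_ideal G) k \<subseteq> {f. subst_poly g f \<in> ideal_power I k}"
    unfolding binomial_edge_ideal_eq
  proof (rule ideal_power_subset_filtration)
    show "is_ideal {f. subst_poly g f \<in> ideal_power I j}" for j
      using is_ideal_ideal_power[of I j] by (auto simp: ring_module.subspace_def subst_poly_simps)
  qed (use assms(1) in \<open>auto simp: subst_poly_mult intro!: ideal_times_mem\<close>)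
  then show ?thesis using assms(3) by blast
qed

section \<open>The regularity is at least the length of an induced path\<close>

text \<open>With u_i the variable x of \<open>c i\<close> for i < l, the specialization sends y of
  \<open>c (Suc i)\<close> to u_i, and x of \<open>c l\<close> and y of \<open>c 0\<close> to 0. The
  minor of the i-th edge becomes u_i u_i - u_(i+1) u_(i-1).\<close>

lemma regularity_ge_path:
  fixes G :: "'n::{finite,linorder} set set" and c :: "nat \<Rightarrow> 'n"
  assumes G: "simple_graph G" and inj: "inj_on c {..l}" and l: "0 < l"
    and edge: "\<And>i. i < l \<Longrightarrow> {c i, c (Suc i)} \<in> G"
    and induced: "\<And>i j. i \<le> l \<Longrightarrow> j \<le> l \<Longrightarrow> {c i, c j} \<in> G \<Longrightarrow> j = Suc i \<or> i = Suc j"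
  shows "ereal (real (2 * k + l)) \<le> regularity (ideal_power (binomial_edge_ideal G :: ('n, 'k::field) xy_poly set) (Suc k))"
proof -
  define J :: "('n, 'k) xy_poly set" where "J = binomial_edge_ideal G"
  have J: "is_ideal J" "graded_ideal J" "J \<subseteq> irrelevant_ideal"
    unfolding J_def by (rule is_ideal_binomial_edge_ideal graded_binomial_edge_ideal binomial_edge_ideal_irrelevant)+
  interpret path_quadrics l "\<lambda>i. X (c i)" "TYPE('k)"
    by standard (use inj in \<open>auto simp: inj_on_def\<close>)
  define U where "U = (\<lambda>i. X (c i)) ` {..<l}"
  define \<rho> where "\<rho> v = (case v of X i \<Rightarrow> None
      | Y i \<Rightarrow> if i \<in> c ` {1..l} then Some (X (c (inv_into {..l} c i - 1))) else None)" for v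
  define \<sigma> where "\<sigma> = subst_poly (special U \<rho> :: 'n var \<Rightarrow> ('n, 'k) xy_poly)"
  have inv: "inv_into {..l} c (c i) = i" if "i \<le> l" for i using inj that by simp
  have c_eq: "c i = c j \<longleftrightarrow> i = j" if "i \<le> l" "j \<le> l" for i j
    using inj that by (auto simp: inj_on_def)
  have \<rho>: "u \<in> U" if "\<rho> v = Some u" for v u
  proof -
    have "v \<noteq> X i" for i using that by (auto simp: \<rho>_def)
    then obtain x where v: "v = Y x" by (cases v) auto
    have x: "x \<in> c ` {1..l}" "u = X (c (inv_into {..l} c x - 1))"
      using that unfolding v \<rho>_def by (simp_all split: if_splits)
    obtain i where "i \<in> {1..l}" "x = c i" using x(1) by blast
    then have "i \<in> {1..l}" "u = X (c (i - 1))" using x(2) inv[of i] by auto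
    then show ?thesis unfolding U_def by (intro image_eqI[of _ _ "i - 1"]) auto
  qed
  have \<sigma>x: "\<sigma> (x_var (c i)) = uvar i" if "i \<le> l" for i
    using that c_eq by (auto simp: \<sigma>_def x_var_eq special_def U_def uvar_def \<rho>_def)
  have \<sigma>y: "\<sigma> (y_var (c i)) = (if i = 0 then 0 else uvar (i - 1))" if "i \<le> l" for i
  proof -
    have "c i \<in> c ` {1..l} \<longleftrightarrow> i \<noteq> 0" using that c_eq by (auto simp: image_iff)
    then show ?thesis using that inv[OF that]
      by (auto simp: \<sigma>_def y_var_eq special_def U_def uvar_def \<rho>_def)
  qed
  have \<sigma>x': "\<sigma> (x_var v) = 0" and \<sigma>y': "\<sigma> (y_var v) = 0" if "v \<notin> c ` {..l}" for v
    using that by (auto simp: \<sigma>_def x_var_eq y_var_eq special_def U_def \<rho>_def)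
  have \<sigma>minor: "\<sigma> (minor u v) = \<sigma> (x_var u) * \<sigma> (y_var v) - \<sigma> (x_var v) * \<sigma> (y_var u)" for u v
    by (simp add: minor_def \<sigma>_def subst_poly_simps)
  have \<sigma>path: "\<sigma> (minor (c i) (c (Suc i))) = quadric i" if "i < l" for i
    using that by (simp add: \<sigma>minor \<sigma>x \<sigma>y quadric_def power2_eq_square mult.commute)
  have \<sigma>uvar: "\<sigma> (uvar i) = uvar i" for i
    by (auto simp: uvar_def \<sigma>_def special_def U_def)
  \<comment> \<open>An edge with an end off the path is killed; the path being induced, the
    remaining edges join consecutive vertices.\<close>
  have \<sigma>J: "\<sigma> (minor u v) \<in> ideal_span (quadric ` {..<l})" if uv: "{u, v} \<in> G" for u v
  proof (cases "u \<in> c ` {..l} \<and> v \<in> c ` {..l}")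
    case False
    then have "\<sigma> (minor u v) = 0" unfolding \<sigma>minor using \<sigma>x' \<sigma>y' by auto
    then show ?thesis by (simp add: ring_module.span_zero)
  next
    case True
    have *: "\<sigma> (minor (c i) (c (Suc i))) \<in> ideal_span (quadric ` {..<l})" if "i < l" for i
      unfolding \<sigma>path[OF that] using that by (intro ring_module.span_base) auto
    obtain i j where ij: "i \<le> l" "j \<le> l" "u = c i" "v = c j" using True by auto
    then consider "j = Suc i" | "i = Suc j" using induced uv by blast
    then show ?thesis
    proof cases
      case 1
      then show ?thesis using * ij by simp
    next
      case 2
      then have "\<sigma> (minor u v) = - \<sigma> (minor v u)" by (simp add: minor_swap[of u v] \<sigma>_def subst_poly_uminus)
      then show ?thesis using *[of j] 2 ij by (simp add: ring_module.span_neg)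
    qed
  qed
  \<comment> \<open>\<open>A\<close> is \<open>J\<close> plus the kernel of \<open>\<sigma>\<close>.
    Unlike the image of \<open>J\<close>, it is an ideal of R.\<close>
  define A where "A = {f. \<exists>b\<in>J. \<sigma> b = \<sigma> f}"
  have A: "is_ideal A"
    unfolding ring_module.subspace_def
  proof (intro conjI ballI allI)
    show "0 \<in> A" using ring_module.subspace_0[OF J(1)] unfolding A_def by blast
    fix f assume "f \<in> A"
    then obtain b where b: "b \<in> J" "\<sigma> b = \<sigma> f" unfolding A_def by blast
    have "\<sigma> (x * b) = \<sigma> (x * f)" for x using b(2) by (simp add: \<sigma>_def subst_poly_mult)
    then show "x * f \<in> A" for x using ideal_mult_left[OF J(1) b(1)] unfolding A_def by blast
    fix g assume "g \<in> A"
    then obtain b' where b': "b' \<in> J" "\<sigma> b' = \<sigma> g" unfolding A_def by blast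
    have "\<sigma> (b + b') = \<sigma> (f + g)" using b(2) b'(2) by (simp add: \<sigma>_def subst_poly_add)
    then show "f + g \<in> A" using ring_module.subspace_add[OF J(1) b(1) b'(1)] unfolding A_def by blast
  qed
  have qA: "quadric i \<in> A" if "i < l" for i
  proof -
    have "\<sigma> (quadric i) = \<sigma> (uvar i) ^ 2 - (if i = 0 then 0 else \<sigma> (uvar (i - 1))) * \<sigma> (uvar (Suc i))"
      by (simp add: quadric_def \<sigma>_def subst_poly_simps)
    then have "\<sigma> (quadric i) = quadric i" by (simp add: \<sigma>uvar quadric_def)
    then show ?thesis using \<sigma>path[OF that] minor_mem[OF G edge[OF that]] unfolding A_def J_def by auto
  qed
  \<comment> \<open>The square of u_0 lies in \<open>A\<close>, and modulo \<open>A\<close> the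
    square of u_(i+1) is a multiple of u_i, so nilpotency passes upwards.\<close>
  have nilA: "\<exists>M. uvar i ^ M \<in> A" if "i < l" for i
    using that
  proof (induction i)
    case 0
    then show ?case using qA[of 0] by (intro exI[of _ 2]) (simp add: quadric_def)
  next
    case (Suc i)
    then obtain M where M: "uvar i ^ M \<in> A" by auto
    let ?a = "uvar (Suc i) ^ 2" and ?b = "uvar i * uvar (Suc (Suc i))"
    have "?a - ?b dvd ?a ^ M - ?b ^ M" unfolding power_diff_sumr2[of ?a M ?b] by simp
    moreover have "?a - ?b \<in> A" using qA[OF Suc.prems] by (simp add: quadric_def)
    ultimately have "?a ^ M - ?b ^ M \<in> A" using ideal_mult_right[OF A] by (elim dvdE) simp
    moreover have "?b ^ M \<in> A" unfolding power_mult_distrib by (rule ideal_mult_right[OF A M])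
    ultimately have "?a ^ M - ?b ^ M + ?b ^ M \<in> A" by (rule ring_module.subspace_add[OF A])
    then show ?case by (auto simp: power_mult[symmetric])
  qed
  have nilJ: "\<exists>M. \<exists>b\<in>J. \<sigma> b = uvar i ^ M" if i: "i < l" for i
  proof -
    obtain M b where "b \<in> J" "\<sigma> b = \<sigma> (uvar i ^ M)"
      using nilA[OF i] unfolding A_def by blast
    moreover have "\<sigma> (uvar i ^ M) = \<sigma> (uvar i) ^ M" by (simp add: \<sigma>_def subst_poly_power)
    ultimately show ?thesis unfolding \<sigma>uvar by auto
  qed
  have wk: "ideal_power J (Suc k) \<subseteq> irrelevant_ideal"
    using ideal_power_subset[OF J(1), of "Suc k"] J(3) by simp
  \<comment> \<open>A preimage under \<open>\<sigma>\<close> of the element in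
    \<open>not_in_power\<close>.\<close>
  define w :: "('n, 'k) xy_poly" where "w = (\<Prod>i<l. x_var (c i)) * minor (c 0) (c 1) ^ k"
  have "(\<Prod>i<j. x_var (c i) :: ('n, 'k) xy_poly) \<in> graded_component (int j)" for j
  proof (induction j)
    case 0
    show ?case using graded_component_const[of 1] by simp
  next
    case (Suc j)
    then show ?case unfolding prod.lessThan_Suc x_var_eq
      by (rule graded_component_mult[OF _ graded_component_varp]) simp
  qed
  then have w: "w \<in> graded_component (int (2 * k + l))"
    unfolding w_def
    by (rule graded_component_mult[OF _ graded_component_power[OF minor_graded]]) simp
  have \<sigma>w: "\<sigma> w = (\<Prod>i<l. uvar i) * quadric 0 ^ k"
  proof -
    have "\<sigma> w = (\<Prod>i<l. \<sigma> (x_var (c i))) * \<sigma> (minor (c 0) (c 1)) ^ k"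
      by (simp add: w_def \<sigma>_def subst_poly_simps)
    then show ?thesis using \<sigma>path[OF l] by (simp add: \<sigma>x)
  qed
  have "ereal (real_of_int (int (2 * k + l))) \<le> regularity (ideal_power J (Suc k))"
  proof (rule regularity_ge_specialization[OF graded_ideal_power[OF J(2)] wk \<rho> _ w])
    fix u assume "u \<in> U"
    then obtain i where i: "i < l" "u = X (c i)" by (auto simp: U_def)
    obtain M b where b: "b \<in> J" "\<sigma> b = uvar i ^ M" using nilJ[OF i(1)] by blast
    have "\<sigma> (b ^ Suc k) = varp u ^ (M * Suc k)"
      using b(2) i by (simp only: \<sigma>_def subst_poly_power power_mult) (simp add: uvar_def)
    then show "\<exists>M. \<exists>b\<in>ideal_power J (Suc k). subst_poly (special U \<rho>) b = varp u ^ M"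
      using power_mem_ideal_power[OF b(1)] unfolding \<sigma>_def by blast
  next
    fix b assume "b \<in> ideal_power J (Suc k)"
    then have "\<sigma> b \<in> ideal_power (ideal_span (quadric ` {..<l})) (Suc k)"
      unfolding \<sigma>_def J_def by (intro subst_binomial_edge_power) (use \<sigma>J in \<open>auto simp: \<sigma>_def\<close>)
    then show "subst_poly (special U \<rho>) b \<noteq> subst_poly (special U \<rho>) w"
      using not_in_power[OF l, of k] \<sigma>w unfolding \<sigma>_def by metis
  qed
  then show ?thesis by (simp add: J_def)
qed

section \<open>The ideal of all minors\<close>

definition minors_ideal :: "('n, 'k::field) xy_poly set" where
  "minors_ideal = ideal_span {minor u v | u v. True}"

lemma minor_in_minors_ideal: "minor u v \<in> minors_ideal"
  unfolding minors_ideal_def by (rule ring_module.span_base) blast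

lemma is_ideal_minors_ideal: "is_ideal minors_ideal"
  unfolding minors_ideal_def by (rule ring_module.subspace_span)

text \<open>The second row of the matrix becomes a multiple of the first. The factor is the existing
  variable y_a, so that the parametrization is a substitution within R.\<close>

definition rank1 :: "'n \<Rightarrow> 'n var \<Rightarrow> ('n, 'k::field) xy_poly" where
  "rank1 a v = (case v of X i \<Rightarrow> x_var i | Y i \<Rightarrow> y_var a * x_var i)"

lemma rank1_simps [simp]: "rank1 a (X i) = x_var i" "rank1 a (Y i) = y_var a * x_var i"
  by (simp_all add: rank1_def)

definition rank1_monom :: "'n \<Rightarrow> ('n::finite var \<Rightarrow>\<^sub>0 nat) \<Rightarrow> 'n var \<Rightarrow>\<^sub>0 nat" where
  "rank1_monom a m = (\<Sum>i\<in>UNIV. Poly_Mapping.single (X i) (Poly_Mapping.lookup m (X i) + Poly_Mapping.lookup m (Y i)))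
    + Poly_Mapping.single (Y a) (\<Sum>i\<in>UNIV. Poly_Mapping.lookup m (Y i))"

lemma lookup_rank1_monom:
  "Poly_Mapping.lookup (rank1_monom a m) (X i) = Poly_Mapping.lookup m (X i) + Poly_Mapping.lookup m (Y i)"
  "Poly_Mapping.lookup (rank1_monom a m) (Y a) = (\<Sum>i\<in>UNIV. Poly_Mapping.lookup m (Y i))"
  by (simp_all add: rank1_monom_def lookup_add lookup_sum lookup_single when_def)

lemma rank1_monom_add: "rank1_monom a (m + m') = rank1_monom a m + rank1_monom a m'"
  by (simp add: rank1_monom_def lookup_add sum.distrib single_add add.assoc add.left_commute)

lemma prod_var: "(\<Prod>v\<in>UNIV. h v) = (\<Prod>i\<in>UNIV. h (X i)) * (\<Prod>i\<in>UNIV. h (Y i))"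
  for h :: "'n::finite var \<Rightarrow> 'b::comm_monoid_mult"
proof -
  have "(\<Prod>v\<in>UNIV. h v) = (\<Prod>v\<in>range X. h v) * (\<Prod>v\<in>range Y. h v)"
    unfolding UNIV_var by (rule prod.union_disjoint) auto
  then show ?thesis by (simp add: prod.reindex inj_def)
qed

lemma monom_eval_rank1: "monom_eval (rank1 a) m = xmon (rank1_monom a m)"
proof -
  have "monom_eval (rank1 a) m =
      (\<Prod>i\<in>UNIV. x_var i ^ (Poly_Mapping.lookup m (X i) + Poly_Mapping.lookup m (Y i)))
      * y_var a ^ (\<Sum>i\<in>UNIV. Poly_Mapping.lookup m (Y i))"
    by (simp add: monom_eval_def prod_var power_mult_distrib prod.distrib power_add power_sum ac_simps)
  also have "\<dots> = xmon (rank1_monom a m)"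
    by (simp add: rank1_monom_def xmon_add xmon_sum x_var_eq y_var_eq varp_power)
  finally show ?thesis .
qed

lemma xmon_single_mult: "xmon (Poly_Mapping.single v 1 + m) = varp v * xmon m"
  by (simp add: xmon_add varp_def)

lemma monom_split:
  assumes "0 < Poly_Mapping.lookup m v"
  shows "m = Poly_Mapping.single v 1 + (m - Poly_Mapping.single v (1::nat))"
  by (rule poly_mapping_eqI) (use assms in \<open>auto simp: lookup_add lookup_minus lookup_single when_def\<close>)

text \<open>Induction on the degree in the y-variables: a common factor y_i is cancelled, and if
  there is none it is created by an exchange.\<close>

lemma rank1_monom_eq_imp:
  fixes m m' :: "'n::{finite,linorder} var \<Rightarrow>\<^sub>0 nat"
  assumes "rank1_monom a m = rank1_monom a m'"
  shows "xmon m - xmon m' \<in> (minors_ideal :: ('n, 'k::field) xy_poly set)"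
  using assms
proof (induction "\<Sum>i\<in>UNIV. Poly_Mapping.lookup m (Y i)" arbitrary: m m')
  case 0
  have "Poly_Mapping.lookup m (X i) + Poly_Mapping.lookup m (Y i) = Poly_Mapping.lookup m' (X i) + Poly_Mapping.lookup m' (Y i)"
    and "(\<Sum>i\<in>UNIV. Poly_Mapping.lookup m (Y i)) = (\<Sum>i\<in>UNIV. Poly_Mapping.lookup m' (Y i))" for i
    using lookup_rank1_monom[of a m] lookup_rank1_monom[of a m'] 0(2) by metis+
  then have "Poly_Mapping.lookup m v = Poly_Mapping.lookup m' v" for v
    using 0(1) by (cases v) (auto simp: sum_eq_0_iff)
  then have "m = m'" by (intro poly_mapping_eqI)
  then show ?case using ring_module.subspace_0[OF is_ideal_minors_ideal] by simp
next
  case (Suc n)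
  have IH: "xmon m - xmon \<mu> \<in> (minors_ideal :: ('n, 'k) xy_poly set)"
    if "rank1_monom a m = rank1_monom a \<mu>" "0 < Poly_Mapping.lookup m (Y i)" "0 < Poly_Mapping.lookup \<mu> (Y i)" for i \<mu>
  proof -
    define r where "r = m - Poly_Mapping.single (Y i) 1"
    define r' where "r' = \<mu> - Poly_Mapping.single (Y i) 1"
    have m: "m = Poly_Mapping.single (Y i) 1 + r" and \<mu>: "\<mu> = Poly_Mapping.single (Y i) 1 + r'"
      using monom_split that(2,3) unfolding r_def r'_def by auto
    have "(\<Sum>j\<in>UNIV. Poly_Mapping.lookup m (Y j)) = Suc (\<Sum>j\<in>UNIV. Poly_Mapping.lookup r (Y j))"
      unfolding m by (simp add: lookup_add lookup_single when_def sum.distrib)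
    then have n: "n = (\<Sum>j\<in>UNIV. Poly_Mapping.lookup r (Y j))" using Suc.hyps(2) by simp
    have "rank1_monom a r = rank1_monom a r'" using that(1) by (simp add: m \<mu> rank1_monom_add)
    from Suc.hyps(1)[OF n this] have "varp (Y i) * (xmon r - xmon r') \<in> (minors_ideal :: ('n, 'k) xy_poly set)"
      by (rule ideal_mult_left[OF is_ideal_minors_ideal])
    then show ?thesis unfolding m \<mu> by (simp only: xmon_single_mult right_diff_distrib)
  qed
  have X: "Poly_Mapping.lookup m (X i) + Poly_Mapping.lookup m (Y i) = Poly_Mapping.lookup m' (X i) + Poly_Mapping.lookup m' (Y i)"
    and Y: "(\<Sum>i\<in>UNIV. Poly_Mapping.lookup m (Y i)) = (\<Sum>i\<in>UNIV. Poly_Mapping.lookup m' (Y i))" for i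
    using lookup_rank1_monom[of a m] lookup_rank1_monom[of a m'] Suc.prems by metis+
  have "\<exists>i. Poly_Mapping.lookup m (Y i) \<noteq> 0"
    using Suc.hyps(2) by (metis nat.distinct(1) sum.neutral)
  then obtain i where i: "0 < Poly_Mapping.lookup m (Y i)" by auto
  show ?case
  proof (cases "0 < Poly_Mapping.lookup m' (Y i)")
    case True
    then show ?thesis using IH[OF Suc.prems i] by blast
  next
    case False
    have "\<exists>j. Poly_Mapping.lookup m' (Y j) \<noteq> 0"
      using Suc.hyps(2) Y by (metis nat.distinct(1) sum.neutral)
    then obtain j where j: "0 < Poly_Mapping.lookup m' (Y j)" by auto
    \<comment> \<open>Column \<open>i\<close> has the same degree in both monomials, so
      \<open>m'\<close> contains x_i. Trading x_i y_j for x_j y_i changes \<open>m'\<close> by a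
      multiple of a minor, keeps its image and brings in y_i.\<close>
    have xi: "0 < Poly_Mapping.lookup m' (X i)" using X[of i] i False by simp
    define r where "r = m' - Poly_Mapping.single (X i) 1 - Poly_Mapping.single (Y j) 1"
    have m': "m' = Poly_Mapping.single (X i) 1 + (Poly_Mapping.single (Y j) 1 + r)"
      by (rule poly_mapping_eqI)
        (use xi j in \<open>auto simp: r_def lookup_add lookup_minus lookup_single when_def\<close>)
    define \<mu> where "\<mu> = Poly_Mapping.single (Y i) 1 + (Poly_Mapping.single (X j) 1 + r)"
    have "rank1_monom a (Poly_Mapping.single (X i) 1) + rank1_monom a (Poly_Mapping.single (Y j) 1)
        = rank1_monom a (Poly_Mapping.single (Y i) 1) + rank1_monom a (Poly_Mapping.single (X j) 1)"
      by (simp add: rank1_monom_def lookup_single when_def single_zero if_distrib[of "Poly_Mapping.single _"]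
          sum.If_cases add.commute add.left_commute cong: if_cong)
    then have "rank1_monom a m' = rank1_monom a \<mu>"
      unfolding m' \<mu>_def rank1_monom_add by (simp add: add.assoc[symmetric])
    then have "xmon m - xmon \<mu> \<in> (minors_ideal :: ('n, 'k) xy_poly set)"
      using IH[of \<mu> i] Suc.prems i by (simp add: \<mu>_def lookup_add lookup_single)
    moreover have "xmon r * minor j i \<in> (minors_ideal :: ('n, 'k) xy_poly set)"
      by (rule ideal_mult_left[OF is_ideal_minors_ideal minor_in_minors_ideal])
    ultimately have "xmon m - xmon \<mu> + xmon r * minor j i \<in> (minors_ideal :: ('n, 'k) xy_poly set)"
      by (rule ring_module.subspace_add[OF is_ideal_minors_ideal])
    also have "xmon m - xmon \<mu> + xmon r * minor j i = (xmon m - xmon m' :: ('n, 'k) xy_poly)"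
      unfolding m' \<mu>_def xmon_single_mult minor_def x_var_eq y_var_eq by (simp add: algebra_simps)
    finally show ?thesis .
  qed
qed

lemma kernel_rank1:
  "{f. subst_poly (rank1 a) f = 0} = (minors_ideal :: ('n::{finite,linorder}, 'k::field) xy_poly set)"
proof
  have "subst_poly (rank1 a) (minor u v) = (0 :: ('n, 'k) xy_poly)" for u v
    by (simp add: minor_def x_var_eq y_var_eq subst_poly_simps ac_simps)
  then show "minors_ideal \<subseteq> {f. subst_poly (rank1 a) f = (0 :: ('n, 'k) xy_poly)}"
    unfolding minors_ideal_def by (intro ring_module.span_minimal) (auto simp: is_ideal_subst_kernel)
  \<comment> \<open>\<open>s\<close> picks one monomial over each image and \<open>\<Psi>\<close>
    extends it linearly. Every f agrees with \<open>\<Psi>\<close> of its image modulo the minors,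
    by linearity from monomials, so image 0 forces membership.\<close>
  define s where "s \<mu> = (SOME m. rank1_monom a m = \<mu>)" for \<mu>
  have s: "rank1_monom a (s (rank1_monom a m)) = rank1_monom a m" for m
    unfolding s_def by (rule someI) simp
  define \<Psi> where "\<Psi> f = (\<Sum>\<mu>\<in>Poly_Mapping.keys f. Poly_Mapping.single (s \<mu>) (Poly_Mapping.lookup f \<mu>))" for f :: "('n, 'k) xy_poly"
  have \<Psi>: "\<Psi> f = (\<Sum>\<mu>\<in>A. Poly_Mapping.single (s \<mu>) (Poly_Mapping.lookup f \<mu>))"
    if "finite A" "Poly_Mapping.keys f \<subseteq> A" for f A
    unfolding \<Psi>_def by (rule sum.mono_neutral_left) (use that in \<open>auto simp: in_keys_iff\<close>)
  have \<Psi>_add: "\<Psi> (f + g) = \<Psi> f + \<Psi> g" for f g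
  proof -
    let ?A = "Poly_Mapping.keys f \<union> Poly_Mapping.keys g"
    have "Poly_Mapping.keys (f + g) \<subseteq> ?A" by (rule keys_add)
    then show ?thesis by (simp add: \<Psi>[of ?A] lookup_add single_add sum.distrib)
  qed
  have "f - \<Psi> (subst_poly (rank1 a) f) \<in> minors_ideal" for f :: "('n, 'k) xy_poly"
  proof (induction f rule: poly_add_induct)
    case (single m c)
    have "\<Psi> (subst_poly (rank1 a) (Poly_Mapping.single m c)) = Poly_Mapping.single (s (rank1_monom a m)) c"
      by (simp add: subst_poly_single monom_eval_rank1 mult_single \<Psi>_def)
    moreover have "cst c * (xmon m - xmon (s (rank1_monom a m))) \<in> (minors_ideal :: ('n, 'k) xy_poly set)"
      using s by (intro ideal_mult_left[OF is_ideal_minors_ideal] rank1_monom_eq_imp[where a = a]) auto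
    ultimately show ?case
      by (simp add: right_diff_distrib mult_single)
  next
    case (add f g)
    have eq: "f + g - \<Psi> (subst_poly (rank1 a) (f + g))
        = (f - \<Psi> (subst_poly (rank1 a) f)) + (g - \<Psi> (subst_poly (rank1 a) g))"
      by (simp add: subst_poly_add \<Psi>_add)
    show ?case unfolding eq by (rule ring_module.subspace_add[OF is_ideal_minors_ideal add])
  qed
  moreover have "\<Psi> 0 = 0" by (simp add: \<Psi>_def)
  ultimately show "{f. subst_poly (rank1 a) f = (0 :: ('n, 'k) xy_poly)} \<subseteq> minors_ideal"
    by (metis (mono_tags, lifting) diff_zero mem_Collect_eq subsetI)
qed

text \<open>Perturbing the generic rank one matrix by \<open>t = y\<^sub>b\<close> in one entry of column \<open>b\<close> sends every
  minor to a multiple of \<open>t\<close>, and \<open>f\<^sub>a\<^sub>b\<close> to a multiple of \<open>t\<close> that is not divisible by \<open>t\<^sup>2\<close>. So \<open>t\<close>-adic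
  orders decide membership in the powers.\<close>

definition perturbed :: "'n \<Rightarrow> 'n \<Rightarrow> 'n var \<Rightarrow> ('n, 'k::field) xy_poly" where
  "perturbed a b v = rank1 a v + (if v = Y b then y_var b else 0)"

lemma colon_power_eq:
  fixes G :: "'n::{finite,linorder} set set"
  assumes G: "simple_graph G" and ab: "{a, b} \<in> G"
    and C: "\<And>u v. (\<Prod>i\<in>C. x_var i) * minor u v \<in> (binomial_edge_ideal G :: ('n, 'k::field) xy_poly set)"
  shows "ideal_colon (ideal_power (binomial_edge_ideal G) (Suc k)) (minor a b ^ k * (\<Prod>i\<in>C. x_var i))
      = (minors_ideal :: ('n, 'k) xy_poly set)"
proof
  define J where "J = (binomial_edge_ideal G :: ('n, 'k) xy_poly set)"
  define F where "F = (\<Prod>i\<in>C. x_var i :: ('n, 'k) xy_poly)"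
  have "a \<noteq> b" using G ab unfolding simple_graph_def by force
  have J: "is_ideal J" unfolding J_def by (rule is_ideal_binomial_edge_ideal)
  show "minors_ideal \<subseteq> ideal_colon (ideal_power (binomial_edge_ideal G) (Suc k)) (minor a b ^ k * (\<Prod>i\<in>C. x_var i :: ('n, 'k) xy_poly))"
    unfolding minors_ideal_def F_def[symmetric] J_def[symmetric]
  proof (rule ring_module.span_minimal)
    show "is_ideal (ideal_colon (ideal_power J (Suc k)) (minor a b ^ k * F))"
      by (rule ideal_colon_is_ideal) (rule is_ideal_ideal_power)
    have "minor u v * (minor a b ^ k * F) \<in> ideal_power J (Suc k)" for u v
    proof -
      have "F * minor u v \<in> J" using C by (simp add: J_def F_def)
      then have "F * minor u v \<in> ideal_power J (Suc 0)" by (simp only: ideal_power_1[OF J])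
      from power_mult_mem_ideal_power[OF _ this, of "minor a b" k]
      have "minor a b ^ k * (F * minor u v) \<in> ideal_power J (Suc k)"
        using minor_mem[OF G ab] by (simp add: J_def)
      then show ?thesis by (simp only: ac_simps)
    qed
    then show "{minor u v | u v. True} \<subseteq> ideal_colon (ideal_power J (Suc k)) (minor a b ^ k * F)"
      by (auto simp: ideal_colon_def)
  qed
  show "ideal_colon (ideal_power (binomial_edge_ideal G) (Suc k)) (minor a b ^ k * (\<Prod>i\<in>C. x_var i)) \<subseteq> (minors_ideal :: ('n, 'k) xy_poly set)"
    unfolding F_def[symmetric] J_def[symmetric]
  proof
    fix h assume "h \<in> ideal_colon (ideal_power J (Suc k)) (minor a b ^ k * F)"
    then have h: "h * (minor a b ^ k * F) \<in> ideal_power J (Suc k)" by (simp add: ideal_colon_def)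
    define \<phi> where "\<phi> = subst_poly (perturbed a b :: 'n var \<Rightarrow> ('n, 'k) xy_poly)"
    define t where "t = (y_var b :: ('n, 'k) xy_poly)"
    have \<phi>x: "\<phi> (x_var i) = x_var i" and \<phi>y: "\<phi> (y_var i) = y_var a * x_var i + (if i = b then t else 0)" for i
      by (simp_all add: \<phi>_def x_var_eq[where i = i] y_var_eq[where i = i] perturbed_def t_def)
    have \<phi>minor: "\<phi> (minor u v) = \<phi> (x_var u) * \<phi> (y_var v) - \<phi> (x_var v) * \<phi> (y_var u)" for u v
      by (simp add: minor_def \<phi>_def subst_poly_simps)
    have "\<phi> (minor u v) = t * ((if v = b then x_var u else 0) - (if u = b then x_var v else 0))" for u v
      unfolding \<phi>minor \<phi>x \<phi>y by (simp add: algebra_simps)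
    then have minors: "t dvd \<phi> (minor u v)" for u v by simp
    have \<phi>ab: "\<phi> (minor a b) = x_var a * t"
      unfolding \<phi>minor \<phi>x \<phi>y using \<open>a \<noteq> b\<close> by (simp add: algebra_simps)
    \<comment> \<open>The power of \<open>J\<close> has \<open>t\<close>-order at least
      \<open>k + 1\<close>, but \<open>minor a b ^ k\<close> contributes exactly \<open>k\<close>.
      One factor \<open>t\<close> therefore divides the image of \<open>h\<close> times a product of
      x-variables.\<close>
    have "ideal_power J (Suc k) \<subseteq> {f. t ^ Suc k dvd \<phi> f}"
      unfolding J_def binomial_edge_ideal_eq
    proof (rule ideal_power_subset_filtration)
      show "is_ideal {f. t ^ j dvd \<phi> f}" for j
        by (auto simp: ring_module.subspace_def \<phi>_def subst_poly_simps)
      show "m * f \<in> {f. t ^ Suc j dvd \<phi> f}"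
        if "m \<in> {minor i j | i j. i < j \<and> {i, j} \<in> G}" "f \<in> {f. t ^ j dvd \<phi> f}" for m f j
        using that minors by (auto simp: \<phi>_def subst_poly_mult mult_dvd_mono)
    qed simp
    then have "t ^ Suc k dvd \<phi> (h * (minor a b ^ k * F))" using h by blast
    moreover have "\<phi> (h * (minor a b ^ k * F)) = t ^ k * (\<phi> h * x_var a ^ k * F)"
    proof -
      have "\<phi> F = F" unfolding F_def using \<phi>x by (simp add: \<phi>_def subst_poly_prod)
      moreover have "\<phi> (h * (minor a b ^ k * F)) = \<phi> h * (\<phi> (minor a b) ^ k * \<phi> F)"
        by (simp add: \<phi>_def subst_poly_simps)
      ultimately show ?thesis unfolding \<phi>ab by (simp add: power_mult_distrib ac_simps)
    qed
    moreover have "t \<noteq> 0" unfolding t_def y_var_eq by (rule varp_nonzero)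
    ultimately have "t dvd \<phi> h * x_var a ^ k * F" by (simp add: mult.commute[of t])
    then obtain r where r: "\<phi> h * x_var a ^ k * F = t * r" by (elim dvdE)
    \<comment> \<open>\<open>\<tau>\<close> sets \<open>t\<close> to 0. As
      \<open>a \<noteq> b\<close>, the parameter y_a survives and the perturbed matrix turns back
      into \<open>rank1 a\<close>.\<close>
    define \<tau> where "\<tau> = subst_poly (\<lambda>v. if v = Y b then 0 else varp v :: ('n, 'k) xy_poly)"
    have \<tau>x: "\<tau> (x_var i) = x_var i" for i by (simp add: \<tau>_def x_var_eq)
    have "\<tau> (\<phi> h * x_var a ^ k * F) = \<tau> (\<phi> h) * \<tau> (x_var a) ^ k * \<tau> F"
      by (simp add: \<tau>_def subst_poly_simps)
    moreover have "\<tau> F = F" unfolding F_def using \<tau>x by (simp add: \<tau>_def subst_poly_prod)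
    moreover have "\<tau> (t * r) = 0" by (simp add: \<tau>_def t_def y_var_eq subst_poly_mult)
    ultimately have "\<tau> (\<phi> h) * x_var a ^ k * F = 0" using r \<tau>x by metis
    moreover have "F \<noteq> 0" by (cases "finite C") (simp_all add: F_def x_var_nonzero)
    ultimately have "\<tau> (\<phi> h) = 0" by (simp add: x_var_nonzero)
    moreover have "\<tau> (\<phi> h) = subst_poly (rank1 a) h"
      unfolding \<tau>_def \<phi>_def subst_poly_subst_poly
    proof (rule arg_cong[of _ _ "\<lambda>g. subst_poly g h"], rule ext)
      fix v
      show "subst_poly (\<lambda>v. if v = Y b then 0 else varp v) (perturbed a b v) = (rank1 a v :: ('n, 'k) xy_poly)"
        using \<open>a \<noteq> b\<close> by (cases v) (auto simp: perturbed_def x_var_eq y_var_eq subst_poly_simps)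
    qed
    ultimately have "subst_poly (rank1 a) h = 0" by simp
    then show "h \<in> minors_ideal" using kernel_rank1[of a] by blast
  qed
qed

section \<open>Upper bound for the v-number\<close>

lemma v_number_le:
  fixes I :: "('n, 'k::field) xy_poly set"
  assumes "f \<in> graded_component (int d)" and "is_prime_ideal (ideal_colon I f)"
  shows "v_number I \<le> d"
proof -
  have "ideal_colon I f \<in> associated_primes I" using assms(2) unfolding associated_primes_def by blast
  then show ?thesis unfolding v_number_def by (intro Least_le) (use assms(1) in blast)
qed

lemma v_number_binomial_edge_power_le:
  fixes G :: "'n::{finite,linorder} set set"
  assumes "simple_graph G" and "{a, b} \<in> G"
    and "\<And>u v. (\<Prod>i\<in>C. x_var i) * minor u v \<in> (binomial_edge_ideal G :: ('n, 'k::field) xy_poly set)"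
  shows "v_number (ideal_power (binomial_edge_ideal G :: ('n, 'k) xy_poly set) (Suc k)) \<le> 2 * k + card C"
proof (rule v_number_le)
  have "(\<Prod>i\<in>C. x_var i :: ('n, 'k) xy_poly) \<in> graded_component (int (card C))" if "finite C" for C
    using that
  proof (induction C rule: finite_induct)
    case empty
    show ?case using graded_component_const[of 1] by simp
  next
    case (insert i C)
    have "x_var i * (\<Prod>i\<in>C. x_var i :: ('n, 'k) xy_poly) \<in> graded_component (int (card (insert i C)))"
      unfolding x_var_eq[of i]
      by (rule graded_component_mult[OF graded_component_varp insert.IH]) (use insert.hyps in simp)
    then show ?case using insert.hyps by simp
  qed
  from this[of C] show "minor a b ^ k * (\<Prod>i\<in>C. x_var i :: ('n, 'k) xy_poly) \<in> graded_component (int (2 * k + card C))"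
    by (intro graded_component_mult[OF graded_component_power[OF minor_graded]]) auto
  show "is_prime_ideal (ideal_colon (ideal_power (binomial_edge_ideal G) (Suc k)) (minor a b ^ k * (\<Prod>i\<in>C. x_var i :: ('n, 'k) xy_poly)))"
    unfolding colon_power_eq[OF assms] kernel_rank1[of a, symmetric] by (rule prime_kernel_subst_poly)
qed

section \<open>Dominating paths\<close>

text \<open>One application of \<open>x_var_mult_minor\<close> at \<open>c j\<close>; the factors
  missing in \<open>S\<close> and \<open>S'\<close> are filled up to \<open>T - {j}\<close>.\<close>

lemma minor_mem_through:
  fixes c :: "nat \<Rightarrow> 'n::{finite,linorder}"
  assumes J: "is_ideal (J :: ('n, 'k::field) xy_poly set)"
    and "finite T" "j \<in> T"
    and "(\<Prod>i\<in>S. x_var (c i)) * minor u (c j) \<in> J" "S \<subseteq> T - {j}"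
    and "(\<Prod>i\<in>S'. x_var (c i)) * minor (c j) v \<in> J" "S' \<subseteq> T - {j}"
  shows "(\<Prod>i\<in>T. x_var (c i)) * minor u v \<in> J"
proof -
  have up: "(\<Prod>i\<in>T - {j}. x_var (c i)) * f \<in> J" if "(\<Prod>i\<in>R. x_var (c i)) * f \<in> J" "R \<subseteq> T - {j}" for R f
    using ideal_mult_left[OF J that(1), of "\<Prod>i\<in>T - {j} - R. x_var (c i)"] assms(2)
    by (simp add: mult.assoc[symmetric] prod.subset_diff[OF that(2)])
  have "(\<Prod>i\<in>T. x_var (c i)) * minor u v = (\<Prod>i\<in>T - {j}. x_var (c i)) * (x_var (c j) * minor u v)"
    using assms(2,3) by (simp add: prod.remove[of T j] ac_simps)
  also have "\<dots> = x_var u * ((\<Prod>i\<in>T - {j}. x_var (c i)) * minor (c j) v) + x_var v * ((\<Prod>i\<in>T - {j}. x_var (c i)) * minor u (c j))"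
    unfolding x_var_mult_minor[of "c j" u v] by (simp add: algebra_simps)
  also have "\<dots> \<in> J"
    by (intro ring_module.subspace_add[OF J] ideal_mult_left[OF J] up[OF assms(4,5)] up[OF assms(6,7)])
  finally show ?thesis .
qed

text \<open>Route the minor from \<open>u\<close> to a neighbouring inner vertex, along the path and
  on to \<open>v\<close>. Each inner vertex is used at most once, so the squarefree product
  suffices.\<close>

lemma dominating_path_completes:
  fixes G :: "'n::{finite,linorder} set set"
  assumes G: "simple_graph G"
    and edge: "\<And>i. 1 \<le> i \<Longrightarrow> Suc i < l \<Longrightarrow> {c i, c (Suc i)} \<in> G"
    and dom: "\<And>u. \<exists>s. 1 \<le> s \<and> s < l \<and> (u = c s \<or> {u, c s} \<in> G)"
  shows "(\<Prod>i\<in>{1..<l}. x_var (c i)) * minor u v \<in> (binomial_edge_ideal G :: ('n, 'k::field) xy_poly set)"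
proof -
  define J where "J = (binomial_edge_ideal G :: ('n, 'k) xy_poly set)"
  have J: "is_ideal J" unfolding J_def by (rule is_ideal_binomial_edge_ideal)
  have near: "(\<Prod>i\<in>{}. x_var (c i)) * minor u v \<in> J" if "u = v \<or> {u, v} \<in> G" for u v
    using that minor_mem[OF G, of u v] ring_module.subspace_0[OF J] by (auto simp: J_def)
  have path: "(\<Prod>i\<in>{s<..<t}. x_var (c i)) * minor (c s) (c t) \<in> J" if "1 \<le> s" "s \<le> t" "t < l" for s t
    using that(2,3)
  proof (induction t rule: dec_induct)
    case base
    show ?case using ring_module.subspace_0[OF J] by simp
  next
    case (step t)
    show ?case
    proof (cases "t = s")
      case True
      have "{s<..<Suc s} = {}" by auto
      then show ?thesis using near[of "c s" "c (Suc s)"] edge[of s] step.prems that(1) True by simp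
    next
      case False
      show ?thesis
        by (rule minor_mem_through[OF J, where j = t and S = "{s<..<t}" and S' = "{}"])
          (use step False that(1) near[of "c t" "c (Suc t)"] edge[of t] in auto)
    qed
  qed
  have le: "(\<Prod>i\<in>{1..<l}. x_var (c i)) * minor u v \<in> J"
    if s: "1 \<le> s" "u = c s \<or> {u, c s} \<in> G" and t: "t < l" "v = c t \<or> {v, c t} \<in> G" and st: "s \<le> t" for u v s t
  proof (cases "s = t")
    case True
    show ?thesis
      by (rule minor_mem_through[OF J, where j = t and S = "{}" and S' = "{}"])
        (use that True near[of u "c t"] near[of "c t" v] in \<open>auto simp: insert_commute\<close>)
  next
    case False
    have "(\<Prod>i\<in>{s..<t}. x_var (c i)) * minor u (c t) \<in> J"
      by (rule minor_mem_through[OF J, where j = s and S = "{}" and S' = "{s<..<t}"])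
        (use that False near[of u "c s"] path[of s t] in auto)
    then show ?thesis
      by (rule minor_mem_through[OF J, where j = t and S' = "{}", rotated 2])
        (use that False near[of "c t" v] in \<open>auto simp: insert_commute\<close>)
  qed
  obtain s where s: "1 \<le> s" "s < l" "u = c s \<or> {u, c s} \<in> G" using dom by blast
  obtain t where t: "1 \<le> t" "t < l" "v = c t \<or> {v, c t} \<in> G" using dom by blast
  show ?thesis
  proof (cases "s \<le> t")
    case True
    then show ?thesis using le s t unfolding J_def by blast
  next
    case False
    then have "(\<Prod>i\<in>{1..<l}. x_var (c i)) * minor v u \<in> J" using le[of t v s u] s t by simp
    from ring_module.subspace_neg[OF J this] show ?thesis by (simp add: minor_swap[of v u] J_def)
  qed
qed

section \<open>Closed graphs\<close>

locale closed_labelling =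
  fixes G :: "'n::{finite,linorder} set set" and label :: "'n \<Rightarrow> nat" and N :: nat
  assumes G: "simple_graph G" and conn: "connected_graph G"
    and bij: "bij_betw label UNIV {1..N}"
    and closed: "\<And>i j k l. {i, j} \<in> G \<Longrightarrow> {k, l} \<in> G \<Longrightarrow> label i < label j \<Longrightarrow> label k < label l \<Longrightarrow>
        (i = k \<and> j \<noteq> l \<longrightarrow> {j, l} \<in> G) \<and> (j = l \<and> i \<noteq> k \<longrightarrow> {i, k} \<in> G)"
begin

definition inc :: "('n \<times> 'n) set" where
  "inc = {(u, v). {u, v} \<in> G \<and> label u < label v}"

lemma label_eq: "label u = label v \<longleftrightarrow> u = v"
  using bij by (auto simp: bij_betw_def inj_def)

lemma inc_cases: "{u, v} \<in> G \<Longrightarrow> (u, v) \<in> inc \<or> (v, u) \<in> inc"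
proof -
  assume uv: "{u, v} \<in> G"
  then have "u \<noteq> v" using G unfolding simple_graph_def by force
  then show ?thesis using uv label_eq[of u v] by (auto simp: inc_def insert_commute)
qed

lemma inc_upper: "(u, w) \<in> inc \<Longrightarrow> (v, w) \<in> inc \<Longrightarrow> u = v \<or> (u, v) \<in> inc \<or> (v, u) \<in> inc"
  using closed[of u w v w] inc_cases[of u v] by (auto simp: inc_def)

lemma inc_lower: "(w, u) \<in> inc \<Longrightarrow> (w, v) \<in> inc \<Longrightarrow> u = v \<or> (u, v) \<in> inc \<or> (v, u) \<in> inc"
  using closed[of w u w v] inc_cases[of u v] by (auto simp: inc_def)

text \<open>Cuts off a peak: the last edge of the walk and the edge from \<open>v\<close> share
  their upper end, so their lower ends are equal or adjacent and the walk gets shorter.\<close>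

lemma inc_path_upper:
  "(u, w) \<in> inc\<^sup>* \<Longrightarrow> (v, w) \<in> inc \<Longrightarrow> (u, v) \<in> inc\<^sup>* \<or> (v, u) \<in> inc\<^sup>*"
proof (induction arbitrary: v rule: rtrancl_induct)
  case (step y w)
  consider "y = v" | "(y, v) \<in> inc" | "(v, y) \<in> inc" using inc_upper[OF step(2,4)] by blast
  then show ?case
  proof cases
    case 1
    then show ?thesis using step(1) by blast
  next
    case 2
    then show ?thesis using rtrancl_into_rtrancl[OF step(1)] by blast
  next
    case 3
    then show ?thesis by (rule step(3))
  qed
qed auto

lemma inc_path_lower:
  "(w, u) \<in> inc\<^sup>* \<Longrightarrow> (w, v) \<in> inc \<Longrightarrow> (u, v) \<in> inc\<^sup>* \<or> (v, u) \<in> inc\<^sup>*"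
proof (induction arbitrary: v rule: converse_rtrancl_induct)
  case (step w y)
  consider "y = v" | "(y, v) \<in> inc" | "(v, y) \<in> inc" using inc_lower[OF step(1,4)] by blast
  then show ?case
  proof cases
    case 1
    then show ?thesis using step(2) by blast
  next
    case 2
    then show ?thesis by (rule step(3))
  next
    case 3
    then show ?thesis using converse_rtrancl_into_rtrancl[OF _ step(2)] by blast
  qed
qed auto

text \<open>A walk with a local maximum or minimum can be shortened, so any two vertices are joined by a
  path with monotone labels.\<close>

lemma inc_connected: "(u, v) \<in> inc\<^sup>* \<or> (v, u) \<in> inc\<^sup>*"
proof -
  have "(u, v) \<in> {(a, b). {a, b} \<in> G}\<^sup>*" using conn by (simp add: connected_graph_def)
  then show ?thesis
  proof (induction rule: rtrancl_induct)
    case (step w v)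
    then have "(w, v) \<in> inc \<or> (v, w) \<in> inc" using inc_cases by blast
    then show ?case
      using step.IH inc_path_upper[of u w v] inc_path_lower[of w u v]
        rtrancl_into_rtrancl[of u w inc v] converse_rtrancl_into_rtrancl[of v w inc u] by blast
  qed auto
qed

lemma inc_path_label: "(u, v) \<in> inc\<^sup>* \<Longrightarrow> label u \<le> label v"
  by (induction rule: rtrancl_induct) (auto simp: inc_def)

section \<open>Edges as intervals of labels\<close>

definition vx :: "nat \<Rightarrow> 'n" where
  "vx = inv_into UNIV label"

lemma label_vx: "i \<in> {1..N} \<Longrightarrow> label (vx i) = i"
  unfolding vx_def using bij by (metis bij_betw_inv_into_right)

lemma vx_label: "vx (label u) = u"
  unfolding vx_def using bij by (simp add: bij_betw_def)

lemma label_range: "1 \<le> label u" "label u \<le> N"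
  using bij by (auto simp: bij_betw_def)

definition adj :: "nat \<Rightarrow> nat \<Rightarrow> bool" where
  "adj i j \<longleftrightarrow> {vx i, vx j} \<in> G"

text \<open>A path with increasing labels between consecutive labels has no room for an inner
  vertex, so it is a single edge.\<close>

lemma adj_Suc:
  assumes "1 \<le> i" "i < N"
  shows "adj i (Suc i)"
proof -
  have l: "label (vx i) = i" "label (vx (Suc i)) = Suc i" using assms label_vx by auto
  have "(vx i, vx (Suc i)) \<in> inc\<^sup>*"
    using inc_connected[of "vx i" "vx (Suc i)"] inc_path_label[of "vx (Suc i)" "vx i"] l by auto
  moreover have "vx i \<noteq> vx (Suc i)" using l by force
  ultimately obtain y where y: "(vx i, y) \<in> inc" "(y, vx (Suc i)) \<in> inc\<^sup>*" by (meson converse_rtranclE)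
  then have "label y = Suc i" using inc_path_label[OF y(2)] l by (auto simp: inc_def)
  then have "y = vx (Suc i)" using l label_eq by metis
  then show ?thesis using y(1) by (simp add: inc_def adj_def)
qed

lemma adj_left:
  assumes "1 \<le> i" "i < j" "j < k" "k \<le> N" "adj i k" "adj j k"
  shows "adj i j"
proof -
  have "label (vx i) = i" "label (vx j) = j" "label (vx k) = k" using assms label_vx by auto
  moreover from this have "vx i \<noteq> vx j" using assms by (metis less_irrefl)
  ultimately show ?thesis using closed[of "vx i" "vx k" "vx j" "vx k"] assms by (simp add: adj_def)
qed

lemma adj_right:
  assumes "1 \<le> i" "i < j" "j < k" "k \<le> N" "adj i j" "adj i k"
  shows "adj j k"
proof -
  have "label (vx i) = i" "label (vx j) = j" "label (vx k) = k" using assms label_vx by auto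
  moreover from this have "vx j \<noteq> vx k" using assms by (metis less_irrefl)
  ultimately show ?thesis using closed[of "vx i" "vx j" "vx i" "vx k"] assms by (simp add: adj_def)
qed

text \<open>Descend from \<open>j\<close>: the pairs (i, n + 1) and (n, n + 1) share their upper
  end, so \<open>i\<close> and \<open>n\<close> are adjacent.\<close>

lemma adj_shrink_right:
  assumes "1 \<le> i" "i < b" "b \<le> j" "j \<le> N" "adj i j"
  shows "adj i b"
  using assms(3,2)
proof (induction rule: inc_induct)
  case base
  show ?case using assms by simp
next
  case (step n)
  then have "adj i (Suc n)" by simp
  moreover have "adj n (Suc n)" using adj_Suc[of n] step assms by auto
  ultimately show ?case using adj_left[of i n "Suc n"] step assms by auto
qed

text \<open>An edge makes a clique of the whole interval it spans: shrink its right end to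
  \<open>b\<close> and to \<open>a\<close>, then compare these two neighbours of
  \<open>i\<close>.\<close>

lemma adj_interval:
  assumes "1 \<le> i" "i \<le> a" "a < b" "b \<le> j" "j \<le> N" "adj i j"
  shows "adj a b"
proof -
  have ib: "adj i b" using adj_shrink_right[of i b j] assms by auto
  show ?thesis
  proof (cases "i = a")
    case False
    then have "adj i a" using adj_shrink_right[of i a j] assms by auto
    then show ?thesis using adj_right[of i a b] ib assms False by auto
  qed (use ib in simp)
qed

section \<open>The greedy path\<close>

definition reach :: "nat \<Rightarrow> nat" where
  "reach i = Max {j. i < j \<and> j \<le> N \<and> adj i j}"

lemma reach:
  assumes "1 \<le> i" "i < N"
  shows "i < reach i" "reach i \<le> N" "adj i (reach i)"
    and "\<And>j. i < j \<Longrightarrow> j \<le> N \<Longrightarrow> adj i j \<Longrightarrow> j \<le> reach i"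
proof -
  let ?S = "{j. i < j \<and> j \<le> N \<and> adj i j}"
  have fin: "finite ?S" by (rule finite_subset[of _ "{..N}"]) auto
  have "Suc i \<in> ?S" using assms adj_Suc by auto
  then have "reach i \<in> ?S" unfolding reach_def using Max_in[OF fin] by blast
  then show "i < reach i" "reach i \<le> N" "adj i (reach i)" by auto
  show "j \<le> reach i" if "i < j" "j \<le> N" "adj i j" for j
    unfolding reach_def using Max_ge[OF fin] that by blast
qed

text \<open>Standing still at \<open>N\<close>, where \<open>reach\<close> has no meaning, makes the
  sequence total; its length is the first index with value \<open>N\<close>.\<close>

primrec pos :: "nat \<Rightarrow> nat" where
  "pos 0 = 1"
| "pos (Suc s) = (if pos s < N then reach (pos s) else pos s)"

lemma greedy_path:
  assumes N: "2 \<le> N"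
  shows "\<exists>l c. 0 < l \<and> inj_on c {..l} \<and> (\<forall>i<l. {c i, c (Suc i)} \<in> G)
    \<and> (\<forall>i j. i \<le> l \<longrightarrow> j \<le> l \<longrightarrow> {c i, c j} \<in> G \<longrightarrow> j = Suc i \<or> i = Suc j)
    \<and> (if l = 1 then \<forall>u v. u \<noteq> v \<longrightarrow> {u, v} \<in> G
        else \<forall>u. \<exists>s. 1 \<le> s \<and> s < l \<and> (u = c s \<or> {u, c s} \<in> G))"
proof -
  have pos_range: "1 \<le> pos s \<and> pos s \<le> N" for s
  proof (induction s)
    case (Suc s)
    then show ?case using reach[of "pos s"] by auto
  qed (use N in auto)
  have pos_ge: "pos s = N \<or> s < pos s" for s
  proof (induction s)
    case (Suc s)
    then show ?case using reach[of "pos s"] pos_range[of s] by fastforce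
  qed simp
  define l where "l = (LEAST s. pos s = N)"
  have "pos N = N" using pos_ge[of N] pos_range[of N] by auto
  then have posl: "pos l = N" unfolding l_def by (rule LeastI)
  have lt: "pos s < N" if "s < l" for s
    using not_less_Least[of s "\<lambda>s. pos s = N"] that pos_range[of s] by (fastforce simp: l_def)
  have l: "0 < l" using posl N by (cases l) auto
  have step: "pos (Suc s) = reach (pos s)" if "s < l" for s using lt[OF that] by simp
  have inc1: "pos s < pos (Suc s)" "adj (pos s) (pos (Suc s))" if "s < l" for s
    using step[OF that] reach[of "pos s"] lt[OF that] pos_range[of s] by auto
  have less: "pos s < pos t" if "s < t" "t \<le> l" for s t
    using that
  proof (induction t)
    case (Suc t)
    then show ?case using inc1(1)[of t] by (cases "s = t") (auto simp del: pos.simps)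
  qed simp
  define c where "c s = vx (pos s)" for s
  have lab: "label (c s) = pos s" for s using pos_range[of s] by (simp add: c_def label_vx)
  have "inj_on c {..l}"
  proof (rule inj_onI)
    fix s t assume "s \<in> {..l}" "t \<in> {..l}" "c s = c t"
    then have "pos s = pos t" using lab by metis
    then show "s = t" using less[of s t] less[of t s] \<open>s \<in> {..l}\<close> \<open>t \<in> {..l}\<close>
      by (metis atMost_iff less_irrefl linorder_neqE_nat)
  qed
  moreover have "\<forall>i<l. {c i, c (Suc i)} \<in> G" using inc1(2) by (simp add: adj_def c_def del: pos.simps)
  moreover have "j = Suc i \<or> i = Suc j" if ij: "i \<le> l" "j \<le> l" "{c i, c j} \<in> G" for i j
  proof -
    have *: "j = Suc i" if "i < j" "j \<le> l" "adj (pos i) (pos j)" for i j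
    proof -
      \<comment> \<open>No chord can skip a vertex, because the greedy step already goes to the
        furthest neighbour.\<close>
      have "pos j \<le> pos (Suc i)"
        using reach(4)[of "pos i" "pos j"] less[OF that(1,2)] that pos_range lt[of i] step[of i] by auto
      then have "\<not> Suc i < j" using less[of "Suc i" j] that by auto
      then show ?thesis using that by simp
    qed
    have "i \<noteq> j" using ij(3) G unfolding simple_graph_def by force
    then consider "i < j" | "j < i" by linarith
    then show ?thesis
      using *[of i j] *[of j i] ij by cases (auto simp: adj_def c_def insert_commute)
  qed
  moreover have "{u, v} \<in> G" if l1: "l = 1" and uv: "u \<noteq> v" for u v
  proof -
    have A: "adj 1 N" using inc1(2)[of 0] posl l1 by simp
    have *: "{u, v} \<in> G" if "label u < label v" for u v
      using adj_interval[of 1 "label u" "label v" N] A label_range[of u] label_range[of v] that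
      by (simp add: adj_def vx_label)
    show ?thesis using *[of u v] *[of v u] uv label_eq[of u v] by (cases "label u < label v") (auto simp: insert_commute)
  qed
  moreover have "\<exists>s. 1 \<le> s \<and> s < l \<and> (u = c s \<or> {u, c s} \<in> G)" if l1: "l \<noteq> 1" for u
  proof -
    \<comment> \<open>Consecutive path vertices span a clique of labels, so a vertex between them
      equals or meets either end.\<close>
    have near: "u = c r \<or> {u, c r} \<in> G"
      if "pos s \<le> label u" "label u \<le> pos (Suc s)" "s < l" "r = s \<or> r = Suc s" for s r
    proof -
      have A: "adj (pos s) (pos (Suc s))" by (rule inc1(2)[OF that(3)])
      have "label u = pos r \<or> adj (label u) (pos r)"
      proof (cases "r = s")
        case True
        then show ?thesis
          using adj_interval[OF _ order_refl _ that(2) _ A, of] that(1) pos_range[of s] pos_range[of "Suc s"]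
          by (cases "label u = pos s") (auto simp: adj_def insert_commute simp del: pos.simps)
      next
        case False
        then show ?thesis
          using adj_interval[OF _ that(1) _ order_refl _ A] that(2,4) pos_range[of s] pos_range[of "Suc s"]
          by (cases "label u = pos (Suc s)") (auto simp del: pos.simps)
      qed
      then show ?thesis
        using label_eq[of u "c r"] lab[of r] vx_label[of u] by (auto simp: adj_def c_def)
    qed
    have "\<exists>s<l. pos s \<le> label u \<and> label u \<le> pos (Suc s)"
    proof -
      define s where "s = (GREATEST s. s < l \<and> pos s \<le> label u)"
      have P: "s < l \<and> pos s \<le> label u"
        unfolding s_def by (rule GreatestI_nat[of _ 0 l]) (use l label_range in auto)
      have "label u \<le> pos (Suc s)"
      proof (cases "Suc s < l")
        case True
        then have "\<not> pos (Suc s) \<le> label u"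
          using Greatest_le_nat[of "\<lambda>s. s < l \<and> pos s \<le> label u" "Suc s" l] unfolding s_def[symmetric] by auto
        then show ?thesis by simp
      next
        case False
        then have "Suc s = l" using P by simp
        then show ?thesis using posl label_range[of u] by (simp del: pos.simps)
      qed
      then show ?thesis using P by blast
    qed
    then obtain s where s: "s < l" "pos s \<le> label u" "label u \<le> pos (Suc s)" by blast
    show ?thesis
    \<comment> \<open>\<open>c 0\<close> is not an inner vertex. In the first interval the right end
      \<open>c 1\<close> is taken, which is inner since \<open>l\<close> is at least 2; otherwise
      the left end.\<close>
    proof (cases "s = 0")
      case True
      then show ?thesis using near[OF s(2,3,1), of 1] l l1 by (intro exI[of _ 1]) auto
    next
      case False
      then show ?thesis using near[OF s(2,3,1), of s] s(1) by (intro exI[of _ s]) auto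
    qed
  qed
  ultimately show ?thesis using l by (intro exI[of _ l] exI[of _ c]) auto
qed

end

section \<open>Comparison of the two bounds\<close>

theorem proposition10p1:
  fixes G :: "'n::{finite, linorder} set set" and k :: nat
  assumes "simple_graph G" and "connected_graph G" and "closed_graph G" and "k \<ge> 1"
  shows "ereal (real (v_number (ideal_power (binomial_edge_ideal G :: ('n, 'k::field) xy_poly set) k)))
    \<le> regularity (ideal_power (binomial_edge_ideal G :: ('n, 'k) xy_poly set) k)"
proof -
  obtain k' where k: "k = Suc k'" using assms(4) by (cases k) auto
  define J :: "('n, 'k) xy_poly set" where "J = binomial_edge_ideal G"
  obtain label :: "'n \<Rightarrow> nat" where "bij_betw label UNIV {1..card (UNIV :: 'n set)}"
    "\<And>i j k l. {i, j} \<in> G \<Longrightarrow> {k, l} \<in> G \<Longrightarrow> label i < label j \<Longrightarrow> label k < label l \<Longrightarrow>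
        (i = k \<and> j \<noteq> l \<longrightarrow> {j, l} \<in> G) \<and> (j = l \<and> i \<noteq> k \<longrightarrow> {i, k} \<in> G)"
    using assms(3) unfolding closed_graph_def by blast
  then interpret closed_labelling G label "card (UNIV :: 'n set)"
    using assms by unfold_locales
  show ?thesis
  proof (cases "2 \<le> card (UNIV :: 'n set)")
    case False
    \<comment> \<open>With one vertex there is no edge, and the zero ideal is prime: the element 1
      gives v-number 0, and the generator in degree 0 gives regularity at least 0.\<close>
    have "is_singleton (UNIV :: 'n set)"
      using False by (metis One_nat_def Suc_1 UNIV_not_empty card_0_eq finite is_singleton_altdef less_2_cases_iff not_le)
    then have "G = {}"
      using assms(1) unfolding simple_graph_def is_singleton_altdef
      by (metis (no_types) False card_mono ex_in_conv finite top_greatest)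
    then have J0: "J = {0}" by (simp add: J_def binomial_edge_ideal_def)
    have Jk: "ideal_power J k = {0}"
    proof
      show "ideal_power J k \<subseteq> {0}"
        using ideal_power_subset[of J k] assms(4) J0 by (simp add: J_def is_ideal_binomial_edge_ideal)
      show "{0} \<subseteq> ideal_power J k" using ring_module.subspace_0[OF is_ideal_ideal_power] by blast
    qed
    have "v_number (ideal_power J k) \<le> 0"
    proof (rule v_number_le)
      show "1 \<in> graded_component (int 0)" using graded_component_const[of 1] by simp
      show "is_prime_ideal (ideal_colon (ideal_power J k) 1)"
        unfolding Jk by (auto simp: ideal_colon_def is_prime_ideal_def ring_module.subspace_def dest: arg_cong[of _ _ "\<lambda>S. 1 \<in> S"])
    qed
    moreover have "ereal (real_of_int 0) \<le> regularity (ideal_power J k)"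
    proof (rule regularity_ge[where i = 0])
      show "graded_ideal (ideal_power J k)" unfolding J_def by (intro graded_ideal_power graded_binomial_edge_ideal)
      show "ideal_power J k \<subseteq> irrelevant_ideal" unfolding Jk irrelevant_ideal_def using ring_module.span_zero by auto
      show "\<exists>r<length (D 0). 0 + int 0 \<le> int (D 0 ! r)" if "minimal_graded_free_resolution (ideal_power J k) D M" for D M
        using that unfolding minimal_graded_free_resolution_def by auto
    qed
    ultimately show ?thesis by (simp add: J_def)
  next
    case True
    obtain l c where l: "0 < l" and inj: "inj_on c {..l}" and edge: "\<And>i. i < l \<Longrightarrow> {c i, c (Suc i)} \<in> G"
      and induced: "\<And>i j. i \<le> l \<Longrightarrow> j \<le> l \<Longrightarrow> {c i, c j} \<in> G \<Longrightarrow> j = Suc i \<or> i = Suc j"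
      and dom: "if l = 1 then \<forall>u v. u \<noteq> v \<longrightarrow> {u, v} \<in> G
        else \<forall>u. \<exists>s. 1 \<le> s \<and> s < l \<and> (u = c s \<or> {u, c s} \<in> G)"
      using greedy_path[OF True] by auto
    have complete: "(\<Prod>i\<in>{1..<l}. x_var (c i)) * minor u v \<in> J" for u v
    proof (cases "l = 1")
      case True
      then have "u \<noteq> v \<Longrightarrow> {u, v} \<in> G" using dom by simp
      then have "minor u v \<in> J"
        using minor_mem[OF assms(1), of u v] ring_module.subspace_0[OF is_ideal_binomial_edge_ideal]
        by (cases "u = v") (auto simp: J_def)
      then show ?thesis using True by simp
    next
      case False
      show ?thesis unfolding J_def
        by (rule dominating_path_completes[OF assms(1)]) (use edge dom False in auto)
    qed
    have inj': "inj_on c {1..<l}" using inj by (rule inj_on_subset) auto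
    have "v_number (ideal_power J (Suc k')) \<le> 2 * k' + card (c ` {1..<l})"
      unfolding J_def
      by (rule v_number_binomial_edge_power_le[OF assms(1) edge[OF l]])
        (simp only: prod.reindex[OF inj'] comp_def J_def[symmetric] complete)
    also have "\<dots> \<le> 2 * k' + l" using card_image[OF inj'] by simp
    finally have "ereal (real (v_number (ideal_power J k))) \<le> ereal (real (2 * k' + l))"
      by (simp only: k ereal_less_eq(3) of_nat_le_iff)
    also have "\<dots> \<le> regularity (ideal_power J k)"
      unfolding J_def k by (rule regularity_ge_path[OF assms(1) inj l edge induced])
    finally show ?thesis by (simp add: J_def)
  qed
qed

end
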